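(* Let $\delta\in(0,1)$, $n\in\mathbb N$, and let $\lambda\in(0,s]$ satisfy $$\mathcal B_{n,\lambda}\log\left(\tfrac{2}{\delta}\right)\le \tfrac{\sqrt\lambda}{2},\qquad \mathcal B_{n,\lambda}:=2\left(\frac{2b\kappa^2}{\sqrt\lambda\,n}+\sqrt{\frac{b\kappa^2\mathcal N(\lambda)}{n}}\right).$$ Assume: (1) $k(x,x)\le\kappa^2$ for all $x\in X$; (2) $dq_X=\beta\,dp_X$ with $0\le\beta(x)\le b$ for all $x\in X$; (3) $\|y\|_Y\le M'$ for $p$-almost every $(x,y)$; (4) $f^*=C_*\phi(\cdot)$ with $C_*=C_o\,\varphi(C_X)$ for some $C_o\in\mathcal S_2(\mathcal H,Y)$ and an index function $\varphi$. Assume further that the qualification $\nu$ of the regularization family $\{g_\lambda\}$ covers the index function $t\mapsto\varphi(t)\sqrt t$, with covering constant $c$. Then, with probability at least $1-\delta$ over the i.i.d. sample $\mathbf z$ from $p$, $$\big\|f^*-\widehat f_{\mathbf z,\lambda}\big\|_{L_2(q_X,Y)}\le\left(\frac{A_1}{n}\sqrt{\frac1\lambda}+A_2\sqrt{\frac{\mathcal N(\lambda)}{n}}\right)\log\left(\frac2\delta\right)+A_3\sqrt\lambda\,\varphi(\lambda),$$ where, with $\bar\nu:=\lfloor\nu-1/2\rfloor$ and $M:=M'+\kappa\|C_*\|_{\mathcal S_2(\mathcal H,Y)}$, $$A_1=2^{2\nu-\bar\nu+2}(\gamma_\nu+\gamma)\max\left(1,\tfrac1c\right)\bar\nu\,b\,\kappa^2\|C_*\|_{\mathcal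 S_2(\mathcal H,Y)}+10\,b\,M\,\kappa\,(B+D),$$ $$A_2=2^{2\nu-\bar\nu+1}(\gamma_\nu+\gamma)\max\left(1,\tfrac1c\right)\bar\nu\,\sqrt b\,\kappa\,\|C_*\|_{\mathcal S_2(\mathcal H,Y)}+5\,M\sqrt b\,(B+D),$$ $$A_3=2^{2\nu-\bar\nu}(\gamma_\nu+\gamma)\max\left(1,\tfrac1c\right)\|C_o\|_{\mathcal S_2(\mathcal H,Y)}.$$
   Context: Spaces. $X$ is a second-countable locally compact Hausdorff space and $Y$ an infinite-dimensional real separable Hilbert space. $k:X\times X\to\mathbb R$ is the reproducing kernel of a separable scalar RKHS $\mathcal H$, with measurable feature map $\phi(x)=k(x,\cdot)\in\mathcal H$. $\mathcal S_2(\mathcal H,Y)$ is the space of Hilbert–Schmidt operators $\mathcal H\to Y$; $\|\cdot\|_{op}$ is the operator norm; $a\otimes a'$ denotes the operator $v\mapsto\langle v,a'\rangle a$. (Note: $\phi$ is the feature map, $\varphi$ an index function.) Data (covariate shift). $p$ and $q$ are probability distributions on $X\times Y$ with the same conditional distribution $p(y|x)$ and marginals $p_X,q_X$ on $X$, i.e. $p(x,y)=p(y|x)p_X(x)$, $q(x,y)=p(y|x)q_X(x)$. The common regression function is $f^*(x)=\int_Y y\,dp(y|x)$. The sample $\mathbf z=\{(x_i,y_i)\}_{i=1}^n$ is i.i.d. from $p$. The weight function $\beta=dq_X/dp_X:X\to[0,\infty)$ is known exactly. $L_2(q_X,Y)$ is the Bochner space of $q_X$-square-integrable $Y$-valued functions.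 Operators. $C_X=\mathbb E_{x\sim q_X}[\phi(x)\otimes\phi(x)]=\mathbb E_{x\sim p_X}[\beta(x)\,\phi(x)\otimes\phi(x)]$ on $\mathcal H$; $\widehat C_X^\beta=\frac1n\sum_{i=1}^n\beta(x_i)\phi(x_i)\otimes\phi(x_i)$; $\widehat C_{YX}^\beta=\frac1n\sum_{i=1}^n\beta(x_i)\,y_i\otimes\phi(x_i)$. Effective dimension: $\mathcal N(\lambda)=\mathrm{Tr}\big(C_X(C_X+\lambda I)^{-1}\big)$. Regularization family. A family of functions $g_\lambda:[0,s]\to\mathbb R$, $0<\lambda\le s$ (with $s\ge b\kappa^2$, so that $g_\lambda(\widehat C_X^\beta)$ is defined by functional calculus), with constants $B,D,\gamma>0$ independent of $\lambda$ such that $\sup_{\sigma\in(0,s]}|\sigma g_\lambda(\sigma)|\le D$, $\sup_{\sigma\in(0,s]}|g_\lambda(\sigma)|\le B/\lambda$, $\sup_{\sigma\in(0,s]}|1-\sigma g_\lambda(\sigma)|\le\gamma$. Its qualification is the largest $\nu>0$ for which $\sup_{\sigma\in(0,s]}|1-\sigma g_\lambda(\sigma)|\sigma^\nu\le\gamma_\nu\lambda^\nu$ with $\gamma_\nu$ independent of $\lambda$. Index function: a continuous strictly increasing $\varphi:[0,\infty)\to[0,\infty)$ with $\varphi(0)=0$. The qualification $\nu$ covers an index function $\psi$ (with constant $c>0$) if $c\,\frac{t^\nu}{\psi(t)}\le\inf_{t\le\sigma\le s}\frac{\sigma^\nu}{\psi(\sigma)}$ for all $0<t\le s$. Estimator: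 $\widehat f_{\mathbf z,\lambda}(x)=\widehat C_\lambda^\beta\phi(x)$ with $\widehat C_\lambda^\beta=\widehat C_{YX}^\beta\,g_\lambda(\widehat C_X^\beta)$. *)

theory Defs
  imports "HOL-Probability.Probability"
begin

section \<open>Operators on Hilbert spaces\<close>

text \<open>A real Hilbert space is a type of sort \<open>{real_inner, banach}\<close>; adding
  \<open>second_countable_topology\<close> makes it separable.\<close>

lift_definition tensor_op :: "'a::real_inner \<Rightarrow> 'b::real_inner \<Rightarrow> 'b \<Rightarrow>\<^sub>L 'a"
  is "\<lambda>a a' v. (v \<bullet> a') *\<^sub>R a"
  by (intro bounded_linear_scaleR_const bounded_linear_inner_left)

definition orthonormal_basis :: "'a::{real_inner,banach} set \<Rightarrow> bool" where
  "orthonormal_basis B \<longleftrightarrow>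
     pairwise orthogonal B \<and> (\<forall>e\<in>B. norm e = 1) \<and> closure (span B) = UNIV"

text \<open>The trace and the Hilbert--Schmidt norm do not depend on the basis, so one is chosen.\<close>

definition some_onb :: "'a::{real_inner,banach} set" where
  "some_onb = (SOME B. orthonormal_basis B)"

definition op_trace :: "('a::{real_inner,banach} \<Rightarrow> 'a) \<Rightarrow> real" where
  "op_trace T = (\<Sum>\<^sub>\<infinity>e\<in>some_onb. T e \<bullet> e)"

definition hilbert_schmidt ::
    "('a::{real_inner,banach} \<Rightarrow>\<^sub>L 'b::{real_inner,banach}) \<Rightarrow> bool" where
  "hilbert_schmidt T \<longleftrightarrow> (\<lambda>e. (norm (blinfun_apply T e))\<^sup>2) summable_on some_onb"

definition hs_norm :: "('a::{real_inner,banach} \<Rightarrow>\<^sub>L 'b::{real_inner,banach}) \<Rightarrow> real" where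
  "hs_norm T = sqrt (\<Sum>\<^sub>\<infinity>e\<in>some_onb. (norm (blinfun_apply T e))\<^sup>2)"

definition eigenspace :: "('a::real_normed_vector \<Rightarrow>\<^sub>L 'a) \<Rightarrow> real \<Rightarrow> 'a set" where
  "eigenspace T \<mu> = {v. blinfun_apply T v = \<mu> *\<^sub>R v}"

definition eigenvalues :: "('a::real_normed_vector \<Rightarrow>\<^sub>L 'a) \<Rightarrow> real set" where
  "eigenvalues T = {\<mu>. \<exists>v. v \<noteq> 0 \<and> v \<in> eigenspace T \<mu>}"

definition orth_proj :: "'a::{real_inner,banach} set \<Rightarrow> 'a \<Rightarrow> 'a" where
  "orth_proj S v = (THE u. u \<in> S \<and> (\<forall>w\<in>S. orthogonal (v - u) w))"

text \<open>Functional calculus for a compact self-adjoint operator with spectral decomposition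
  \<open>T = \<Sum>\<mu>. \<mu> P\<^sub>\<mu>\<close>, where \<open>P\<^sub>\<mu>\<close> projects onto the eigenspace of \<open>\<mu>\<close>. The eigenvalue \<open>0\<close>
  is included, so that \<open>f 0\<close> acts on the kernel of \<open>T\<close>. All operators to which this is
  applied below are compact and self-adjoint (trace class or finite rank).\<close>

definition fun_calc ::
    "(real \<Rightarrow> real) \<Rightarrow> ('a::{real_inner,banach} \<Rightarrow>\<^sub>L 'a) \<Rightarrow> ('a \<Rightarrow>\<^sub>L 'a)" where
  "fun_calc f T =
     Blinfun (\<lambda>v. \<Sum>\<^sub>\<infinity>\<mu>\<in>eigenvalues T. f \<mu> *\<^sub>R orth_proj (eigenspace T \<mu>) v)"

section \<open>Reproducing kernel Hilbert spaces\<close>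

text \<open>A Hilbert space of functions on \<open>'x\<close> is a Hilbert space type \<open>'h\<close> together with an
  injective linear map \<open>fn\<close> turning an element of \<open>'h\<close> into the function it is.\<close>

definition is_rkhs ::
    "('x \<Rightarrow> 'x \<Rightarrow> real) \<Rightarrow> ('h::{real_inner,banach} \<Rightarrow> 'x \<Rightarrow> real) \<Rightarrow> bool" where
  "is_rkhs k fn \<longleftrightarrow>
     (\<forall>x. linear (\<lambda>h. fn h x)) \<and> inj fn \<and>
     (\<forall>x. \<exists>u. fn u = k x \<and> (\<forall>h. fn h x = h \<bullet> u))"

definition feature_map ::
    "('x \<Rightarrow> 'x \<Rightarrow> real) \<Rightarrow> ('h::{real_inner,banach} \<Rightarrow> 'x \<Rightarrow> real) \<Rightarrow> 'x \<Rightarrow> 'h" where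
  "feature_map k fn x = the_inv fn (k x)"

section \<open>Covariate shift\<close>

definition marginal_X ::
    "('x::topological_space \<times> 'y::topological_space) measure \<Rightarrow> 'x measure" where
  "marginal_X p = distr p borel fst"

definition has_conditional ::
    "('x::topological_space \<times> 'y::topological_space) measure \<Rightarrow> ('x \<Rightarrow> 'y measure) \<Rightarrow> bool" where
  "has_conditional p K \<longleftrightarrow>
     p = do { x \<leftarrow> marginal_X p; y \<leftarrow> K x; return (borel \<Otimes>\<^sub>M borel) (x, y) }"

definition covariate_shift ::
    "('x::topological_space \<times> 'y::topological_space) measure \<Rightarrow> ('x \<times> 'y) measure \<Rightarrow>
     ('x \<Rightarrow> 'y measure) \<Rightarrow> bool" where
  "covariate_shift p q K \<longleftrightarrow>
     prob_space p \<and> sets p = sets (borel \<Otimes>\<^sub>M borel) \<and>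
     prob_space q \<and> sets q = sets (borel \<Otimes>\<^sub>M borel) \<and>
     K \<in> borel \<rightarrow>\<^sub>M prob_algebra borel \<and>
     has_conditional p K \<and> has_conditional q K"

definition regression_fun ::
    "('x \<Rightarrow> 'y measure) \<Rightarrow> 'x \<Rightarrow> 'y::{banach,second_countable_topology}" where
  "regression_fun K x = (\<integral>y. y \<partial>K x)"

definition in_L2 ::
    "'x measure \<Rightarrow> ('x \<Rightarrow> 'y::{banach,second_countable_topology}) \<Rightarrow> bool" where
  "in_L2 M h \<longleftrightarrow> h \<in> borel_measurable M \<and> integrable M (\<lambda>x. (norm (h x))\<^sup>2)"

definition L2_norm ::
    "'x measure \<Rightarrow> ('x \<Rightarrow> 'y::{banach,second_countable_topology}) \<Rightarrow> real" where
  "L2_norm M h = sqrt (\<integral>x. (norm (h x))\<^sup>2 \<partial>M)"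

section \<open>Covariance operators and the estimator\<close>

text \<open>The space of bounded operators is not second countable, so the Bochner integral of the
  operator-valued map \<open>\<phi> \<otimes> \<phi>\<close> is taken vectorwise.\<close>

definition cov_op ::
    "'x measure \<Rightarrow> ('x \<Rightarrow> 'h::{real_inner,banach,second_countable_topology}) \<Rightarrow> ('h \<Rightarrow>\<^sub>L 'h)" where
  "cov_op M \<phi> = Blinfun (\<lambda>v. \<integral>x. blinfun_apply (tensor_op (\<phi> x) (\<phi> x)) v \<partial>M)"

definition emp_cov ::
    "('x \<Rightarrow> 'h::{real_inner,banach}) \<Rightarrow> ('x \<Rightarrow> real) \<Rightarrow> nat \<Rightarrow> (nat \<Rightarrow> 'x \<times> 'y) \<Rightarrow> ('h \<Rightarrow>\<^sub>L 'h)" where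
  "emp_cov \<phi> \<beta> n z =
     (1 / real n) *\<^sub>R (\<Sum>i<n. \<beta> (fst (z i)) *\<^sub>R tensor_op (\<phi> (fst (z i))) (\<phi> (fst (z i))))"

definition emp_cross_cov ::
    "('x \<Rightarrow> 'h::{real_inner,banach}) \<Rightarrow> ('x \<Rightarrow> real) \<Rightarrow> nat \<Rightarrow>
     (nat \<Rightarrow> 'x \<times> 'y::{real_inner,banach}) \<Rightarrow> ('h \<Rightarrow>\<^sub>L 'y)" where
  "emp_cross_cov \<phi> \<beta> n z =
     (1 / real n) *\<^sub>R (\<Sum>i<n. \<beta> (fst (z i)) *\<^sub>R tensor_op (snd (z i)) (\<phi> (fst (z i))))"

definition effective_dim :: "('h::{real_inner,banach} \<Rightarrow>\<^sub>L 'h) \<Rightarrow> real \<Rightarrow> real" where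
  "effective_dim C lam =
     op_trace (blinfun_apply C \<circ> inv (blinfun_apply (C + lam *\<^sub>R id_blinfun)))"

definition estimator ::
    "('x \<Rightarrow> 'h::{real_inner,banach}) \<Rightarrow> ('x \<Rightarrow> real) \<Rightarrow> (real \<Rightarrow> real \<Rightarrow> real) \<Rightarrow> real \<Rightarrow> nat \<Rightarrow>
     (nat \<Rightarrow> 'x \<times> 'y::{real_inner,banach}) \<Rightarrow> 'x \<Rightarrow> 'y" where
  "estimator \<phi> \<beta> g lam n z x =
     blinfun_apply (emp_cross_cov \<phi> \<beta> n z o\<^sub>L fun_calc (g lam) (emp_cov \<phi> \<beta> n z)) (\<phi> x)"

section \<open>Regularization families and index functions\<close>

text \<open>Only the values \<open>g lam \<sigma>\<close> with \<open>0 < lam \<le> s\<close> and \<open>0 \<le> \<sigma> \<le> s\<close> are meaningful.\<close>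

definition regularization_family ::
    "real \<Rightarrow> (real \<Rightarrow> real \<Rightarrow> real) \<Rightarrow> real \<Rightarrow> real \<Rightarrow> real \<Rightarrow> bool" where
  "regularization_family s g B D \<gamma> \<longleftrightarrow>
     B > 0 \<and> D > 0 \<and> \<gamma> > 0 \<and>
     (\<forall>lam\<in>{0<..s}. \<forall>\<sigma>\<in>{0<..s}.
        \<bar>\<sigma> * g lam \<sigma>\<bar> \<le> D \<and> \<bar>g lam \<sigma>\<bar> \<le> B / lam \<and> \<bar>1 - \<sigma> * g lam \<sigma>\<bar> \<le> \<gamma>)"

definition qualification_bound ::
    "real \<Rightarrow> (real \<Rightarrow> real \<Rightarrow> real) \<Rightarrow> real \<Rightarrow> real \<Rightarrow> bool" where
  "qualification_bound s g \<nu> \<gamma>\<^sub>\<nu> \<longleftrightarrow>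
     (\<forall>lam\<in>{0<..s}. \<forall>\<sigma>\<in>{0<..s}. \<bar>1 - \<sigma> * g lam \<sigma>\<bar> * \<sigma> powr \<nu> \<le> \<gamma>\<^sub>\<nu> * lam powr \<nu>)"

definition is_qualification :: "real \<Rightarrow> (real \<Rightarrow> real \<Rightarrow> real) \<Rightarrow> real \<Rightarrow> bool" where
  "is_qualification s g \<nu> \<longleftrightarrow>
     \<nu> > 0 \<and> (\<exists>\<gamma>'. qualification_bound s g \<nu> \<gamma>') \<and>
     (\<forall>\<nu>'>0. (\<exists>\<gamma>'. qualification_bound s g \<nu>' \<gamma>') \<longrightarrow> \<nu>' \<le> \<nu>)"

definition index_function :: "(real \<Rightarrow> real) \<Rightarrow> bool" where
  "index_function \<psi> \<longleftrightarrow>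
     continuous_on {0..} \<psi> \<and> strict_mono_on {0..} \<psi> \<and> \<psi> 0 = 0"

definition covers :: "real \<Rightarrow> real \<Rightarrow> real \<Rightarrow> (real \<Rightarrow> real) \<Rightarrow> bool" where
  "covers s \<nu> c \<psi> \<longleftrightarrow> c > 0 \<and>
     (\<forall>t\<in>{0<..s}. c * (t powr \<nu> / \<psi> t) \<le> (INF \<sigma>\<in>{t..s}. \<sigma> powr \<nu> / \<psi> \<sigma>))"

end

theory Submission
  imports Defs "HOL-Computational_Algebra.Fundamental_Theorem_Algebra"
begin

text \<open>
  Write \<open>C = C\<^sub>X\<close>, \<open>Ch\<close> for the empirical covariance, \<open>T = C + lam\<close>, \<open>Th = Ch + lam\<close> and
  \<open>r \<sigma> = 1 - \<sigma> g(\<sigma>)\<close>. The error splits as \<open>C\<^sub>s r(Ch) \<phi> + (C\<^sub>s Ch - Ch\<^sub>Y\<^sub>X) g(Ch) \<phi>\<close>. If the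
  Hilbert--Schmidt norm \<open>\<epsilon>\<close> of \<open>T\<^sup>-\<^sup>1\<^sup>/\<^sup>2 (C - Ch)\<close> is at most \<open>sqrt lam / 2\<close>, then \<open>T \<le> 2 Th\<close> and
  \<open>norm (T v) \<le> 2 norm (Th v)\<close>, so the second term costs only a factor \<open>2 (B + D)\<close> on top of the
  deviation of the noise. In the first term, write \<open>\<nu> - 1/2 = m + \<theta>\<close> with \<open>m\<close> the integer part. The
  telescoping identity \<open>1 = T\<^sup>-\<^sup>m Th\<^sup>m + (\<Sum>j. T\<^sup>-\<^sup>j (C - Ch) Th\<^sup>j\<^sup>-\<^sup>1)\<close>, \<open>j = 1, \<dots>, m\<close>, trades the
  powers of \<open>T\<close> for powers of \<open>Th\<close> at the price \<open>m \<epsilon>\<close>, and the remaining power \<open>\<theta> < 1\<close> is compared by the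
  Heinz inequality, proved here by real interpolation. Square roots of operators never occur: they
  are replaced by the quadratic forms of \<open>T\<close> and \<open>T\<^sup>-\<^sup>1\<close>. Nor is \<open>C\<close> diagonalised: its eigenprojections
  enter only through Bessel's inequality, and only the finite-rank operator \<open>Ch\<close> needs a complete
  set of eigenvectors.

  Both deviations are controlled by a Hilbert space Bernstein inequality obtained from the
  supermartingale \<open>cosh (h * norm S\<^sub>n)\<close>. Two events share the confidence \<open>\<delta>\<close>, although the bound has
  \<open>ln (2 / \<delta>)\<close> rather than \<open>ln (4 / \<delta>)\<close>; the constants leave enough room for this if
  Chebyshev's inequality takes over for \<open>\<delta>\<close> close to \<open>1\<close>.
\<close>

section \<open>Projections, adjoints and orthonormal bases\<close>

text \<open>Every error is the \<open>L2\<close> norm of a map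
  \<open>x \<mapsto> A (\<phi> x)\<close>. Its square is the trace of \<open>A C (adj A)\<close>, a
  sum of \<open>C v \<bullet> v\<close> over the images \<open>v\<close> of a basis of the output
  space under \<open>adj A\<close>; so operator estimates reduce to bounds for one vector, which are
  squared and summed.

  The factor \<open>2 powr (2 * \<nu> - m)\<close> has three sources: \<open>sqrt 2\<close> for
  replacing the form of \<open>T\<close> by twice that of \<open>Th\<close>,
  \<open>2 powr \<theta>\<close> from the Heinz inequality, and \<open>2 powr \<nu>\<close> because
  the qualification controls powers of \<open>\<sigma>\<close> while powers of
  \<open>\<sigma> + lam\<close> are needed. The deviation thresholds carry the factors 2 and 5/2:
  the first is built into \<open>B\<^sub>n\<close>, the second is what the 10 and the 5 in
  \<open>A\<^sub>1\<close> and \<open>A\<^sub>2\<close> allow. At these levels the Chebyshev tails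
  add up to \<open>(1/4 + 4/25) / t\<^sup>2\<close>, which stays below \<open>2 * exp (- t)\<close>
  on [ln 2, 1) by a narrow margin.

  The eigenvalue 0 needs care, since the family is bounded only on (0, s]: the noise has no
  component in the kernel of \<open>Ch\<close>, and the residual is 1 there, which is covered by
  \<open>\<gamma> \<ge> 1\<close>.\<close>

lemma parallelogram_law:
  fixes x y :: "'a::real_inner"
  shows "(norm (x - y))\<^sup>2 = 2 * (norm x)\<^sup>2 + 2 * (norm y)\<^sup>2 - (norm (x + y))\<^sup>2"
  by (simp add: power2_norm_eq_inner inner_simps inner_commute)

text \<open>A minimising sequence for the distance to \<open>v\<close> is Cauchy by the
  parallelogram law, and its limit satisfies the orthogonality condition because no perturbation
  inside \<open>S\<close> lowers the distance.\<close>

lemma projection_exists: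
  fixes S :: "'a::{real_inner,banach} set"
  assumes S: "subspace S" "closed S"
  shows "\<exists>u\<in>S. \<forall>w\<in>S. orthogonal (v - u) w"
proof -
  define d where "d = Inf ((\<lambda>u. (norm (v - u))\<^sup>2) ` S)"
  have ne: "S \<noteq> {}" using S(1) subspace_0 by blast
  have bdd: "bdd_below ((\<lambda>u. (norm (v - u))\<^sup>2) ` S)" by (rule bdd_belowI2[of _ 0]) simp
  have dle: "d \<le> (norm (v - u))\<^sup>2" if "u \<in> S" for u
    unfolding d_def using bdd that by (intro cInf_lower) auto
  have "\<exists>u\<in>S. (norm (v - u))\<^sup>2 < d + 1 / real (Suc n)" for n
  proof -
    have "Inf ((\<lambda>u. (norm (v - u))\<^sup>2) ` S) < d + 1 / real (Suc n)" unfolding d_def by simp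
    then show ?thesis using cInf_lessD[of "(\<lambda>u. (norm (v - u))\<^sup>2) ` S"] ne by fastforce
  qed
  then obtain u where u: "\<And>n. u n \<in> S" "\<And>n. (norm (v - u n))\<^sup>2 < d + 1 / real (Suc n)" by metis
  \<comment> \<open>The midpoint of \<open>a\<close> and \<open>b\<close> lies in \<open>S\<close>,
    so its squared distance to \<open>v\<close> is at least \<open>d\<close>; this is the source of
    the term \<open>4 * d\<close>.\<close>
  have key: "(norm (a - b))\<^sup>2 \<le> 2 * (norm (v - a))\<^sup>2 + 2 * (norm (v - b))\<^sup>2 - 4 * d"
    if "a \<in> S" "b \<in> S" for a b
  proof -
    have m: "(1/2) *\<^sub>R (a + b) \<in> S" using that S(1) by (simp add: subspace_add subspace_scale)
    have "(v - a) + (v - b) = 2 *\<^sub>R (v - (1/2) *\<^sub>R (a + b))" by (simp add: scaleR_2 algebra_simps)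
    then have "(norm ((v - a) + (v - b)))\<^sup>2 = 4 * (norm (v - (1/2) *\<^sub>R (a + b)))\<^sup>2"
      by (simp add: power_mult_distrib)
    with dle[OF m] have "4 * d \<le> (norm ((v - a) + (v - b)))\<^sup>2" by simp
    moreover have "(norm (a - b))\<^sup>2 = (norm ((v - a) - (v - b)))\<^sup>2" by (simp add: norm_minus_commute)
    ultimately show ?thesis using parallelogram_law[of "v - a" "v - b"] by simp
  qed
  have "Cauchy u"
  proof (rule metric_CauchyI)
    fix e :: real assume e: "e > 0"
    obtain N where N: "4 / e\<^sup>2 < real N" using reals_Archimedean2 by blast
    have Npos: "0 < real (Suc N)" by simp
    have "dist (u m) (u n) < e" if "m \<ge> N" "n \<ge> N" for m n
    proof -
      have a: "1 / real (Suc m) \<le> 1 / real (Suc N)" "1 / real (Suc n) \<le> 1 / real (Suc N)"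
        using that by (simp_all add: frac_le)
      have "(norm (u m - u n))\<^sup>2 < 4 * (1 / real (Suc N))"
        using key[OF u(1) u(1), of m n] u(2)[of m] u(2)[of n] a by linarith
      also have "\<dots> \<le> e\<^sup>2"
      proof -
        have "4 < real N * e\<^sup>2" using N e by (simp add: divide_less_eq)
        also have "\<dots> \<le> real (Suc N) * e\<^sup>2" by (intro mult_right_mono) auto
        finally show ?thesis by (simp add: divide_le_eq mult.commute)
      qed
      finally show ?thesis using e by (simp add: dist_norm power_less_imp_less_base)
    qed
    then show "\<exists>M. \<forall>m\<ge>M. \<forall>n\<ge>M. dist (u m) (u n) < e" by blast
  qed
  then obtain l where l: "u \<longlonglongrightarrow> l" using Cauchy_convergent convergent_def by blast
  have lS: "l \<in> S" using closed_sequentially[OF S(2)] u(1) l by blast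
  have "(norm (v - l))\<^sup>2 \<le> d"
  proof (rule LIMSEQ_le)
    show "(\<lambda>n. (norm (v - u n))\<^sup>2) \<longlonglongrightarrow> (norm (v - l))\<^sup>2" by (intro tendsto_intros l)
    show "(\<lambda>n. d + 1 / real (Suc n)) \<longlonglongrightarrow> d"
      using tendsto_add[OF tendsto_const LIMSEQ_Suc[OF lim_1_over_n], of d] by simp
    show "\<exists>N. \<forall>n\<ge>N. (norm (v - u n))\<^sup>2 \<le> d + 1 / real (Suc n)" using u(2) less_imp_le by blast
  qed
  then have min: "(norm (v - l))\<^sup>2 \<le> (norm (v - a))\<^sup>2" if "a \<in> S" for a
    using dle[OF that] by linarith
  have "orthogonal (v - l) w" if w: "w \<in> S" for w
  proof (cases "w = 0")
    case False
    \<comment> \<open>The minimiser of \<open>(norm (v - l - c *\<^sub>R w))\<^sup>2\<close> as a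
      quadratic in \<open>c\<close>; a nonzero inner product would push the value below the minimum
      attained at \<open>l\<close>.\<close>
    define c where "c = ((v - l) \<bullet> w) / (w \<bullet> w)"
    have ww: "w \<bullet> w > 0" using False by simp
    have "(norm (v - l))\<^sup>2 \<le> (norm (v - (l + c *\<^sub>R w)))\<^sup>2"
      by (rule min) (simp add: lS S(1) w subspace_add subspace_scale)
    also have "\<dots> = (norm (v - l))\<^sup>2 - 2 * c * ((v - l) \<bullet> w) + c\<^sup>2 * (w \<bullet> w)"
      unfolding power2_norm_eq_inner
      by (simp add: inner_simps inner_commute power2_eq_square algebra_simps)
    also have "\<dots> = (norm (v - l))\<^sup>2 - ((v - l) \<bullet> w)\<^sup>2 / (w \<bullet> w)"
      using ww by (simp add: c_def field_simps power2_eq_square)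
    finally have "((v - l) \<bullet> w)\<^sup>2 / (w \<bullet> w) \<le> 0" by simp
    then have "(v - l) \<bullet> w = 0" using ww by (simp add: divide_le_0_iff)
    then show ?thesis by (simp add: orthogonal_def)
  qed (simp add: orthogonal_def)
  with lS show ?thesis by blast
qed

lemma projection_unique:
  assumes "subspace S" "u \<in> S" "\<forall>w\<in>S. orthogonal (v - u) w" "u' \<in> S" "\<forall>w\<in>S. orthogonal (v - u') w"
  shows "u = u'"
proof -
  have "u - u' \<in> S" using assms by (simp add: subspace_diff)
  then have "(v - u') \<bullet> (u - u') = 0" "(v - u) \<bullet> (u - u') = 0" using assms by (auto simp: orthogonal_def)
  then have "(u - u') \<bullet> (u - u') = 0" by (simp add: inner_simps)
  then show ?thesis by simp
qed

lemma orth_proj_props: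
  fixes S :: "'a::{real_inner,banach} set"
  assumes S: "subspace S" "closed S"
  shows orth_proj_in: "orth_proj S v \<in> S"
    and orth_proj_orth: "w \<in> S \<Longrightarrow> orth_proj S v \<bullet> w = v \<bullet> w"
proof -
  have "\<exists>!u. u \<in> S \<and> (\<forall>w\<in>S. orthogonal (v - u) w)"
    using projection_exists[OF S] projection_unique[OF S(1)] by blast
  from theI'[OF this] have *: "orth_proj S v \<in> S \<and> (\<forall>w\<in>S. orthogonal (v - orth_proj S v) w)"
    by (simp add: orth_proj_def)
  then show "orth_proj S v \<in> S" by blast
  show "w \<in> S \<Longrightarrow> orth_proj S v \<bullet> w = v \<bullet> w" using * by (simp add: orthogonal_def inner_simps)
qed

lemma orth_projI:
  assumes "subspace S" "closed S" "u \<in> S" "\<And>w. w \<in> S \<Longrightarrow> u \<bullet> w = v \<bullet> w"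
  shows "orth_proj S v = u"
proof (rule projection_unique[OF assms(1), of _ v])
  show "orth_proj S v \<in> S" "u \<in> S" using assms(3) orth_proj_in[OF assms(1,2)] by auto
  show "\<forall>w\<in>S. orthogonal (v - orth_proj S v) w" "\<forall>w\<in>S. orthogonal (v - u) w"
    by (simp_all add: orthogonal_def inner_diff_left orth_proj_orth[OF assms(1,2)] assms(4))
qed

text \<open>Used twice to identify a closed subspace with the whole space: for the closed span of a
  maximal orthonormal set and for the range of \<open>C + lam\<close>.\<close>

lemma orthogonal_complement_trivial:
  fixes S :: "'a::{real_inner,banach} set"
  assumes S: "subspace S" "closed S" and "\<And>v. (\<And>w. w \<in> S \<Longrightarrow> v \<bullet> w = 0) \<Longrightarrow> v = 0"
  shows "S = UNIV"
proof -
  have "v \<in> S" for v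
  proof -
    have "v - orth_proj S v = 0" by (rule assms(3)) (simp add: inner_simps orth_proj_orth[OF S])
    then show ?thesis using orth_proj_in[OF S, of v] by simp
  qed
  then show ?thesis by blast
qed

section \<open>Riesz representation and adjoints\<close>

lemma inner_all_eqI:
  fixes x y :: "'a::real_inner"
  assumes "\<And>z. z \<bullet> x = z \<bullet> y"
  shows "x = y"
proof -
  have "(x - y) \<bullet> (x - y) = 0" using assms[of "x - y"] by (simp add: inner_diff_right)
  then show ?thesis by simp
qed

lemma riesz_representation:
  fixes f :: "'a::{real_inner,banach} \<Rightarrow> real"
  assumes f: "bounded_linear f"
  shows "\<exists>w. \<forall>v. f v = v \<bullet> w"
proof -
  interpret f: bounded_linear f by fact
  define S where "S = f -` {0}"
  have S: "subspace S" "closed S"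
    unfolding S_def
    by (auto simp: subspace_def f.add f.scaleR f.zero intro!: closed_vimage f.continuous_on continuous_on_id)
  show ?thesis
  proof (cases "\<forall>v. f v = 0")
    case False
    then obtain v where v: "f v \<noteq> 0" by blast
    \<comment> \<open>\<open>z\<close> spans the orthogonal complement of the kernel
      \<open>S\<close>: subtracting the right multiple of \<open>z\<close> from any \<open>x\<close>
      lands in \<open>S\<close>, which determines \<open>f x\<close>.\<close>
    define z where "z = v - orth_proj S v"
    have fz: "f z \<noteq> 0" using orth_proj_in[OF S, of v] v by (simp add: z_def f.diff S_def)
    then have z0: "z \<bullet> z \<noteq> 0" using f.zero by auto
    have "f x = x \<bullet> ((f z / (z \<bullet> z)) *\<^sub>R z)" for x
    proof -
      have "x - (f x / f z) *\<^sub>R z \<in> S" using fz by (simp add: S_def f.diff f.scaleR)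
      then have "z \<bullet> (x - (f x / f z) *\<^sub>R z) = 0"
        by (simp add: z_def inner_diff_left orth_proj_orth[OF S])
      then show ?thesis using fz z0 by (simp add: inner_simps inner_commute field_simps)
    qed
    then show ?thesis by blast
  qed (use inner_zero_right in metis)
qed

lemma adjoint_exists:
  fixes A :: "'a::{real_inner,banach} \<Rightarrow>\<^sub>L 'b::{real_inner,banach}"
  shows "\<exists>A' :: 'b \<Rightarrow>\<^sub>L 'a. \<forall>u v. A u \<bullet> v = u \<bullet> A' v"
proof -
  have "\<exists>w. \<forall>u. A u \<bullet> v = u \<bullet> w" for v
    by (rule riesz_representation)
      (rule bounded_linear_compose[OF bounded_linear_inner_left blinfun.bounded_linear_right])
  then obtain h where h: "\<And>u v. A u \<bullet> v = u \<bullet> h v" by metis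
  have "bounded_linear h"
  proof (rule bounded_linear_intro)
    show "h (x + y) = h x + h y" for x y
    proof (rule inner_all_eqI)
      fix z show "z \<bullet> h (x + y) = z \<bullet> (h x + h y)" by (simp add: inner_add_right h[symmetric])
    qed
    show "h (r *\<^sub>R x) = r *\<^sub>R h x" for r x
    proof (rule inner_all_eqI)
      fix z show "z \<bullet> h (r *\<^sub>R x) = z \<bullet> (r *\<^sub>R h x)" by (simp add: h[symmetric])
    qed
    show "norm (h x) \<le> norm x * norm A" for x
    proof (cases "h x = 0")
      case False
      have "norm (h x) * norm (h x) = A (h x) \<bullet> x" by (simp add: h flip: power2_norm_eq_inner power2_eq_square)
      also have "\<dots> \<le> norm (A (h x)) * norm x" by (rule norm_cauchy_schwarz)
      also have "\<dots> \<le> (norm A * norm (h x)) * norm x" by (intro mult_right_mono norm_blinfun) auto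
      finally have "norm (h x) * norm (h x) \<le> (norm x * norm A) * norm (h x)" by (simp add: mult_ac)
      then show ?thesis using False by (simp add: mult_le_cancel_right)
    qed simp
  qed
  then have "\<forall>u v. A u \<bullet> v = u \<bullet> Blinfun h v" by (simp add: h bounded_linear_Blinfun_apply)
  then show ?thesis by blast
qed

definition adj :: "('a::{real_inner,banach} \<Rightarrow>\<^sub>L 'b::{real_inner,banach}) \<Rightarrow> ('b \<Rightarrow>\<^sub>L 'a)" where
  "adj A = (SOME A' :: 'b \<Rightarrow>\<^sub>L 'a. \<forall>u v. A u \<bullet> v = u \<bullet> A' v)"

lemma adj_inner: "blinfun_apply A u \<bullet> v = u \<bullet> adj A v"
  using someI_ex[OF adjoint_exists[of A]] unfolding adj_def by blast

lemma adj_inner': "adj A v \<bullet> u = v \<bullet> blinfun_apply A u"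
  by (metis adj_inner inner_commute)

section \<open>Orthonormal bases, Parseval's identity and Hilbert-Schmidt sums\<close>

lemma closure_of_subspace:
  fixes S :: "'a::real_normed_vector set"
  assumes "subspace S"
  shows "subspace (closure S)"
proof (rule subspaceI)
  show "0 \<in> closure S" using assms closure_subset subspace_0 by blast
  fix x assume "x \<in> closure S"
  then obtain X where X: "\<And>n. X n \<in> S" "X \<longlonglongrightarrow> x" by (auto simp: closure_sequential)
  { fix c :: real
    have "(\<lambda>n. c *\<^sub>R X n) \<longlonglongrightarrow> c *\<^sub>R x" by (intro tendsto_intros X)
    moreover have "\<forall>n. c *\<^sub>R X n \<in> S" using X assms by (simp add: subspace_scale)
    ultimately show "c *\<^sub>R x \<in> closure S" unfolding closure_sequential by (intro exI[of _ "\<lambda>n. c *\<^sub>R X n"]) simp }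
  fix y assume "y \<in> closure S"
  then obtain Y where Y: "\<And>n. Y n \<in> S" "Y \<longlonglongrightarrow> y" by (auto simp: closure_sequential)
  have "(\<lambda>n. X n + Y n) \<longlonglongrightarrow> x + y" by (intro tendsto_intros X Y)
  moreover have "\<forall>n. X n + Y n \<in> S" using X Y assms by (simp add: subspace_add)
  ultimately show "x + y \<in> closure S" unfolding closure_sequential by (intro exI[of _ "\<lambda>n. X n + Y n"]) simp
qed

text \<open>Zorn's lemma: unions of chains of orthonormal sets are orthonormal, and a nonzero vector
  orthogonal to a maximal one could be normalised and adjoined.\<close>

lemma orthonormal_basis_exists: "\<exists>B :: 'a::{real_inner,banach} set. orthonormal_basis B"
proof -
  define Q :: "'a set set" where "Q = {B. pairwise orthogonal B \<and> (\<forall>e\<in>B. norm e = 1)}"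
  have "\<Union>\<C> \<in> Q" if "subset.chain Q \<C>" for \<C>
  proof -
    have "pairwise orthogonal (\<Union>\<C>)"
    proof (rule pairwiseI)
      fix x y assume "x \<in> \<Union>\<C>" "y \<in> \<Union>\<C>" "x \<noteq> y"
      then obtain X Y where XY: "X \<in> \<C>" "Y \<in> \<C>" "x \<in> X" "y \<in> Y" by blast
      with that have "X \<subseteq> Y \<or> Y \<subseteq> X" "X \<in> Q" "Y \<in> Q" by (auto simp: subset.chain_def)
      with XY \<open>x \<noteq> y\<close> show "orthogonal x y" unfolding Q_def pairwise_def by blast
    qed
    moreover have "\<forall>e\<in>\<Union>\<C>. norm e = 1" using that by (auto simp: subset.chain_def Q_def)
    ultimately show ?thesis by (simp add: Q_def)
  qed
  then obtain B where B: "B \<in> Q" and max: "\<And>X. X \<in> Q \<Longrightarrow> B \<subseteq> X \<Longrightarrow> X = B"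
    using subset_Zorn'[of Q] by blast
  have "closure (span B) = UNIV"
  proof (rule orthogonal_complement_trivial)
    fix v :: 'a assume v: "\<And>w. w \<in> closure (span B) \<Longrightarrow> v \<bullet> w = 0"
    have vB: "v \<bullet> w = 0" if "w \<in> B" for w using v that closure_subset span_base by blast
    show "v = 0"
    proof (rule ccontr)
      assume "v \<noteq> 0"
      have "insert (sgn v) B \<in> Q"
        using B vB \<open>v \<noteq> 0\<close>
        by (auto simp: Q_def pairwise_insert orthogonal_def sgn_div_norm inner_commute)
      then have "sgn v \<in> B" using max by blast
      then have "v \<bullet> sgn v = 0" using vB by blast
      with \<open>v \<noteq> 0\<close> show False by (simp add: sgn_div_norm)
    qed
  qed (auto intro: closure_of_subspace subspace_span)
  with B show ?thesis unfolding orthonormal_basis_def Q_def by blast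
qed

lemma some_onb: "orthonormal_basis (some_onb :: 'a::{real_inner,banach} set)"
  unfolding some_onb_def by (rule someI_ex[OF orthonormal_basis_exists])

text \<open>Distinct basis vectors are at distance \<open>sqrt 2\<close>, so the balls of radius 1/2
  around them are disjoint; a second countable space has only countably many disjoint nonempty open
  sets.\<close>

lemma countable_some_onb: "countable (some_onb :: 'a::{real_inner,banach,second_countable_topology} set)"
proof (rule countable_image_inj_on)
  let ?B = "some_onb :: 'a set"
  have onb: "pairwise orthogonal ?B" "\<forall>e\<in>?B. norm e = 1"
    using some_onb by (auto simp: orthonormal_basis_def)
  have dist: "dist x y \<ge> 1" if "x \<in> ?B" "y \<in> ?B" "x \<noteq> y" for x y
  proof -
    have "x \<bullet> y = 0" using onb that by (auto simp: pairwise_def orthogonal_def)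
    then have "(dist x y)\<^sup>2 = (norm x)\<^sup>2 + (norm y)\<^sup>2"
      by (simp add: dist_norm power2_norm_eq_inner inner_simps inner_commute)
    then have "(dist x y)\<^sup>2 = 2" using onb that by simp
    then have "1\<^sup>2 \<le> (dist x y)\<^sup>2" by simp
    then show ?thesis by (rule power2_le_imp_le) simp
  qed
  show inj: "inj_on (\<lambda>x. ball x (1/2)) ?B"
  proof (rule inj_onI)
    fix x y assume xy: "x \<in> ?B" "y \<in> ?B" "ball x (1/2) = ball y (1/2)"
    then have "x \<in> ball y (1/2)" by (metis centre_in_ball half_gt_zero zero_less_one)
    then have "dist x y < 1" by (simp add: dist_commute)
    then show "x = y" using dist xy by force
  qed
  show "countable ((\<lambda>x. ball x (1/2)) ` ?B)"
  proof (rule countable_disjoint_nonempty_interior_subsets)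
    show "pairwise disjnt ((\<lambda>x. ball x (1/2)) ` ?B)"
    proof (rule pairwiseI)
      fix X Y assume "X \<in> (\<lambda>x. ball x (1/2)) ` ?B" "Y \<in> (\<lambda>x. ball x (1/2)) ` ?B" "X \<noteq> Y"
      then obtain x y where xy: "x \<in> ?B" "y \<in> ?B" "X = ball x (1/2)" "Y = ball y (1/2)" "x \<noteq> y" by blast
      show "disjnt X Y"
      proof (rule ccontr)
        assume "\<not> disjnt X Y"
        then obtain a where "dist x a < 1/2" "dist y a < 1/2" unfolding disjnt_def xy by auto
        moreover have "dist x y \<le> dist x a + dist y a" by (metis dist_commute dist_triangle)
        ultimately show False using dist[OF xy(1,2,5)] by linarith
      qed
    qed
    fix X assume "X \<in> (\<lambda>x. ball x (1/2)) ` ?B" "interior X = {}"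
    then show "X = {}" by (auto simp: interior_open)
  qed
qed

lemma orthonormal_parseval:
  fixes u v :: "'a::{real_inner,banach}"
  assumes "orthonormal_basis B"
  shows "((\<lambda>e. (u \<bullet> e) * (e \<bullet> v)) has_sum (u \<bullet> v)) B"
proof -
  have orth: "\<And>e f. e \<in> B \<Longrightarrow> f \<in> B \<Longrightarrow> e \<noteq> f \<Longrightarrow> e \<bullet> f = 0" and unit: "\<And>e. e \<in> B \<Longrightarrow> e \<bullet> e = 1"
    and dense: "closure (span B) = UNIV"
    using assms by (auto simp: orthonormal_basis_def pairwise_def orthogonal_def norm_eq_1)
  define s where "s F = (\<Sum>e\<in>F. (u \<bullet> e) *\<^sub>R e)" for F
  \<comment> \<open>\<open>s G\<close> is the best approximation to \<open>u\<close> from the span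
    of \<open>G\<close>, so what a finite \<open>F\<close> achieves is preserved by every larger
    \<open>G\<close>. Convergence along finite subsets demands exactly this.\<close>
  have best: "norm (u - s G) \<le> norm (u - w)"
    if "finite F" "F \<subseteq> G" "finite G" "G \<subseteq> B" "w \<in> span F" for F G w
  proof -
    have o: "(u - s G) \<bullet> e = 0" if "e \<in> G" for e
    proof -
      have "s G \<bullet> e = (\<Sum>f\<in>G. if f = e then u \<bullet> e else 0)"
        unfolding s_def inner_sum_left
        using orth unit \<open>G \<subseteq> B\<close> that by (intro sum.cong) (auto simp: subset_iff)
      then show ?thesis using \<open>finite G\<close> that by (simp add: inner_simps)
    qed
    have "w \<in> span G" using that span_mono by blast
    moreover have "s G \<in> span G" unfolding s_def by (intro span_sum span_scale span_base)
    ultimately have "s G - w \<in> span G" by (simp add: span_diff)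
    then have "orthogonal (u - s G) (s G - w)"
      by (rule orthogonal_to_span) (use o in \<open>auto simp: orthogonal_def\<close>)
    then have "(norm (u - w))\<^sup>2 = (norm (u - s G))\<^sup>2 + (norm (s G - w))\<^sup>2"
      using norm_add_Pythagorean[of "u - s G" "s G - w"] by simp
    then show ?thesis by (metis le_add_same_cancel1 norm_ge_zero power2_le_imp_le zero_le_power2)
  qed
  have "(s \<longlongrightarrow> u) (finite_subsets_at_top B)"
  proof (rule tendstoI)
    fix e :: real assume "e > 0"
    have "u \<in> closure (span B)" using dense by simp
    then obtain w where w: "w \<in> span B" "dist w u < e" using \<open>e > 0\<close> closure_approachable by blast
    from w(1) obtain F r where F: "finite F" "F \<subseteq> B" and wF: "w = (\<Sum>a\<in>F. r a *\<^sub>R a)"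
      unfolding span_explicit by blast
    have F': "w \<in> span F" unfolding wF by (intro span_sum span_scale span_base)
    have close: "dist (s G) u < e" if "finite G" "F \<subseteq> G" "G \<subseteq> B" for G
    proof -
      have "norm (u - s G) \<le> norm (u - w)" by (rule best[OF F(1) that(2,1,3) F'])
      with w(2) show ?thesis by (simp add: dist_norm norm_minus_commute)
    qed
    show "\<forall>\<^sub>F G in finite_subsets_at_top B. dist (s G) u < e"
      unfolding eventually_finite_subsets_at_top
      by (rule exI[of _ F]) (use F close in simp)
  qed
  then have "((\<lambda>F. s F \<bullet> v) \<longlongrightarrow> u \<bullet> v) (finite_subsets_at_top B)" by (intro tendsto_intros)
  then show ?thesis unfolding has_sum_def s_def by (simp add: inner_sum_left)
qed

text \<open>The chosen basis as a sequence, padded with zeros where the enumeration has gaps.\<close>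

definition onb_seq :: "nat \<Rightarrow> 'a::{real_inner,banach}" where
  "onb_seq n = (if n \<in> to_nat_on (some_onb :: 'a set) ` some_onb then from_nat_into some_onb n else 0)"

text \<open>The assumption on \<open>0\<close> makes the padding of \<open>onb_seq\<close>
  invisible, so that sums over the chosen basis become series over the naturals.\<close>

lemma has_sum_onb_seq:
  fixes F :: "'a::{real_inner,banach,second_countable_topology} \<Rightarrow> real"
  assumes "F 0 = 0"
  shows "((\<lambda>n. F (onb_seq n)) has_sum x) UNIV \<longleftrightarrow> (F has_sum x) some_onb"
proof -
  let ?B = "some_onb :: 'a set"
  let ?h = "to_nat_on ?B"
  have "((\<lambda>n. F (onb_seq n)) has_sum x) UNIV \<longleftrightarrow> ((\<lambda>n. F (from_nat_into ?B n)) has_sum x) (?h ` ?B)"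
    by (rule has_sum_cong_neutral) (auto simp: onb_seq_def assms)
  also have "\<dots> \<longleftrightarrow> ((\<lambda>n. F (from_nat_into ?B n)) \<circ> ?h has_sum x) ?B"
    by (rule has_sum_reindex) (rule inj_on_to_nat_on[OF countable_some_onb])
  also have "\<dots> \<longleftrightarrow> (F has_sum x) ?B"
    by (rule has_sum_cong) (simp add: from_nat_into_to_nat_on[OF countable_some_onb])
  finally show ?thesis .
qed

lemma onb_seq_parseval:
  fixes u v :: "'a::{real_inner,banach,second_countable_topology}"
  shows "(\<lambda>n. (u \<bullet> onb_seq n) * (onb_seq n \<bullet> v)) sums (u \<bullet> v)"
  by (rule has_sum_imp_sums, subst has_sum_onb_seq[where F = "\<lambda>e. (u \<bullet> e) * (e \<bullet> v)"])
    (auto intro: orthonormal_parseval some_onb)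

lemma onb_seq_norm:
  fixes u :: "'a::{real_inner,banach,second_countable_topology}"
  shows "(\<lambda>n. (u \<bullet> onb_seq n)\<^sup>2) sums (norm u)\<^sup>2"
  using onb_seq_parseval[of u u] by (simp add: power2_eq_square inner_commute flip: power2_norm_eq_inner)

lemma hilbert_schmidt_iff:
  fixes T :: "'a::{real_inner,banach,second_countable_topology} \<Rightarrow>\<^sub>L 'b::{real_inner,banach}"
  shows "hilbert_schmidt T \<longleftrightarrow> summable (\<lambda>n. (norm (T (onb_seq n)))\<^sup>2)"
proof -
  have "hilbert_schmidt T \<longleftrightarrow> (\<lambda>n. (norm (T (onb_seq n)))\<^sup>2) summable_on UNIV"
    unfolding hilbert_schmidt_def summable_on_def
    by (subst has_sum_onb_seq[where F = "\<lambda>e. (norm (T e))\<^sup>2"]) auto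
  also have "\<dots> \<longleftrightarrow> summable (\<lambda>n. (norm (T (onb_seq n)))\<^sup>2)"
    by (rule summable_on_UNIV_nonneg_real_iff) simp
  finally show ?thesis .
qed

lemma hs_norm_sums:
  fixes T :: "'a::{real_inner,banach,second_countable_topology} \<Rightarrow>\<^sub>L 'b::{real_inner,banach}"
  assumes "hilbert_schmidt T"
  shows "(\<lambda>n. (norm (T (onb_seq n)))\<^sup>2) sums (hs_norm T)\<^sup>2"
proof -
  have "((\<lambda>e. (norm (T e))\<^sup>2) has_sum (\<Sum>\<^sub>\<infinity>e\<in>some_onb. (norm (T e))\<^sup>2)) some_onb"
    using assms by (simp add: hilbert_schmidt_def)
  then have "((\<lambda>n. (norm (T (onb_seq n)))\<^sup>2) has_sum (\<Sum>\<^sub>\<infinity>e\<in>some_onb. (norm (T e))\<^sup>2)) UNIV"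
    by (subst has_sum_onb_seq[where F = "\<lambda>e. (norm (T e))\<^sup>2"]) auto
  moreover have "(hs_norm T)\<^sup>2 = (\<Sum>\<^sub>\<infinity>e\<in>some_onb. (norm (T e))\<^sup>2)"
    unfolding hs_norm_def by (simp add: infsum_nonneg)
  ultimately show ?thesis by (simp add: has_sum_imp_sums)
qed

text \<open>Nonnegativity of every term upgrades convergence of the series to the unordered
  summation in \<open>op_trace\<close>.\<close>

lemma op_trace_eqI:
  fixes T :: "'a::{real_inner,banach,second_countable_topology} \<Rightarrow> 'a"
  assumes "\<And>e. T e \<bullet> e \<ge> 0" "(\<lambda>n. T (onb_seq n) \<bullet> onb_seq n) sums s"
  shows "op_trace T = s"
proof -
  have "((\<lambda>n. T (onb_seq n) \<bullet> onb_seq n) has_sum s) UNIV"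
    by (rule sums_nonneg_imp_has_sum) (use assms in auto)
  then have "((\<lambda>e. T e \<bullet> e) has_sum s) some_onb"
    by (subst (asm) has_sum_onb_seq[where F = "\<lambda>e. T e \<bullet> e"]) auto
  then show ?thesis unfolding op_trace_def by (rule infsumI)
qed

text \<open>Both series are the double sum of the squared matrix entries \<open>f n m\<close>. The
  entries are nonnegative, so the order can be exchanged in \<open>ennreal\<close> before anything
  is known about summability for the adjoint.\<close>

lemma adj_norm_sums:
  fixes T :: "'a::{real_inner,banach,second_countable_topology} \<Rightarrow>\<^sub>L 'b::{real_inner,banach,second_countable_topology}"
  assumes "(\<lambda>n. (norm (T (onb_seq n)))\<^sup>2) sums s"
  shows "(\<lambda>n. (norm (adj T (onb_seq n)))\<^sup>2) sums s"
proof -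
  define f where "f n m = (blinfun_apply T (onb_seq n) \<bullet> onb_seq m)\<^sup>2" for n m
  have s0: "s \<ge> 0" using sums_le[OF _ sums_zero assms] by simp
  have "ennreal ((norm (adj T (onb_seq m)))\<^sup>2) = (\<Sum>n. ennreal (f n m))" for m
  proof -
    have "(\<lambda>n. f n m) sums (norm (adj T (onb_seq m)))\<^sup>2"
      using onb_seq_norm[of "adj T (onb_seq m)"] unfolding f_def adj_inner' by (simp only: inner_commute)
    then show ?thesis by (intro suminf_ennreal_eq[symmetric]) (auto simp: f_def)
  qed
  then have "(\<Sum>m. ennreal ((norm (adj T (onb_seq m)))\<^sup>2)) = (\<Sum>m. \<Sum>n. ennreal (f n m))" by simp
  also have "\<dots> = (\<Sum>n. \<Sum>m. ennreal (f n m))"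
    using nn_integral_suminf[of "\<lambda>m n. ennreal (f n m)" "count_space UNIV"]
    by (simp add: nn_integral_count_space_nat)
  also have "\<dots> = (\<Sum>n. ennreal ((norm (T (onb_seq n)))\<^sup>2))"
    by (intro arg_cong[where f = suminf] ext suminf_ennreal_eq) (auto simp: f_def onb_seq_norm)
  also have "\<dots> = ennreal s" by (rule suminf_ennreal_eq) (use assms in auto)
  finally have *: "(\<Sum>m. ennreal ((norm (adj T (onb_seq m)))\<^sup>2)) = ennreal s" .
  have "summable (\<lambda>m. (norm (adj T (onb_seq m)))\<^sup>2)"
    by (rule summable_suminf_not_top) (simp_all add: *)
  moreover from this have "ennreal (\<Sum>m. (norm (adj T (onb_seq m)))\<^sup>2) = ennreal s"
    using * by (simp add: suminf_ennreal2)
  ultimately show ?thesis using s0 by (simp add: sums_iff suminf_nonneg)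
qed

section \<open>Functional calculus of symmetric operators\<close>

definition symmetric :: "('a::real_inner \<Rightarrow>\<^sub>L 'a) \<Rightarrow> bool" where
  "symmetric T \<longleftrightarrow> (\<forall>u v. blinfun_apply T u \<bullet> v = u \<bullet> blinfun_apply T v)"

lemma symmetricD: "symmetric T \<Longrightarrow> blinfun_apply T u \<bullet> v = u \<bullet> blinfun_apply T v"
  by (simp add: symmetric_def)

section \<open>Projections onto eigenspaces\<close>

abbreviation eproj :: "('a::{real_inner,banach} \<Rightarrow>\<^sub>L 'a) \<Rightarrow> real \<Rightarrow> 'a \<Rightarrow> 'a" where
  "eproj T \<mu> v \<equiv> orth_proj (eigenspace T \<mu>) v"

lemma subspace_eigenspace: "subspace (eigenspace T \<mu>)"
  by (auto simp: eigenspace_def subspace_def blinfun.add_right blinfun.scaleR_right algebra_simps)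

lemma closed_eigenspace: "closed (eigenspace T \<mu>)"
  unfolding eigenspace_def by (intro closed_Collect_eq continuous_intros)

lemmas eproj_in = orth_proj_in[OF subspace_eigenspace closed_eigenspace]
lemmas eproj_inner = orth_proj_orth[OF subspace_eigenspace closed_eigenspace]
lemmas eprojI = orth_projI[OF subspace_eigenspace closed_eigenspace]

lemma eproj_eigen: "blinfun_apply T (eproj T \<mu> v) = \<mu> *\<^sub>R eproj T \<mu> v"
  using eproj_in[of T \<mu> v] by (simp add: eigenspace_def)

lemma eproj_self: "w \<in> eigenspace T \<mu> \<Longrightarrow> eproj T \<mu> w = w"
  by (rule eprojI) auto

lemma eproj_add: "eproj T \<mu> (u + v) = eproj T \<mu> u + eproj T \<mu> v"
  by (rule eprojI) (auto simp: eproj_in subspace_add subspace_eigenspace inner_add_left eproj_inner)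

lemma eproj_scaleR: "eproj T \<mu> (c *\<^sub>R v) = c *\<^sub>R eproj T \<mu> v"
  by (rule eprojI) (auto simp: eproj_in subspace_scale subspace_eigenspace eproj_inner)

lemma eproj_zero: "eproj T \<mu> 0 = 0"
  using eproj_scaleR[of T \<mu> 0 0] by simp

lemma eproj_sum: "eproj T \<mu> (\<Sum>i\<in>I. f i) = (\<Sum>i\<in>I. eproj T \<mu> (f i))"
  by (induction I rule: infinite_finite_induct) (auto simp: eproj_zero eproj_add)

lemma eproj_inner_eq: "eproj T \<mu> u \<bullet> v = eproj T \<mu> u \<bullet> eproj T \<mu> v"
  by (metis eproj_in eproj_inner inner_commute)

lemma eproj_inner_swap: "eproj T \<mu> u \<bullet> v = u \<bullet> eproj T \<mu> v"
  by (metis eproj_inner_eq inner_commute)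

lemma eproj_inner_self: "eproj T \<mu> v \<bullet> v = (norm (eproj T \<mu> v))\<^sup>2"
  by (metis eproj_inner_eq power2_norm_eq_inner)

lemma eproj_not_eigenvalue:
  assumes "\<mu> \<notin> eigenvalues T"
  shows "eproj T \<mu> v = 0"
  using assms eproj_in[of T \<mu> v] by (auto simp: eigenvalues_def)

lemma eigenspace_orthogonal:
  assumes "symmetric T" "u \<in> eigenspace T \<mu>" "v \<in> eigenspace T \<mu>'" "\<mu> \<noteq> \<mu>'"
  shows "u \<bullet> v = 0"
  using symmetricD[OF assms(1), of u v] assms(2-4) by (simp add: eigenspace_def)

lemma eproj_orthogonal:
  assumes "symmetric T" "\<mu> \<noteq> \<mu>'"
  shows "eproj T \<mu> u \<bullet> eproj T \<mu>' v = 0"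
  by (rule eigenspace_orthogonal[OF assms(1) eproj_in eproj_in assms(2)])

lemma eproj_eproj:
  assumes "symmetric T"
  shows "eproj T \<mu> (eproj T \<mu>' v) = (if \<mu> = \<mu>' then eproj T \<mu> v else 0)"
  by (auto intro!: eprojI eproj_in subspace_0 subspace_eigenspace
      simp: eigenspace_orthogonal[OF assms eproj_in])

lemma eproj_apply:
  assumes "symmetric T"
  shows "eproj T \<mu> (blinfun_apply T v) = \<mu> *\<^sub>R eproj T \<mu> v"
proof (rule eprojI)
  fix w assume w: "w \<in> eigenspace T \<mu>"
  then show "\<mu> *\<^sub>R eproj T \<mu> v \<bullet> w = T v \<bullet> w"
    by (simp add: eproj_inner symmetricD[OF assms]) (simp add: eigenspace_def)
qed (simp add: subspace_scale subspace_eigenspace eproj_in)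

section \<open>Orthogonal series and the functional calculus\<close>

lemma norm_orthogonal_sum:
  fixes x :: "'i \<Rightarrow> 'a::real_inner"
  assumes "finite F" "\<And>i j. i \<in> F \<Longrightarrow> j \<in> F \<Longrightarrow> i \<noteq> j \<Longrightarrow> x i \<bullet> x j = 0"
  shows "(norm (\<Sum>i\<in>F. x i))\<^sup>2 = (\<Sum>i\<in>F. (norm (x i))\<^sup>2)"
  by (rule norm_sum_Pythagorean) (use assms in \<open>auto simp: pairwise_def orthogonal_def\<close>)

text \<open>The partial sum \<open>?s\<close> satisfies
  \<open>(norm ?s)\<^sup>2 = ?s \<bullet> v\<close>, and Cauchy-Schwarz does the rest. For the
  operator \<open>C\<close> this inequality takes the place of completeness of the
  eigenvectors.\<close>

lemma eproj_bessel:
  assumes "symmetric T" "finite F"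
  shows "(\<Sum>\<mu>\<in>F. (norm (eproj T \<mu> v))\<^sup>2) \<le> (norm v)\<^sup>2"
proof -
  let ?s = "\<Sum>\<mu>\<in>F. eproj T \<mu> v"
  have n: "(norm ?s)\<^sup>2 = (\<Sum>\<mu>\<in>F. (norm (eproj T \<mu> v))\<^sup>2)"
    by (rule norm_orthogonal_sum) (use assms eproj_orthogonal in auto)
  also have "\<dots> = ?s \<bullet> v" by (simp add: inner_sum_left eproj_inner_self)
  also have "\<dots> \<le> norm ?s * norm v" by (rule norm_cauchy_schwarz)
  finally have "norm ?s \<le> norm v"
    by (cases "norm ?s = 0") (auto simp: power2_eq_square mult_le_cancel_left)
  then have "(norm ?s)\<^sup>2 \<le> (norm v)\<^sup>2" by (simp add: power_mono)
  with n show ?thesis by simp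
qed

text \<open>The squared distance of two nested partial sums is the sum of squares over the
  difference of the index sets, so the net of partial sums inherits the Cauchy property from the
  squares.\<close>

lemma orthogonal_summable:
  fixes x :: "'i \<Rightarrow> 'a::{real_inner,banach}"
  assumes orth: "\<And>i j. i \<in> I \<Longrightarrow> j \<in> I \<Longrightarrow> i \<noteq> j \<Longrightarrow> x i \<bullet> x j = 0"
    and sq: "(\<lambda>i. (norm (x i))\<^sup>2) summable_on I"
  shows "x summable_on I"
proof -
  let ?F = "filtermap (sum x) (finite_subsets_at_top I)"
  let ?q = "\<lambda>F. \<Sum>i\<in>F. (norm (x i))\<^sup>2"
  have "cauchy_filter ?F"
  proof (subst cauchy_filter_metric_filtermap, intro allI impI)
    fix e :: real assume e: "e > 0"
    have "(?q \<longlongrightarrow> infsum (\<lambda>i. (norm (x i))\<^sup>2) I) (finite_subsets_at_top I)"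
      using sq by (rule infsum_tendsto)
    \<comment> \<open>Two sums of squares that are each within \<open>e\<^sup>2 / 8\<close> of the
      limit differ by less than \<open>(e / 2)\<^sup>2\<close>.\<close>
    then have "\<forall>\<^sub>F F in finite_subsets_at_top I. dist (?q F) (infsum (\<lambda>i. (norm (x i))\<^sup>2) I) < e\<^sup>2 / 8"
      using e by (intro tendstoD) auto
    then obtain F0 where F0: "finite F0" "F0 \<subseteq> I" and
      close': "\<forall>F. finite F \<and> F0 \<subseteq> F \<and> F \<subseteq> I \<longrightarrow> dist (?q F) (infsum (\<lambda>i. (norm (x i))\<^sup>2) I) < e\<^sup>2 / 8"
      unfolding eventually_finite_subsets_at_top by (elim exE conjE) (rule that)
    have close: "dist (?q F) (infsum (\<lambda>i. (norm (x i))\<^sup>2) I) < e\<^sup>2 / 8"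
      if "finite F" "F0 \<subseteq> F" "F \<subseteq> I" for F
      using close' that by simp
    have near: "dist (sum x F) (sum x F0) < e / 2" if F: "finite F" "F0 \<subseteq> F" "F \<subseteq> I" for F
    proof -
      have "sum x F - sum x F0 = sum x (F - F0)" using F by (simp add: sum_diff)
      moreover have "(norm (sum x (F - F0)))\<^sup>2 = ?q (F - F0)"
      proof (rule norm_orthogonal_sum)
        show "finite (F - F0)" using F by simp
        show "x i \<bullet> x j = 0" if "i \<in> F - F0" "j \<in> F - F0" "i \<noteq> j" for i j
          using orth[of i j] that F by blast
      qed
      ultimately have "(dist (sum x F) (sum x F0))\<^sup>2 = ?q (F - F0)" by (simp add: dist_norm)
      also have "\<dots> = ?q F - ?q F0" using F by (simp add: sum_diff)
      also have "\<dots> < (e / 2)\<^sup>2"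
      proof -
        have e4: "(e / 2)\<^sup>2 = e\<^sup>2 / 4" by (simp add: power_divide)
        show ?thesis
          using close[OF F] close[OF F0(1) order.refl F0(2)] unfolding dist_real_def e4 by linarith
      qed
      finally show ?thesis by (rule power_less_imp_less_base) (use e in simp)
    qed
    show "\<exists>P. eventually P (finite_subsets_at_top I) \<and> (\<forall>F G. P F \<and> P G \<longrightarrow> dist (sum x F) (sum x G) < e)"
    proof (intro exI conjI allI impI)
      show "\<forall>\<^sub>F F in finite_subsets_at_top I. finite F \<and> F0 \<subseteq> F \<and> F \<subseteq> I"
        unfolding eventually_finite_subsets_at_top using F0 by blast
      fix F G assume "(finite F \<and> F0 \<subseteq> F \<and> F \<subseteq> I) \<and> (finite G \<and> F0 \<subseteq> G \<and> G \<subseteq> I)"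
      then have "dist (sum x F) (sum x F0) < e / 2" "dist (sum x G) (sum x F0) < e / 2" using near by auto
      then show "dist (sum x F) (sum x G) < e" by (rule dist_triangle_half_l)
    qed
  qed
  moreover have "?F \<noteq> bot" by (simp add: filtermap_bot_iff)
  ultimately obtain y where "?F \<le> nhds y"
    using cauchy_filter_complete_converges[OF _ complete_UNIV, of ?F] by (auto simp: filtermap_bot_iff)
  then have "(sum x \<longlongrightarrow> y) (finite_subsets_at_top I)" by (simp add: filterlim_def)
  then show ?thesis by (auto simp: summable_on_def has_sum_def)
qed

lemma orthogonal_has_sum_norm:
  fixes x :: "'i \<Rightarrow> 'a::real_inner"
  assumes orth: "\<And>i j. i \<in> I \<Longrightarrow> j \<in> I \<Longrightarrow> i \<noteq> j \<Longrightarrow> x i \<bullet> x j = 0"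
    and s: "(x has_sum s) I"
  shows "((\<lambda>i. (norm (x i))\<^sup>2) has_sum (norm s)\<^sup>2) I"
proof -
  have "((\<lambda>F. (norm (sum x F))\<^sup>2) \<longlongrightarrow> (norm s)\<^sup>2) (finite_subsets_at_top I)"
    using s unfolding has_sum_def by (intro tendsto_intros)
  moreover have "\<forall>\<^sub>F F in finite_subsets_at_top I. (norm (sum x F))\<^sup>2 = (\<Sum>i\<in>F. (norm (x i))\<^sup>2)"
    by (rule eventually_finite_subsets_at_top_weakI) (use orth in \<open>auto intro!: norm_orthogonal_sum\<close>)
  ultimately show ?thesis unfolding has_sum_def by (simp add: tendsto_cong)
qed

context
  fixes T :: "'a::{real_inner,banach} \<Rightarrow>\<^sub>L 'a" and f :: "real \<Rightarrow> real"
  assumes sym: "symmetric T" and bdd: "bounded (f ` eigenvalues T)"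
begin

lemma fun_calc_summable: "(\<lambda>\<mu>. f \<mu> *\<^sub>R eproj T \<mu> v) summable_on eigenvalues T"
proof (rule orthogonal_summable)
  obtain K where K: "\<And>\<mu>. \<mu> \<in> eigenvalues T \<Longrightarrow> \<bar>f \<mu>\<bar> \<le> K" using bdd by (auto simp: bounded_iff)
  show "(\<lambda>\<mu>. (norm (f \<mu> *\<^sub>R eproj T \<mu> v))\<^sup>2) summable_on eigenvalues T"
  proof (rule nonneg_bdd_above_summable_on)
    show "bdd_above (sum (\<lambda>\<mu>. (norm (f \<mu> *\<^sub>R eproj T \<mu> v))\<^sup>2) ` {F. F \<subseteq> eigenvalues T \<and> finite F})"
    proof (rule bdd_aboveI2)
      fix F assume F: "F \<in> {F. F \<subseteq> eigenvalues T \<and> finite F}"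
      have "(\<Sum>\<mu>\<in>F. (norm (f \<mu> *\<^sub>R eproj T \<mu> v))\<^sup>2) \<le> (\<Sum>\<mu>\<in>F. K\<^sup>2 * (norm (eproj T \<mu> v))\<^sup>2)"
        using F K by (intro sum_mono) (auto simp: power_mult_distrib intro!: mult_right_mono power2_le_iff_abs_le[THEN iffD2] order.trans[OF _ K])
      also have "\<dots> \<le> K\<^sup>2 * (norm v)\<^sup>2"
        using F by (simp add: sum_distrib_left[symmetric] mult_left_mono eproj_bessel[OF sym])
      finally show "(\<Sum>\<mu>\<in>F. (norm (f \<mu> *\<^sub>R eproj T \<mu> v))\<^sup>2) \<le> K\<^sup>2 * (norm v)\<^sup>2" .
    qed
  qed auto
qed (simp add: eproj_orthogonal[OF sym])

lemma fun_calc_infsum_bound: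
  assumes "\<And>\<mu>. \<mu> \<in> eigenvalues T \<Longrightarrow> \<bar>f \<mu>\<bar> \<le> K"
  shows "norm (\<Sum>\<^sub>\<infinity>\<mu>\<in>eigenvalues T. f \<mu> *\<^sub>R eproj T \<mu> v) \<le> \<bar>K\<bar> * norm v"
proof -
  let ?s = "\<Sum>\<^sub>\<infinity>\<mu>\<in>eigenvalues T. f \<mu> *\<^sub>R eproj T \<mu> v"
  have "((\<lambda>\<mu>. (norm (f \<mu> *\<^sub>R eproj T \<mu> v))\<^sup>2) has_sum (norm ?s)\<^sup>2) (eigenvalues T)"
    by (rule orthogonal_has_sum_norm) (auto simp: eproj_orthogonal[OF sym] fun_calc_summable)
  then have "(norm ?s)\<^sup>2 \<le> K\<^sup>2 * (norm v)\<^sup>2"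
  proof (rule has_sum_le_finite_sums)
    fix F assume F: "finite F" "F \<subseteq> eigenvalues T"
    have "(f \<mu>)\<^sup>2 \<le> K\<^sup>2" if "\<mu> \<in> F" for \<mu>
      using assms[of \<mu>] F that by (intro abs_le_square_iff[THEN iffD1]) force
    then have "(\<Sum>\<mu>\<in>F. (norm (f \<mu> *\<^sub>R eproj T \<mu> v))\<^sup>2) \<le> (\<Sum>\<mu>\<in>F. K\<^sup>2 * (norm (eproj T \<mu> v))\<^sup>2)"
      by (intro sum_mono) (auto simp: power_mult_distrib intro!: mult_right_mono)
    also have "\<dots> \<le> K\<^sup>2 * (norm v)\<^sup>2"
      using F by (simp add: sum_distrib_left[symmetric] mult_left_mono eproj_bessel[OF sym])
    finally show "(\<Sum>\<mu>\<in>F. (norm (f \<mu> *\<^sub>R eproj T \<mu> v))\<^sup>2) \<le> K\<^sup>2 * (norm v)\<^sup>2" .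
  qed
  then have "(norm ?s)\<^sup>2 \<le> (\<bar>K\<bar> * norm v)\<^sup>2" by (simp add: power_mult_distrib)
  then show ?thesis by (rule power2_le_imp_le) simp
qed

text \<open>\<open>Blinfun\<close> returns the intended map only for bounded linear arguments;
  boundedness of \<open>f\<close> on the eigenvalues supplies this through Bessel's
  inequality.\<close>

lemma fun_calc_eq: "fun_calc f T v = (\<Sum>\<^sub>\<infinity>\<mu>\<in>eigenvalues T. f \<mu> *\<^sub>R eproj T \<mu> v)"
proof -
  obtain K where K: "\<And>\<mu>. \<mu> \<in> eigenvalues T \<Longrightarrow> \<bar>f \<mu>\<bar> \<le> K" using bdd by (auto simp: bounded_iff)
  have "bounded_linear (\<lambda>v. \<Sum>\<^sub>\<infinity>\<mu>\<in>eigenvalues T. f \<mu> *\<^sub>R eproj T \<mu> v)"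
  proof (rule bounded_linear_intro)
    fix u v c
    show "(\<Sum>\<^sub>\<infinity>\<mu>\<in>eigenvalues T. f \<mu> *\<^sub>R eproj T \<mu> (u + v))
        = (\<Sum>\<^sub>\<infinity>\<mu>\<in>eigenvalues T. f \<mu> *\<^sub>R eproj T \<mu> u) + (\<Sum>\<^sub>\<infinity>\<mu>\<in>eigenvalues T. f \<mu> *\<^sub>R eproj T \<mu> v)"
      by (simp add: eproj_add scaleR_add_right infsum_add fun_calc_summable)
    show "(\<Sum>\<^sub>\<infinity>\<mu>\<in>eigenvalues T. f \<mu> *\<^sub>R eproj T \<mu> (c *\<^sub>R v)) = c *\<^sub>R (\<Sum>\<^sub>\<infinity>\<mu>\<in>eigenvalues T. f \<mu> *\<^sub>R eproj T \<mu> v)"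
      by (simp add: eproj_scaleR infsum_scaleR_right[symmetric] mult.commute)
    show "norm (\<Sum>\<^sub>\<infinity>\<mu>\<in>eigenvalues T. f \<mu> *\<^sub>R eproj T \<mu> v) \<le> norm v * \<bar>K\<bar>"
      using fun_calc_infsum_bound[OF K] by (simp add: mult.commute)
  qed
  then show ?thesis by (simp add: fun_calc_def bounded_linear_Blinfun_apply)
qed

lemma fun_calc_has_sum: "((\<lambda>\<mu>. f \<mu> *\<^sub>R eproj T \<mu> v) has_sum fun_calc f T v) (eigenvalues T)"
  unfolding fun_calc_eq by (intro has_sum_infsum fun_calc_summable)

lemma fun_calc_norm_has_sum:
  "((\<lambda>\<mu>. (f \<mu>)\<^sup>2 * (norm (eproj T \<mu> v))\<^sup>2) has_sum (norm (fun_calc f T v))\<^sup>2) (eigenvalues T)"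
  using orthogonal_has_sum_norm[OF _ fun_calc_has_sum] by (simp add: eproj_orthogonal[OF sym] power_mult_distrib)

lemma fun_calc_inner: "((\<lambda>\<mu>. f \<mu> * (eproj T \<mu> v \<bullet> u)) has_sum (fun_calc f T v \<bullet> u)) (eigenvalues T)"
  using has_sum_bounded_linear[OF bounded_linear_inner_left[of u] fun_calc_has_sum] by simp

lemma fun_calc_symmetric: "fun_calc f T u \<bullet> v = u \<bullet> fun_calc f T v"
proof -
  have "eproj T \<mu> v \<bullet> u = eproj T \<mu> u \<bullet> v" for \<mu> by (metis eproj_inner_swap inner_commute)
  then have "fun_calc f T v \<bullet> u = fun_calc f T u \<bullet> v"
    using has_sum_unique[OF fun_calc_inner[of v u]] fun_calc_inner[of u v] by simp
  then show ?thesis by (simp add: inner_commute)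
qed

text \<open>Of the series only the term at \<open>\<mu>\<close> survives the projection. The
  equation holds for every real \<open>\<mu>\<close>, since off the eigenvalues both sides
  vanish.\<close>

lemma eproj_fun_calc: "eproj T \<mu> (fun_calc f T v) = f \<mu> *\<^sub>R eproj T \<mu> v"
proof (rule inner_all_eqI)
  fix u
  have "((\<lambda>\<mu>'. f \<mu>' * (eproj T \<mu>' v \<bullet> eproj T \<mu> u)) has_sum (fun_calc f T v \<bullet> eproj T \<mu> u)) (eigenvalues T)"
    by (rule fun_calc_inner)
  moreover have "((\<lambda>\<mu>'. f \<mu>' * (eproj T \<mu>' v \<bullet> eproj T \<mu> u)) has_sum (f \<mu> * (eproj T \<mu> v \<bullet> eproj T \<mu> u))) {\<mu>}"
    by (simp add: has_sum_finiteI)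
  then have "((\<lambda>\<mu>'. f \<mu>' * (eproj T \<mu>' v \<bullet> eproj T \<mu> u)) has_sum (f \<mu> * (eproj T \<mu> v \<bullet> eproj T \<mu> u))) (eigenvalues T)"
    by (rule has_sum_cong_neutral[THEN iffD1, rotated -1])
      (auto simp: eproj_orthogonal[OF sym] eproj_not_eigenvalue)
  ultimately have "fun_calc f T v \<bullet> eproj T \<mu> u = f \<mu> * (eproj T \<mu> v \<bullet> eproj T \<mu> u)"
    by (rule has_sum_unique)
  then show "u \<bullet> eproj T \<mu> (fun_calc f T v) = u \<bullet> f \<mu> *\<^sub>R eproj T \<mu> v"
    by (metis eproj_inner_eq eproj_inner_swap inner_commute inner_scaleR_right)
qed

end

subsection \<open>Finite rank\<close>

text \<open>This is \<open>p(T) v\<close> by Horner's scheme; the fold fits induction over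
  \<open>pCons\<close>.\<close>

definition poly_apply :: "('a::real_normed_vector \<Rightarrow>\<^sub>L 'a) \<Rightarrow> real poly \<Rightarrow> 'a \<Rightarrow> 'a" where
  "poly_apply T p = fold_coeffs (\<lambda>a h v. a *\<^sub>R v + blinfun_apply T (h v)) p (\<lambda>_. 0)"

lemma poly_apply_0 [simp]: "poly_apply T 0 v = 0"
  by (simp add: poly_apply_def)

lemma poly_apply_pCons [simp]: "poly_apply T (pCons a p) v = a *\<^sub>R v + T (poly_apply T p v)"
proof (cases "a = 0 \<and> p = 0")
  case False
  then show ?thesis unfolding poly_apply_def by (cases "a = 0") auto
qed (auto simp: blinfun.zero_right)

lemma poly_apply_add: "poly_apply T (p + q) v = poly_apply T p v + poly_apply T q v"
  by (induction p q rule: poly_induct2) (auto simp: blinfun.add_right algebra_simps)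

lemma poly_apply_smult: "poly_apply T (smult c p) v = c *\<^sub>R poly_apply T p v"
  by (induction p) (auto simp: blinfun.scaleR_right algebra_simps)

lemma poly_apply_mult: "poly_apply T (p * q) v = poly_apply T p (poly_apply T q v)"
  by (induction p) (auto simp: mult_pCons_left poly_apply_add poly_apply_smult)

lemma poly_apply_minus_right: "poly_apply T p (u - v) = poly_apply T p u - poly_apply T p v"
  by (induction p) (auto simp: blinfun.diff_right scaleR_diff_right)

lemma poly_apply_scaleR_right: "poly_apply T p (c *\<^sub>R v) = c *\<^sub>R poly_apply T p v"
  by (induction p) (auto simp: blinfun.scaleR_right algebra_simps)

lemma poly_apply_eigen: "v \<in> eigenspace T \<mu> \<Longrightarrow> poly_apply T p v = poly p \<mu> *\<^sub>R v"
  by (induction p) (auto simp: eigenspace_def blinfun.scaleR_right algebra_simps)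

lemma poly_apply_monom: "poly_apply T (monom c i) v = c *\<^sub>R (blinfun_apply T ^^ i) v"
  by (induction i) (auto simp: monom_0 monom_Suc blinfun.scaleR_right blinfun.zero_right)

lemma poly_apply_sum: "poly_apply T (\<Sum>i\<in>I. p i) v = (\<Sum>i\<in>I. poly_apply T (p i) v)"
  by (induction I rule: infinite_finite_induct) (auto simp: poly_apply_add)

text \<open>Real polynomials at complex points: the fundamental theorem of algebra provides a
  complex root, which is then turned into a real linear or quadratic factor.\<close>

lemma cpoly_pCons: "poly (map_poly complex_of_real (pCons a p)) z
    = complex_of_real a + z * poly (map_poly complex_of_real p) z"
  by (simp add: map_poly_pCons)

lemma cpoly_add: "poly (map_poly complex_of_real (p + q)) z
    = poly (map_poly complex_of_real p) z + poly (map_poly complex_of_real q) z"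
  by (induction p q rule: poly_induct2) (simp_all add: cpoly_pCons algebra_simps)

lemma cpoly_smult: "poly (map_poly complex_of_real (smult c p)) z
    = complex_of_real c * poly (map_poly complex_of_real p) z"
  by (induction p) (simp_all add: cpoly_pCons algebra_simps)

lemma cpoly_mult: "poly (map_poly complex_of_real (p * q)) z
    = poly (map_poly complex_of_real p) z * poly (map_poly complex_of_real q) z"
  by (induction p) (simp_all add: cpoly_pCons cpoly_add cpoly_smult mult_pCons_left algebra_simps)

lemma cpoly_of_real: "poly (map_poly complex_of_real p) (complex_of_real x) = complex_of_real (poly p x)"
  by (induction p) (simp_all add: cpoly_pCons)

text \<open>Induction on the degree, removing one real root or one pair of conjugate roots at a
  time. Symmetry of \<open>T\<close> makes a repeated real factor redundant and a quadratic factor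
  without real roots injective.\<close>

lemma annihilated_in_span_eigenspaces:
  assumes sym: "symmetric T"
  shows "p \<noteq> 0 \<Longrightarrow> poly_apply T p v = 0 \<Longrightarrow> v \<in> span (\<Union>\<mu>. eigenspace T \<mu>)"
proof (induction "degree p" arbitrary: p v rule: less_induct)
  case less
  show ?case
  proof (cases "degree p = 0")
    case True
    then obtain c where "p = [:c:]" by (meson degree_eq_zeroE)
    with less have "v = 0" by (simp add: blinfun.zero_right)
    then show ?thesis by (simp add: span_zero)
  next
    case False
    let ?cp = "map_poly complex_of_real p"
    have "\<not> constant (poly ?cp)"
      using False by (simp add: constant_degree degree_map_poly)
    then obtain z where z: "poly ?cp z = 0" using fundamental_theorem_of_algebra by blast
    show ?thesis
    proof (cases "Im z = 0")
      case True
      define \<mu> where "\<mu> = Re z"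
      have "z = complex_of_real \<mu>" using True by (simp add: \<mu>_def complex_eq_iff)
      then have "poly p \<mu> = 0" using z by (simp add: cpoly_of_real)
      then obtain q where p: "p = [:- \<mu>, 1:] * q" by (metis poly_eq_0_iff_dvd dvdE)
      have q0: "q \<noteq> 0" using less.prems(1) p by auto
      then have dq: "degree q < degree p" unfolding p by (subst degree_mult_eq) auto
      define w where "w = poly_apply T q v"
      have Tw: "T w = \<mu> *\<^sub>R w" using less.prems(2) by (simp add: p poly_apply_mult blinfun.zero_right w_def del: mult_pCons_left)
      then have we: "w \<in> eigenspace T \<mu>" by (simp add: eigenspace_def)
      show ?thesis
      proof (cases "poly q \<mu> = 0")
        case False
        \<comment> \<open>\<open>q\<close> acts on the eigenvector \<open>w\<close> as the scalar
          \<open>poly q \<mu>\<close>, so this multiple of \<open>w\<close> is the part of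
          \<open>v\<close> that \<open>q\<close> does not annihilate.\<close>
        have "poly_apply T q (v - (1 / poly q \<mu>) *\<^sub>R w) = 0"
          using False poly_apply_eigen[OF we, of q]
          by (simp add: poly_apply_minus_right poly_apply_scaleR_right flip: w_def)
        then have "v - (1 / poly q \<mu>) *\<^sub>R w \<in> span (\<Union>\<mu>. eigenspace T \<mu>)" by (rule less.hyps[OF dq q0])
        moreover have "(1 / poly q \<mu>) *\<^sub>R w \<in> span (\<Union>\<mu>. eigenspace T \<mu>)"
          using we by (intro span_scale span_base) blast
        ultimately show ?thesis using span_add by fastforce
      next
        case True
        then obtain q' where q: "q = [:- \<mu>, 1:] * q'" by (metis poly_eq_0_iff_dvd dvdE)
        define w' where "w' = poly_apply T q' v"
        \<comment> \<open>\<open>w\<close> is an eigenvector for \<open>\<mu>\<close> and also in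
          the range of \<open>T - \<mu>\<close>. For symmetric \<open>T\<close> these spaces are
          orthogonal, so \<open>w = 0\<close> and already \<open>q\<close> annihilates
          \<open>v\<close>.\<close>
        have "w = T w' - \<mu> *\<^sub>R w'"
          by (simp add: w_def q poly_apply_mult blinfun.zero_right w'_def del: mult_pCons_left)
        then have "w \<bullet> w = T w' \<bullet> w - \<mu> * (w' \<bullet> w)" by (metis inner_diff_left inner_scaleR_left)
        also have "\<dots> = 0" by (simp add: symmetricD[OF sym] Tw)
        finally have "poly_apply T q v = 0" by (simp add: w_def)
        then show ?thesis by (rule less.hyps[OF dq q0])
      qed
    next
      case False
      define a b where "a = Re z" and "b = Im z"
      \<comment> \<open>The real polynomial with the roots \<open>z\<close> and its conjugate. A
        real remainder of degree below 2 that vanishes at the non-real \<open>z\<close> is zero,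
        hence \<open>Q\<close> divides \<open>p\<close>.\<close>
      define Q where "Q = [:a\<^sup>2 + b\<^sup>2, - 2 * a, 1:]"
      define r where "r = p mod Q"
      have Q0: "Q \<noteq> 0" "degree Q = 2" by (auto simp: Q_def)
      have "degree r < 2" using degree_mod_less[of Q p] Q0 by (auto simp: r_def)
      then obtain r0 r1 where r: "r = [:r0, r1:]"
        by (metis Suc_1 degree_pCons_eq_if less_Suc_eq_0_disj less_Suc_eq_le pCons_cases zero_less_Suc degree_0 le_zero_eq not_less_eq degree_eq_zeroE less_2_cases)
      have pe: "p = Q * (p div Q) + r" by (simp add: r_def)
      have "poly (map_poly complex_of_real Q) z = 0"
        by (simp add: Q_def a_def b_def cpoly_pCons complex_eq_iff power2_eq_square algebra_simps)
      then have "poly (map_poly complex_of_real r) z = 0"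
        using z pe by (metis add_0 cpoly_add cpoly_mult mult_zero_left)
      then have "r0 + r1 * a = 0" "r1 * b = 0"
        by (auto simp: r a_def b_def complex_eq_iff cpoly_pCons algebra_simps)
      then have "r = 0" using False by (simp add: r b_def)
      then obtain q where p: "p = Q * q" using pe by auto
      have q0: "q \<noteq> 0" using less.prems(1) p by auto
      then have dq: "degree q < degree p" unfolding p using Q0 by (subst degree_mult_eq) auto
      define w where "w = poly_apply T q v"
      have "(a\<^sup>2 + b\<^sup>2) *\<^sub>R w + T (- (2 * a) *\<^sub>R w + T w) = 0"
        using less.prems(2) by (simp add: p Q_def poly_apply_mult blinfun.zero_right w_def del: mult_pCons_left)
      then have "((a\<^sup>2 + b\<^sup>2) *\<^sub>R w + T (- (2 * a) *\<^sub>R w + T w)) \<bullet> w = 0" by simp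
      then have "(a\<^sup>2 + b\<^sup>2) * (w \<bullet> w) - 2 * a * (w \<bullet> T w) + T w \<bullet> T w = 0"
        by (simp add: inner_add_left inner_diff_left inner_diff_right blinfun.diff_right blinfun.scaleR_right
            symmetricD[OF sym] algebra_simps inner_commute)
      \<comment> \<open>Completing the square: the relation above says \<open>(norm (T w - a
        *\<^sub>R w))\<^sup>2 + b\<^sup>2 * (w \<bullet> w) = 0\<close>.\<close>
      moreover have "(T w - a *\<^sub>R w) \<bullet> (T w - a *\<^sub>R w) = T w \<bullet> T w - 2 * a * (w \<bullet> T w) + a\<^sup>2 * (w \<bullet> w)"
        by (simp add: inner_simps inner_commute power2_eq_square)
      moreover have "(T w - a *\<^sub>R w) \<bullet> (T w - a *\<^sub>R w) \<ge> 0" by simp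
      ultimately have "b\<^sup>2 * (w \<bullet> w) \<le> 0" by (simp add: algebra_simps)
      then have "w \<bullet> w \<le> 0" using False by (simp add: b_def mult_le_0_iff)
      then have "w = 0" by (metis inner_eq_zero_iff inner_ge_zero order_antisym)
      then show ?thesis using less.hyps[OF dq q0] by (simp add: w_def)
    qed
  qed
qed

text \<open>The iterates of \<open>T\<close> at \<open>v\<close> stay in a space spanned by finitely
  many vectors, so they are linearly dependent; the dependence is a polynomial annihilating
  \<open>v\<close>.\<close>

lemma finite_rank_in_span_eigenspaces:
  fixes T :: "'a::real_inner \<Rightarrow>\<^sub>L 'a"
  assumes sym: "symmetric T" and B: "finite B" "range (blinfun_apply T) \<subseteq> span B"
  shows "v \<in> span (\<Union>\<mu>. eigenspace T \<mu>)"
proof -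
  \<comment> \<open>\<open>h 0, \<dots>, h m\<close> are \<open>m + 1\<close> vectors, one more than
    the size of the spanning set.\<close>
  define m where "m = card (insert v B)"
  define h where "h i = (blinfun_apply T ^^ i) v" for i
  have hB: "h i \<in> span (insert v B)" for i
    using B(2) span_mono[of B "insert v B"] by (cases i) (auto simp: h_def span_base)
  have "\<exists>p. p \<noteq> 0 \<and> poly_apply T p v = 0"
  proof (cases "inj_on h {..m}")
    case True
    have "dependent (h ` {..m})"
    proof (rule ccontr)
      assume "independent (h ` {..m})"
      then have "card (h ` {..m}) \<le> card (insert v B)"
        using independent_span_bound[of "insert v B" "h ` {..m}"] hB B(1) by auto
      then show False using card_image[OF True] by (simp add: m_def)
    qed
    then obtain u where u: "\<exists>x\<in>h ` {..m}. u x \<noteq> 0" "(\<Sum>x\<in>h ` {..m}. u x *\<^sub>R x) = 0"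
      using dependent_finite[of "h ` {..m}"] by auto
    define p where "p = (\<Sum>i\<le>m. monom (u (h i)) i)"
    obtain i where i: "i \<le> m" "u (h i) \<noteq> 0" using u(1) by auto
    have "coeff p i = u (h i)" using i by (simp add: p_def coeff_sum)
    then have "p \<noteq> 0" using i by auto
    moreover have "poly_apply T p v = (\<Sum>i\<le>m. u (h i) *\<^sub>R h i)"
      by (simp add: p_def poly_apply_sum poly_apply_monom h_def)
    then have "poly_apply T p v = 0" using u(2) by (simp add: sum.reindex[OF True])
    ultimately show ?thesis by blast
  next
    case False
    \<comment> \<open>Repeated iterates are counted once in the image set, so the dimension count
      fails; the difference of two monomials annihilates \<open>v\<close> directly.\<close>
    then obtain i j where ij: "h i = h j" "i \<noteq> j" by (auto simp: inj_on_def)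
    define p where "p = monom (1::real) i + monom (-1) j"
    have "coeff p i = 1" using ij by (simp add: p_def)
    then have "p \<noteq> 0" by auto
    moreover have "poly_apply T p v = 0" using ij(1) by (simp add: p_def poly_apply_add poly_apply_monom h_def)
    ultimately show ?thesis by blast
  qed
  then show ?thesis using annihilated_in_span_eigenspaces[OF sym] by blast
qed

lemma finite_rank_eigen_expansion:
  fixes T :: "'a::{real_inner,banach} \<Rightarrow>\<^sub>L 'a"
  assumes sym: "symmetric T" and B: "finite B" "range (blinfun_apply T) \<subseteq> span B"
  shows "\<exists>F. finite F \<and> F \<subseteq> eigenvalues T \<and> v = (\<Sum>\<mu>\<in>F. eproj T \<mu> v)"
proof -
  \<comment> \<open>Asking for the expansion over every finite \<open>G\<close> containing
    \<open>F\<close>, not just over one set, lets the property pass to sums.\<close>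
  define good where "good v \<longleftrightarrow> (\<exists>F. finite F \<and> (\<forall>G. finite G \<longrightarrow> F \<subseteq> G \<longrightarrow> v = (\<Sum>\<mu>\<in>G. eproj T \<mu> v)))" for v
  have "v \<in> span (\<Union>\<mu>. eigenspace T \<mu>)" by (rule finite_rank_in_span_eigenspaces[OF assms])
  then have "good v"
  proof (induction rule: span_induct_alt)
    case base
    show ?case unfolding good_def by (rule exI[of _ "{}"]) (simp add: eproj_zero)
  next
    case (step c x y)
    obtain \<mu> where x: "x \<in> eigenspace T \<mu>" using step(1) by blast
    obtain F where F: "finite F" "\<And>G. finite G \<Longrightarrow> F \<subseteq> G \<Longrightarrow> y = (\<Sum>\<mu>\<in>G. eproj T \<mu> y)"
      using step(2) by (auto simp: good_def)
    have "c *\<^sub>R x + y = (\<Sum>\<mu>\<in>G. eproj T \<mu> (c *\<^sub>R x + y))" if G: "finite G" "insert \<mu> F \<subseteq> G" for G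
    proof -
      have "(\<Sum>\<mu>'\<in>G. eproj T \<mu>' x) = (\<Sum>\<mu>'\<in>G. if \<mu>' = \<mu> then x else 0)"
      proof (rule sum.cong)
        fix \<mu>' show "eproj T \<mu>' x = (if \<mu>' = \<mu> then x else 0)"
          using eproj_eproj[OF sym, of \<mu>' \<mu> x] eproj_self[OF x] by auto
      qed simp
      then have "(\<Sum>\<mu>'\<in>G. eproj T \<mu>' x) = x" using G by simp
      moreover have "y = (\<Sum>\<mu>\<in>G. eproj T \<mu> y)" using F(2) G by auto
      ultimately show ?thesis
        by (simp add: eproj_add eproj_scaleR sum.distrib flip: scaleR_sum_right)
    qed
    then show ?case unfolding good_def using F(1) by (intro exI[of _ "insert \<mu> F"]) auto
  qed
  then obtain F where F: "finite F" "v = (\<Sum>\<mu>\<in>F. eproj T \<mu> v)" unfolding good_def by blast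
  have "v = (\<Sum>\<mu>\<in>F \<inter> eigenvalues T. eproj T \<mu> v)"
    by (subst F(2), rule sum.mono_neutral_right) (use F(1) in \<open>auto simp: eproj_not_eigenvalue\<close>)
  then show ?thesis using F(1) by (intro exI[of _ "F \<inter> eigenvalues T"]) auto
qed

section \<open>The Heinz inequality\<close>

text \<open>With \<open>\<tau> = exp (2 * y)\<close> the integrand is
  \<open>\<tau> powr (- \<theta>) * (\<tau> / (1 + \<tau>))\<close>. It decays like
  \<open>exp (- 2 * \<theta> * y)\<close> on the right and like
  \<open>exp (- 2 * (1 - \<theta>) * \<bar>y\<bar>)\<close> on the left, which uses both strict
  bounds on \<open>\<theta>\<close>.\<close>

lemma heinz_kernel_finite:
  fixes \<theta> :: real
  assumes "0 < \<theta>" "\<theta> < 1"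
  shows "(\<integral>\<^sup>+y. ennreal (exp (2 * (1 - \<theta>) * y) / (1 + exp (2 * y))) \<partial>lborel) < \<infinity>" (is "?c < _")
proof -
  have fin: "(\<integral>\<^sup>+y. ennreal (exp (- a * y)) * indicator {0..} y \<partial>lborel) < \<infinity>" if "a > 0" for a :: real
  proof -
    have "(\<integral>\<^sup>+y. ennreal (exp (- a * y)) * indicator {0..} y \<partial>lborel) = ennreal (0 - (- exp (- a * 0) / a))"
    proof (rule nn_integral_FTC_atLeast)
      show "DERIV (\<lambda>y. - exp (- a * y) / a) x :> exp (- a * x)" for x
        using that by (auto intro!: derivative_eq_intros)
      show "((\<lambda>y. - exp (- a * y) / a) \<longlongrightarrow> 0) at_top"
      proof -
        have "filterlim (\<lambda>y. - a * y) at_bot at_top"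
          using that by (simp add: filterlim_uminus_at_bot filterlim_tendsto_pos_mult_at_top[OF tendsto_const] filterlim_ident)
        then have "((\<lambda>y. exp (- a * y)) \<longlongrightarrow> 0) at_top" by (rule filterlim_compose[OF exp_at_bot])
        then have "((\<lambda>y. - exp (- a * y) / a) \<longlongrightarrow> - 0 / a) at_top" by (intro tendsto_intros) (use that in auto)
        then show ?thesis by simp
      qed
    qed auto
    then show ?thesis by simp
  qed
  have "?c \<le> (\<integral>\<^sup>+y. ennreal (exp (- (2 * \<theta>) * y)) * indicator {0..} y
           + ennreal (exp (- (2 * (1 - \<theta>)) * (- y))) * indicator {0..} (- y) \<partial>lborel)"
  proof (rule nn_integral_mono)
    fix y :: real
    show "ennreal (exp (2 * (1 - \<theta>) * y) / (1 + exp (2 * y)))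
      \<le> ennreal (exp (- (2 * \<theta>) * y)) * indicator {0..} y
           + ennreal (exp (- (2 * (1 - \<theta>)) * (- y))) * indicator {0..} (- y)"
    proof (cases "y \<ge> 0")
      case True
      have "exp (2 * (1 - \<theta>) * y) / (1 + exp (2 * y)) \<le> exp (2 * (1 - \<theta>) * y) / exp (2 * y)"
        by (intro divide_left_mono) (auto intro!: mult_pos_pos add_pos_pos)
      also have "\<dots> = exp (- (2 * \<theta>) * y)" by (simp add: exp_diff[symmetric] algebra_simps)
      finally show ?thesis using True by (auto intro!: add_increasing2 ennreal_leI)
    next
      case False
      have "exp (2 * (1 - \<theta>) * y) / (1 + exp (2 * y)) \<le> exp (2 * (1 - \<theta>) * y) / 1"
        by (intro divide_left_mono) (auto intro!: mult_pos_pos add_pos_pos)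
      also have "exp (2 * (1 - \<theta>) * y) / 1 = exp (- (2 * (1 - \<theta>)) * (- y))" by (simp add: algebra_simps)
      finally have *: "exp (2 * (1 - \<theta>) * y) / (1 + exp (2 * y)) \<le> exp (- (2 * (1 - \<theta>)) * (- y))" .
      have i: "indicator {0..} y = (0::ennreal)" "indicator {0..} (- y) = (1::ennreal)" using False by simp_all
      show ?thesis unfolding i mult_zero_right mult_1_right add_0_left by (rule ennreal_leI[OF *])
    qed
  qed
  also have "\<dots> = (\<integral>\<^sup>+y. ennreal (exp (- (2 * \<theta>) * y)) * indicator {0..} y \<partial>lborel)
           + (\<integral>\<^sup>+y. ennreal (exp (- (2 * (1 - \<theta>)) * (- y))) * indicator {0..} (- y) \<partial>lborel)"
    by (rule nn_integral_add) measurable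
  also have "(\<integral>\<^sup>+y. ennreal (exp (- (2 * (1 - \<theta>)) * (- y))) * indicator {0..} (- y) \<partial>lborel)
    = (\<integral>\<^sup>+y. ennreal (exp (- (2 * (1 - \<theta>)) * y)) * indicator {0..} y \<partial>lborel)"
    by (subst nn_integral_real_affine[where c = "-1" and t = 0 and
          f = "\<lambda>y. ennreal (exp (- (2 * (1 - \<theta>)) * y)) * indicator {0..} y"]) auto
  also have "(\<integral>\<^sup>+y. ennreal (exp (- (2 * \<theta>) * y)) * indicator {0..} y \<partial>lborel) + \<dots> < \<infinity>"
    using fin[of "2 * \<theta>"] fin[of "2 * (1 - \<theta>)"] assms by simp
  finally show ?thesis .
qed

lemma heinz_kernel_pos:
  fixes \<theta> :: real
  shows "(\<integral>\<^sup>+y. ennreal (exp (2 * (1 - \<theta>) * y) / (1 + exp (2 * y))) \<partial>lborel) > 0" (is "?c > _")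
proof -
  have pos: "exp (2 * (1 - \<theta>) * y) / (1 + exp (2 * y)) > 0" for y :: real
    by (intro divide_pos_pos add_pos_pos) auto
  have "?c \<noteq> 0"
  proof
    assume "?c = 0"
    then have "AE y in lborel. ennreal (exp (2 * (1 - \<theta>) * y) / (1 + exp (2 * y))) = 0"
      by (subst (asm) nn_integral_0_iff_AE) measurable
    then have "AE y in lborel :: real measure. False"
      by eventually_elim (use pos in \<open>simp only: ennreal_eq_0_iff not_le[symmetric]\<close>)
    then show False using AE_iff_null[of lborel "\<lambda>_::real. False"] by (simp add: null_sets_def)
  qed
  then show ?thesis by (simp add: zero_less_iff_neq_zero)
qed

text \<open>Scaling \<open>\<tau>\<close> by \<open>x\<^sup>2\<close> is a translation in the
  exponential variable, under which Lebesgue measure is invariant; the power of \<open>x\<close> is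
  what the factor \<open>exp (- 2 * \<theta> * y)\<close> picks up.\<close>

lemma heinz_kernel_scale:
  fixes \<theta> x :: real
  assumes "x > 0"
  shows "(\<integral>\<^sup>+y. ennreal (exp (- 2 * \<theta> * y) * (exp (2 * y) * x\<^sup>2 / (1 + exp (2 * y) * x\<^sup>2))) \<partial>lborel)
       = ennreal (x powr (2 * \<theta>)) * (\<integral>\<^sup>+y. ennreal (exp (2 * (1 - \<theta>) * y) / (1 + exp (2 * y))) \<partial>lborel)"
proof -
  have x2: "x\<^sup>2 = exp (2 * ln x)" using assms by (simp add: exp_double)
  have "(\<integral>\<^sup>+y. ennreal (exp (- 2 * \<theta> * y) * (exp (2 * y) * x\<^sup>2 / (1 + exp (2 * y) * x\<^sup>2))) \<partial>lborel)
      = (\<integral>\<^sup>+y. ennreal (exp (- 2 * \<theta> * (- ln x + 1 * y)) * (exp (2 * (- ln x + 1 * y)) * x\<^sup>2 / (1 + exp (2 * (- ln x + 1 * y)) * x\<^sup>2))) \<partial>lborel)"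
    by (subst nn_integral_real_affine[where c = 1 and t = "- ln x"]) auto
  also have "\<dots> = (\<integral>\<^sup>+y. ennreal (x powr (2 * \<theta>)) * ennreal (exp (2 * (1 - \<theta>) * y) / (1 + exp (2 * y))) \<partial>lborel)"
  proof (rule nn_integral_cong)
    fix y :: real
    have a: "exp (2 * (- ln x + 1 * y)) * x\<^sup>2 = exp (2 * y)"
      unfolding x2 by (simp add: exp_add[symmetric] algebra_simps)
    have b: "exp (- 2 * \<theta> * (- ln x + 1 * y)) * exp (2 * y) = x powr (2 * \<theta>) * exp (2 * (1 - \<theta>) * y)"
      using assms by (simp add: powr_def exp_add[symmetric] algebra_simps)
    have "exp (- 2 * \<theta> * (- ln x + 1 * y)) * (exp (2 * (- ln x + 1 * y)) * x\<^sup>2 / (1 + exp (2 * (- ln x + 1 * y)) * x\<^sup>2))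
       = x powr (2 * \<theta>) * (exp (2 * (1 - \<theta>) * y) / (1 + exp (2 * y)))"
      unfolding a using b by simp
    then show "ennreal (exp (- 2 * \<theta> * (- ln x + 1 * y)) * (exp (2 * (- ln x + 1 * y)) * x\<^sup>2 / (1 + exp (2 * (- ln x + 1 * y)) * x\<^sup>2)))
       = ennreal (x powr (2 * \<theta>)) * ennreal (exp (2 * (1 - \<theta>) * y) / (1 + exp (2 * y)))"
      by (simp only: ennreal_mult'[symmetric] powr_ge_zero)
  qed
  also have "\<dots> = ennreal (x powr (2 * \<theta>)) * (\<integral>\<^sup>+y. ennreal (exp (2 * (1 - \<theta>) * y) / (1 + exp (2 * y))) \<partial>lborel)"
    by (rule nn_integral_cmult) measurable
  finally show ?thesis .
qed

text \<open>The weight \<open>\<tau> x\<^sup>2 / (1 + \<tau> x\<^sup>2)\<close> is the quadratic K-functional of the couple of norms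
  \<open>1, x\<close>; integrating it against a power of \<open>\<tau>\<close> yields a multiple of \<open>x powr (2 * \<theta>)\<close>.\<close>

lemma interpolate_weights:
  fixes x a :: "'i \<Rightarrow> real" and y b :: "'j \<Rightarrow> real"
  assumes \<theta>: "0 < \<theta>" "\<theta> < 1" and fin: "finite F" "finite G"
    and x: "\<And>i. i \<in> F \<Longrightarrow> x i > 0" "\<And>i. i \<in> F \<Longrightarrow> a i \<ge> 0"
    and y: "\<And>j. j \<in> G \<Longrightarrow> y j > 0" "\<And>j. j \<in> G \<Longrightarrow> b j \<ge> 0"
    and le: "\<And>\<tau>. \<tau> > 0 \<Longrightarrow> (\<Sum>i\<in>F. (\<tau> * (x i)\<^sup>2 / (1 + \<tau> * (x i)\<^sup>2)) * a i)
                    \<le> (\<Sum>j\<in>G. (\<tau> * (y j)\<^sup>2 / (1 + \<tau> * (y j)\<^sup>2)) * b j)"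
  shows "(\<Sum>i\<in>F. x i powr (2 * \<theta>) * a i) \<le> (\<Sum>j\<in>G. y j powr (2 * \<theta>) * b j)"
proof -
  define c where "c = (\<integral>\<^sup>+y. ennreal (exp (2 * (1 - \<theta>) * y) / (1 + exp (2 * y))) \<partial>lborel)"
  \<comment> \<open>The weight at \<open>\<tau> = exp (2 * t)\<close>, multiplied by
    \<open>\<tau> powr (- \<theta>)\<close>.\<close>
  define k where "k x t = exp (- 2 * \<theta> * t) * (exp (2 * t) * x\<^sup>2 / (1 + exp (2 * t) * x\<^sup>2))" for x t :: real
  have k0: "k x t \<ge> 0" for x t unfolding k_def by (intro mult_nonneg_nonneg divide_nonneg_nonneg) (auto intro: add_nonneg_nonneg)
  have km: "(\<lambda>t. k x t) \<in> borel_measurable borel" for x unfolding k_def by measurable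
  have int: "(\<integral>\<^sup>+t. ennreal (\<Sum>i\<in>I. k (z i) t * w i) \<partial>lborel) = ennreal (\<Sum>i\<in>I. z i powr (2 * \<theta>) * w i) * c"
    if "finite I" "\<And>i. i \<in> I \<Longrightarrow> z i > 0" "\<And>i. i \<in> I \<Longrightarrow> w i \<ge> 0" for I and z w :: "'k \<Rightarrow> real"
  proof -
    have "(\<integral>\<^sup>+t. ennreal (\<Sum>i\<in>I. k (z i) t * w i) \<partial>lborel) = (\<integral>\<^sup>+t. (\<Sum>i\<in>I. ennreal (k (z i) t) * ennreal (w i)) \<partial>lborel)"
      using that k0 by (intro nn_integral_cong) (simp add: sum_ennreal[symmetric] ennreal_mult')
    also have "\<dots> = (\<Sum>i\<in>I. \<integral>\<^sup>+t. ennreal (k (z i) t) * ennreal (w i) \<partial>lborel)"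
      by (rule nn_integral_sum) (use km in measurable)
    also have "\<dots> = (\<Sum>i\<in>I. ennreal (z i powr (2 * \<theta>) * w i) * c)"
    proof (rule sum.cong)
      fix i assume "i \<in> I"
      have "(\<integral>\<^sup>+t. ennreal (k (z i) t) * ennreal (w i) \<partial>lborel) = (\<integral>\<^sup>+t. ennreal (k (z i) t) \<partial>lborel) * ennreal (w i)"
        by (rule nn_integral_multc) (use km in measurable)
      also have "(\<integral>\<^sup>+t. ennreal (k (z i) t) \<partial>lborel) = ennreal (z i powr (2 * \<theta>)) * c"
        unfolding k_def c_def using that \<open>i \<in> I\<close> by (intro heinz_kernel_scale) auto
      finally show "(\<integral>\<^sup>+t. ennreal (k (z i) t) * ennreal (w i) \<partial>lborel) = ennreal (z i powr (2 * \<theta>) * w i) * c"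
        using that \<open>i \<in> I\<close> by (simp add: ennreal_mult mult_ac)
    qed simp
    also have "\<dots> = ennreal (\<Sum>i\<in>I. z i powr (2 * \<theta>) * w i) * c"
      using that by (simp add: sum_distrib_right[symmetric] sum_ennreal)
    finally show ?thesis .
  qed
  have "ennreal (\<Sum>i\<in>F. x i powr (2 * \<theta>) * a i) * c = (\<integral>\<^sup>+t. ennreal (\<Sum>i\<in>F. k (x i) t * a i) \<partial>lborel)"
    by (rule int[symmetric]) (use fin x in auto)
  also have "\<dots> \<le> (\<integral>\<^sup>+t. ennreal (\<Sum>j\<in>G. k (y j) t * b j) \<partial>lborel)"
  proof (intro nn_integral_mono ennreal_leI)
    fix t :: real
    have *: "(\<Sum>i\<in>I. k (z i) t * w i) = exp (- 2 * \<theta> * t) * (\<Sum>i\<in>I. (exp (2 * t) * (z i)\<^sup>2 / (1 + exp (2 * t) * (z i)\<^sup>2)) * w i)"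
      for I and z w :: "'k \<Rightarrow> real"
      unfolding k_def sum_distrib_left by (simp add: mult.assoc)
    show "(\<Sum>i\<in>F. k (x i) t * a i) \<le> (\<Sum>j\<in>G. k (y j) t * b j)"
      unfolding * by (intro mult_left_mono le) auto
  qed
  also have "\<dots> = ennreal (\<Sum>j\<in>G. y j powr (2 * \<theta>) * b j) * c" by (rule int) (use fin y in auto)
  \<comment> \<open>The common factor \<open>c\<close> is positive and finite, so it
    cancels.\<close>
  finally have "ennreal (\<Sum>i\<in>F. x i powr (2 * \<theta>) * a i) \<le> ennreal (\<Sum>j\<in>G. y j powr (2 * \<theta>) * b j)"
    using heinz_kernel_finite[OF \<theta>] heinz_kernel_pos[of \<theta>]
    unfolding c_def[symmetric] by (simp add: ennreal_mult_le_mult_iff mult.commute[of _ c])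
  then show ?thesis using y by (simp add: sum_nonneg)
qed

text \<open>A splitting of \<open>w\<close> that is optimal for \<open>Ch + lam\<close> is a
  competitor for \<open>C + lam\<close>, so the K-functionals compare for every
  \<open>\<tau>\<close>, and integration in \<open>\<tau>\<close> compares the fractional powers.
  The set \<open>F\<close> is arbitrary and enters through Bessel, while \<open>w\<close> must be
  fully expanded in eigenvectors of \<open>Ch\<close>.\<close>

lemma heinz_inequality:
  fixes C Ch :: "'a::{real_inner,banach} \<Rightarrow>\<^sub>L 'a"
  assumes sym: "symmetric C" "symmetric Ch" and lam: "lam > 0"
    and le: "\<And>v. norm (C v + lam *\<^sub>R v) \<le> 2 * norm (Ch v + lam *\<^sub>R v)"
    and fin: "finite F" "finite G" and nn: "\<And>\<mu>. \<mu> \<in> F \<Longrightarrow> \<mu> \<ge> 0" "\<And>\<sigma>. \<sigma> \<in> G \<Longrightarrow> \<sigma> \<ge> 0"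
    and w: "w = (\<Sum>\<sigma>\<in>G. eproj Ch \<sigma> w)" and \<theta>: "0 \<le> \<theta>" "\<theta> < 1"
  shows "(\<Sum>\<mu>\<in>F. (\<mu> + lam) powr (2 * \<theta>) * (norm (eproj C \<mu> w))\<^sup>2)
       \<le> 4 powr \<theta> * (\<Sum>\<sigma>\<in>G. (\<sigma> + lam) powr (2 * \<theta>) * (norm (eproj Ch \<sigma> w))\<^sup>2)"
proof -
  have orthG: "(norm (\<Sum>\<sigma>\<in>G. f \<sigma> *\<^sub>R eproj Ch \<sigma> w))\<^sup>2 = (\<Sum>\<sigma>\<in>G. (f \<sigma>)\<^sup>2 * (norm (eproj Ch \<sigma> w))\<^sup>2)" for f
  proof -
    have "(norm (\<Sum>\<sigma>\<in>G. f \<sigma> *\<^sub>R eproj Ch \<sigma> w))\<^sup>2 = (\<Sum>\<sigma>\<in>G. (norm (f \<sigma> *\<^sub>R eproj Ch \<sigma> w))\<^sup>2)"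
      by (rule norm_orthogonal_sum[OF fin(2)]) (simp add: eproj_orthogonal[OF sym(2)])
    then show ?thesis by (simp add: power_mult_distrib)
  qed
  show ?thesis
  proof (cases "\<theta> = 0")
    case True
    \<comment> \<open>At \<open>\<theta> = 0\<close> the kernel integral diverges, but the claim is
      just Bessel against Parseval.\<close>
    have "(\<Sum>\<mu>\<in>F. (norm (eproj C \<mu> w))\<^sup>2) \<le> (norm w)\<^sup>2" by (rule eproj_bessel[OF sym(1) fin(1)])
    also have "\<dots> = (\<Sum>\<sigma>\<in>G. (norm (eproj Ch \<sigma> w))\<^sup>2)" using orthG[of "\<lambda>_. 1"] w by simp
    finally have "(\<Sum>\<mu>\<in>F. (norm (eproj C \<mu> w))\<^sup>2) \<le> (\<Sum>\<sigma>\<in>G. (norm (eproj Ch \<sigma> w))\<^sup>2)" .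
    moreover have "\<mu> + lam \<noteq> 0" if "\<mu> \<in> F \<or> \<mu> \<in> G" for \<mu> using nn[of \<mu>] lam that by force
    ultimately show ?thesis using True by simp
  next
    case False
    have "(\<Sum>\<mu>\<in>F. (\<mu> + lam) powr (2 * \<theta>) * (norm (eproj C \<mu> w))\<^sup>2)
       \<le> (\<Sum>\<sigma>\<in>G. (2 * (\<sigma> + lam)) powr (2 * \<theta>) * (norm (eproj Ch \<sigma> w))\<^sup>2)"
    proof (rule interpolate_weights)
      fix \<tau> :: real assume \<tau>: "\<tau> > 0"
      define s where "s \<sigma> = \<tau> * (2 * (\<sigma> + lam))\<^sup>2" for \<sigma>
      have s0: "s \<sigma> \<ge> 0" for \<sigma> using \<tau> by (simp add: s_def)
      then have s1: "1 + s \<sigma> \<noteq> 0" for \<sigma> by (smt (verit))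
      \<comment> \<open>The minimiser of \<open>(norm a)\<^sup>2 + \<tau> * (2 * norm (Ch b + lam
        *\<^sub>R b))\<^sup>2\<close> over splittings \<open>w = a + b\<close>, found separately in
        each eigencomponent.\<close>
      define b where "b = (\<Sum>\<sigma>\<in>G. (1 / (1 + s \<sigma>)) *\<^sub>R eproj Ch \<sigma> w)"
      define a where "a = (\<Sum>\<sigma>\<in>G. (s \<sigma> / (1 + s \<sigma>)) *\<^sub>R eproj Ch \<sigma> w)"
      have "a + b = (\<Sum>\<sigma>\<in>G. (s \<sigma> / (1 + s \<sigma>) + 1 / (1 + s \<sigma>)) *\<^sub>R eproj Ch \<sigma> w)"
        by (simp add: a_def b_def sum.distrib scaleR_add_left)
      also have "\<dots> = w" using s1 by (subst (2) w) (simp add: add_divide_distrib[symmetric] add.commute)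
      finally have ab: "w = a + b" ..
      have Tb: "Ch b + lam *\<^sub>R b = (\<Sum>\<sigma>\<in>G. ((\<sigma> + lam) / (1 + s \<sigma>)) *\<^sub>R eproj Ch \<sigma> w)"
        by (simp add: b_def blinfun.sum_right blinfun.scaleR_right eproj_eigen scaleR_sum_right
            sum.distrib[symmetric] scaleR_add_left[symmetric] add_divide_distrib)
      have "(\<Sum>\<mu>\<in>F. (\<tau> * (\<mu> + lam)\<^sup>2 / (1 + \<tau> * (\<mu> + lam)\<^sup>2)) * (norm (eproj C \<mu> w))\<^sup>2)
        \<le> (\<Sum>\<mu>\<in>F. (norm (eproj C \<mu> a))\<^sup>2 + \<tau> * (norm (eproj C \<mu> (C b + lam *\<^sub>R b)))\<^sup>2)"
      proof (rule sum_mono)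
        fix \<mu> assume "\<mu> \<in> F"
        define r where "r = \<tau> * (\<mu> + lam)\<^sup>2"
        have r0: "r \<ge> 0" using \<tau> by (simp add: r_def)
        let ?p = "eproj C \<mu> a" and ?q = "eproj C \<mu> b"
        \<comment> \<open>The defect of the next inequality is exactly this square.\<close>
        have "0 \<le> (norm (?p - r *\<^sub>R ?q))\<^sup>2" by simp
        then have "r * (norm (?p + ?q))\<^sup>2 \<le> (1 + r) * ((norm ?p)\<^sup>2 + r * (norm ?q)\<^sup>2)"
          unfolding power2_norm_eq_inner by (simp add: inner_simps inner_commute algebra_simps)
        then have "r / (1 + r) * (norm (?p + ?q))\<^sup>2 \<le> (norm ?p)\<^sup>2 + r * (norm ?q)\<^sup>2"
          using r0 by (simp add: field_simps)
        moreover have "eproj C \<mu> (C b + lam *\<^sub>R b) = (\<mu> + lam) *\<^sub>R ?q"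
          by (simp add: eproj_add eproj_scaleR eproj_apply[OF sym(1)] scaleR_add_left)
        ultimately show "(\<tau> * (\<mu> + lam)\<^sup>2 / (1 + \<tau> * (\<mu> + lam)\<^sup>2)) * (norm (eproj C \<mu> w))\<^sup>2
          \<le> (norm (eproj C \<mu> a))\<^sup>2 + \<tau> * (norm (eproj C \<mu> (C b + lam *\<^sub>R b)))\<^sup>2"
          by (simp add: ab eproj_add r_def power_mult_distrib)
      qed
      also have "\<dots> \<le> (norm a)\<^sup>2 + \<tau> * (norm (C b + lam *\<^sub>R b))\<^sup>2"
        unfolding sum.distrib sum_distrib_left[symmetric]
        by (intro add_mono mult_left_mono eproj_bessel[OF sym(1) fin(1)]) (use \<tau> in auto)
      also have "\<dots> \<le> (norm a)\<^sup>2 + \<tau> * (2 * norm (Ch b + lam *\<^sub>R b))\<^sup>2"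
        by (intro add_mono order.refl mult_left_mono power_mono le) (use \<tau> in auto)
      also have "\<dots> = (\<Sum>\<sigma>\<in>G. (s \<sigma> / (1 + s \<sigma>)) * (norm (eproj Ch \<sigma> w))\<^sup>2)"
      proof -
        \<comment> \<open>Optimality of the splitting makes its cost equal to the K-functional, so
          no constant is lost here.\<close>
        have "(s \<sigma> / (1 + s \<sigma>))\<^sup>2 + \<tau> * 4 * ((\<sigma> + lam) / (1 + s \<sigma>))\<^sup>2 = s \<sigma> / (1 + s \<sigma>)" for \<sigma>
        proof -
          have e: "\<tau> * 4 * (\<sigma> + lam)\<^sup>2 = s \<sigma>" by (simp only: s_def power_mult_distrib) simp
          have "(s \<sigma> / (1 + s \<sigma>))\<^sup>2 + \<tau> * 4 * ((\<sigma> + lam) / (1 + s \<sigma>))\<^sup>2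
              = ((s \<sigma>)\<^sup>2 + \<tau> * 4 * (\<sigma> + lam)\<^sup>2) / (1 + s \<sigma>)\<^sup>2"
            unfolding power_divide times_divide_eq_right by (rule add_divide_distrib[symmetric])
          then have "(s \<sigma> / (1 + s \<sigma>))\<^sup>2 + \<tau> * 4 * ((\<sigma> + lam) / (1 + s \<sigma>))\<^sup>2 = ((s \<sigma>)\<^sup>2 + s \<sigma>) / (1 + s \<sigma>)\<^sup>2"
            by (simp only: e)
          also have "(s \<sigma>)\<^sup>2 + s \<sigma> = s \<sigma> * (1 + s \<sigma>)" by (simp add: power2_eq_square algebra_simps)
          also have "s \<sigma> * (1 + s \<sigma>) / (1 + s \<sigma>)\<^sup>2 = s \<sigma> / (1 + s \<sigma>)" using s1[of \<sigma>] by (simp add: power2_eq_square)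
          finally show ?thesis .
        qed
        then have "(\<Sum>\<sigma>\<in>G. (s \<sigma> / (1 + s \<sigma>)) * (norm (eproj Ch \<sigma> w))\<^sup>2)
          = (\<Sum>\<sigma>\<in>G. ((s \<sigma> / (1 + s \<sigma>))\<^sup>2 + \<tau> * 4 * ((\<sigma> + lam) / (1 + s \<sigma>))\<^sup>2) * (norm (eproj Ch \<sigma> w))\<^sup>2)" by simp
        also have "\<dots> = (norm a)\<^sup>2 + \<tau> * (2 * norm (Ch b + lam *\<^sub>R b))\<^sup>2"
          unfolding power_mult_distrib Tb unfolding a_def orthG
          by (simp add: distrib_right sum.distrib sum_distrib_left mult.assoc)
        finally show ?thesis ..
      qed
      finally show "(\<Sum>\<mu>\<in>F. (\<tau> * (\<mu> + lam)\<^sup>2 / (1 + \<tau> * (\<mu> + lam)\<^sup>2)) * (norm (eproj C \<mu> w))\<^sup>2)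
        \<le> (\<Sum>\<sigma>\<in>G. (\<tau> * (2 * (\<sigma> + lam))\<^sup>2 / (1 + \<tau> * (2 * (\<sigma> + lam))\<^sup>2)) * (norm (eproj Ch \<sigma> w))\<^sup>2)"
        by (simp add: s_def)
    qed (use False \<theta> fin nn lam in \<open>auto simp: add_nonneg_pos\<close>)
    also have "\<dots> = 4 powr \<theta> * (\<Sum>\<sigma>\<in>G. (\<sigma> + lam) powr (2 * \<theta>) * (norm (eproj Ch \<sigma> w))\<^sup>2)"
      unfolding sum_distrib_left
    proof (rule sum.cong)
      fix \<sigma> assume "\<sigma> \<in> G"
      have "(4::real) powr \<theta> = 2 powr (2 * \<theta>)" by (simp add: powr_powr[symmetric])
      then show "(2 * (\<sigma> + lam)) powr (2 * \<theta>) * (norm (eproj Ch \<sigma> w))\<^sup>2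
        = 4 powr \<theta> * ((\<sigma> + lam) powr (2 * \<theta>) * (norm (eproj Ch \<sigma> w))\<^sup>2)"
        using powr_mult[of 2 "\<sigma> + lam" "2 * \<theta>"] nn(2)[OF \<open>\<sigma> \<in> G\<close>] lam by (simp only: mult.assoc)
    qed simp
    finally show ?thesis .
  qed
qed

section \<open>Resolvents\<close>

text \<open>Built from the same \<open>inv\<close> as \<open>effective_dim\<close>, so that the two
  refer to one operator.\<close>

definition resolvent :: "('a::{real_inner,banach} \<Rightarrow>\<^sub>L 'a) \<Rightarrow> real \<Rightarrow> ('a \<Rightarrow>\<^sub>L 'a)" where
  "resolvent C lam = Blinfun (inv (blinfun_apply (C + lam *\<^sub>R id_blinfun)))"

lemma eigenvalue_nonneg:
  assumes "\<And>v. blinfun_apply T v \<bullet> v \<ge> 0" "\<mu> \<in> eigenvalues T"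
  shows "\<mu> \<ge> 0"
proof -
  obtain v where v: "v \<noteq> 0" "T v = \<mu> *\<^sub>R v" using assms(2) by (auto simp: eigenvalues_def eigenspace_def)
  then have "0 \<le> \<mu> * (v \<bullet> v)" using assms(1)[of v] by simp
  then show ?thesis using v(1) by (simp add: zero_le_mult_iff) (metis inner_gt_zero_iff not_le)
qed

lemma eigenvalue_le:
  assumes "\<And>v. norm (blinfun_apply T v) \<le> K * norm v" "\<mu> \<in> eigenvalues T"
  shows "\<mu> \<le> K"
proof -
  obtain v where v: "v \<noteq> 0" "T v = \<mu> *\<^sub>R v" using assms(2) by (auto simp: eigenvalues_def eigenspace_def)
  then have "\<bar>\<mu>\<bar> * norm v \<le> K * norm v" using assms(1)[of v] by simp
  then show ?thesis using v(1) by simp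
qed

locale shifted_operator =
  fixes C :: "'a::{real_inner,banach} \<Rightarrow>\<^sub>L 'a" and lam :: real
  assumes sym: "symmetric C" and nonneg: "\<And>v. blinfun_apply C v \<bullet> v \<ge> 0" and lam: "lam > 0"
begin

definition T :: "'a \<Rightarrow> 'a" where "T v = C v + lam *\<^sub>R v"

lemma T_eq: "blinfun_apply (C + lam *\<^sub>R id_blinfun) = T"
  by (auto simp: T_def blinfun.add_left blinfun.scaleR_left)

lemma T_linear: "bounded_linear T" unfolding T_eq[symmetric] by (rule blinfun.bounded_linear_right)

lemma T_inner: "T v \<bullet> v = C v \<bullet> v + lam * (v \<bullet> v)"
  by (simp add: T_def inner_add_left)

lemma T_lower: "lam * (norm v)\<^sup>2 \<le> T v \<bullet> v"
  using nonneg[of v] by (simp add: T_inner power2_norm_eq_inner)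

lemma T_inner_nonneg: "T v \<bullet> v \<ge> 0"
  using T_lower[of v] lam by (smt (verit) mult_nonneg_nonneg zero_le_power2)

lemma norm_T_lower: "lam * norm v \<le> norm (T v)"
proof (cases "v = 0")
  case False
  have "lam * norm v * norm v \<le> T v \<bullet> v" using T_lower[of v] by (simp add: power2_eq_square mult.assoc)
  also have "\<dots> \<le> norm (T v) * norm v" by (rule norm_cauchy_schwarz)
  finally show ?thesis using False by simp
qed simp

lemma T_inner_le: "T v \<bullet> v \<le> (norm (T v))\<^sup>2 / lam"
proof -
  have "T v \<bullet> v \<le> norm (T v) * norm v" by (rule norm_cauchy_schwarz)
  also have "\<dots> \<le> norm (T v) * (norm (T v) / lam)"
    using norm_T_lower[of v] lam by (intro mult_left_mono) (auto simp: field_simps)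
  finally show ?thesis by (simp add: power2_eq_square)
qed

lemma T_sym: "T u \<bullet> v = u \<bullet> T v"
  by (simp add: T_def inner_add_left inner_add_right symmetricD[OF sym])

text \<open>Coercivity of the form of \<open>T\<close> gives injectivity and, with completeness, a
  closed range; a vector orthogonal to the range satisfies \<open>T v \<bullet> v = 0\<close> and
  hence vanishes.\<close>

lemma T_bij: "bij T"
proof -
  interpret bounded_linear T by (rule T_linear)
  have "inj T"
    unfolding inj_iff_eq_0 using norm_T_lower lam
    by (metis mult_le_0_iff norm_eq_zero norm_le_zero_iff norm_zero not_le)
  moreover have "range T = UNIV"
  proof (rule orthogonal_complement_trivial)
    show "subspace (range T)"
      by (rule linear_subspace_image[OF bounded_linear.linear[OF T_linear] subspace_UNIV])
    show "closed (range T)"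
      by (rule complete_imp_closed, rule complete_isometric_image[OF lam subspace_UNIV T_linear _ complete_UNIV])
        (simp add: norm_T_lower)
    show "v = 0" if "\<And>w. w \<in> range T \<Longrightarrow> v \<bullet> w = 0" for v
    proof -
      have "T v \<bullet> v = 0" using that[of "T v"] by (simp add: inner_commute)
      then show ?thesis using T_lower[of v] lam by (smt (verit) mult_pos_pos zero_less_norm_iff zero_less_power)
    qed
  qed
  ultimately show ?thesis by (simp add: bij_def)
qed

abbreviation R :: "'a \<Rightarrow>\<^sub>L 'a" where "R \<equiv> resolvent C lam"

lemma R_eq: "blinfun_apply R = inv T"
proof -
  interpret bounded_linear T by (rule T_linear)
  have s: "T (inv T x) = x" for x by (rule surj_f_inv_f) (rule bij_is_surj[OF T_bij])
  have i: "T x = T y \<Longrightarrow> x = y" for x y using T_bij by (simp add: bij_def inj_eq)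
  have "bounded_linear (inv T)"
  proof (rule bounded_linear_intro)
    show "inv T (x + y) = inv T x + inv T y" for x y by (rule i) (simp add: s add)
    show "inv T (r *\<^sub>R x) = r *\<^sub>R inv T x" for r x by (rule i) (simp add: s scaleR)
    show "norm (inv T x) \<le> norm x * (1 / lam)" for x
      using norm_T_lower[of "inv T x"] lam by (simp add: s field_simps)
  qed
  then show ?thesis by (simp add: resolvent_def T_eq bounded_linear_Blinfun_apply)
qed

lemma T_R: "T (R v) = v"
  unfolding R_eq by (rule surj_f_inv_f) (rule bij_is_surj[OF T_bij])

lemma R_T: "R (T v) = v"
  unfolding R_eq by (rule inv_f_f) (rule bij_is_inj[OF T_bij])

lemma R_norm: "norm (R v) \<le> norm v / lam"
  using norm_T_lower[of "R v"] lam by (simp add: T_R field_simps)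

lemma R_sym: "R u \<bullet> v = u \<bullet> R v"
  by (metis T_R T_sym)

lemma R_inner_nonneg: "R v \<bullet> v \<ge> 0"
  using T_inner_nonneg[of "R v"] by (simp add: T_R inner_commute)

lemma R_inner_le: "R v \<bullet> v \<le> (norm v)\<^sup>2 / lam"
  using T_inner_le[of "R v"] by (simp add: T_R inner_commute)

text \<open>With \<open>u = R y\<close> this reads \<open>(y \<bullet> v)\<^sup>2 \<le> (R y
  \<bullet> y) * (T v \<bullet> v)\<close>, the duality between \<open>T\<close> and its inverse
  that stands in for splitting off a square root.\<close>

lemma T_cauchy_schwarz: "(T u \<bullet> v)\<^sup>2 \<le> (T u \<bullet> u) * (T v \<bullet> v)"
proof -
  interpret bounded_linear T by (rule T_linear)
  show ?thesis
  proof (cases "v = 0")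
    case False
    then have pos: "T v \<bullet> v > 0"
      using T_lower[of v] lam by (smt (verit) mult_pos_pos zero_less_norm_iff zero_less_power)
    define c where "c = (T u \<bullet> v) / (T v \<bullet> v)"
    have "0 \<le> T (u - c *\<^sub>R v) \<bullet> (u - c *\<^sub>R v)" by (rule T_inner_nonneg)
    also have "\<dots> = T u \<bullet> u - 2 * c * (T u \<bullet> v) + c * c * (T v \<bullet> v)"
      using T_sym[of v u] by (simp add: diff scaleR inner_simps inner_commute algebra_simps)
    also have "\<dots> = T u \<bullet> u - (T u \<bullet> v)\<^sup>2 / (T v \<bullet> v)"
      using pos by (simp add: c_def power2_eq_square)
    finally show ?thesis using pos by (simp add: field_simps)
  qed (simp add: zero)
qed

lemma eproj_R:
  assumes "\<mu> \<ge> 0"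
  shows "eproj C \<mu> (R v) = (1 / (\<mu> + lam)) *\<^sub>R eproj C \<mu> v"
proof -
  have "eproj C \<mu> v = eproj C \<mu> (T (R v))" by (simp add: T_R)
  also have "\<dots> = (\<mu> + lam) *\<^sub>R eproj C \<mu> (R v)"
    by (simp add: T_def eproj_add eproj_scaleR eproj_apply[OF sym] scaleR_add_left)
  finally show ?thesis using assms lam by simp
qed

lemma eproj_R_pow:
  assumes "\<mu> \<ge> 0"
  shows "eproj C \<mu> ((blinfun_apply R ^^ m) v) = (1 / (\<mu> + lam) ^ m) *\<^sub>R eproj C \<mu> v"
  by (induction m) (simp_all add: eproj_R[OF assms])

lemma eproj_T_pow: "eproj C \<mu> ((T ^^ m) v) = (\<mu> + lam) ^ m *\<^sub>R eproj C \<mu> v"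
  by (induction m)
    (simp_all add: T_def eproj_add eproj_scaleR eproj_apply[OF sym] scaleR_add_left[symmetric] distrib_right)

lemma R_pow_sym: "(blinfun_apply R ^^ m) u \<bullet> v = u \<bullet> (blinfun_apply R ^^ m) v"
  by (induction m arbitrary: u v) (simp_all add: R_sym funpow_swap1)

lemma R_pow_norm: "norm ((blinfun_apply R ^^ m) v) \<le> norm v / lam ^ m"
proof (induction m)
  case (Suc m)
  have "norm ((blinfun_apply R ^^ Suc m) v) \<le> norm ((blinfun_apply R ^^ m) v) / lam" using R_norm by simp
  also have "\<dots> \<le> (norm v / lam ^ m) / lam" using Suc lam by (intro divide_right_mono) auto
  finally show ?case by (simp add: mult.commute)
qed simp

text \<open>The left side is the squared norm of \<open>T powr (- j - 1/2)\<close> applied to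
  \<open>v\<close>: cancelling one resolvent against \<open>T\<close> leaves the form of
  \<open>R\<close> at the \<open>j\<close>-th iterate.\<close>

lemma T_R_pow_inner: "T ((blinfun_apply R ^^ Suc j) v) \<bullet> (blinfun_apply R ^^ Suc j) v \<le> (norm v / (lam ^ j * sqrt lam))\<^sup>2"
proof -
  have "T ((blinfun_apply R ^^ Suc j) v) \<bullet> (blinfun_apply R ^^ Suc j) v = R ((blinfun_apply R ^^ j) v) \<bullet> (blinfun_apply R ^^ j) v" by (simp add: T_R inner_commute)
  also have "\<dots> \<le> (norm ((blinfun_apply R ^^ j) v))\<^sup>2 / lam" by (rule R_inner_le)
  also have "\<dots> \<le> (norm v / lam ^ j)\<^sup>2 / lam" using R_pow_norm lam by (intro divide_right_mono power_mono) auto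
  finally show ?thesis using lam by (simp add: power_divide power_mult_distrib)
qed

end

section \<open>Deterministic error bounds under a small perturbation\<close>

text \<open>\<open>perturbation\<close> expresses that \<open>T powr (- 1/2)\<close> times
  \<open>C - Ch\<close> has norm at most \<open>eps\<close>: the test vector \<open>v\<close> is
  measured in the energy norm of \<open>T\<close>, which avoids the inverse square root.\<close>

locale perturbed_operator = orig: shifted_operator C lam + pert: shifted_operator Ch lam
  for C Ch :: "'a::{real_inner,banach} \<Rightarrow>\<^sub>L 'a" and lam :: real +
  fixes eps :: real
  assumes finite_rank: "\<exists>B. finite B \<and> range (blinfun_apply Ch) \<subseteq> span B"
    and eps: "0 \<le> eps" "eps \<le> sqrt lam / 2"
    and perturbation: "\<And>u v. (C u - Ch u) \<bullet> v \<le> eps * norm u * sqrt (C v \<bullet> v + lam * (v \<bullet> v))"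
begin

lemmas symC = orig.sym and symCh = pert.sym and lam = orig.lam

lemma diff_T: "C v - Ch v = orig.T v - pert.T v"
  by (simp add: orig.T_def pert.T_def)

lemma perturbation_T: "(C u - Ch u) \<bullet> v \<le> eps * norm u * sqrt (orig.T v \<bullet> v)"
  using perturbation[of u v] by (simp add: orig.T_inner)

text \<open>Symmetry of the difference lets \<open>d = C v - Ch v\<close> serve as the argument and
  \<open>v\<close> as the test vector. The energy norm then falls on \<open>v\<close>, where it is
  at most \<open>norm (T v) / sqrt lam\<close>.\<close>

lemma norm_diff_le: "norm (C v - Ch v) \<le> norm (orig.T v) / 2"
proof (cases "C v - Ch v = 0")
  case False
  define d where "d = C v - Ch v"
  let ?d = d
  have "norm d * norm d = d \<bullet> C v - d \<bullet> Ch v"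
    by (simp add: d_def inner_diff_right[symmetric] flip: power2_norm_eq_inner power2_eq_square)
  also have "\<dots> = (C d - Ch d) \<bullet> v"
    by (simp add: inner_diff_left symmetricD[OF symC, of d] symmetricD[OF symCh, of d])
  also have "\<dots> \<le> eps * norm ?d * sqrt (orig.T v \<bullet> v)" by (rule perturbation_T)
  finally have "norm ?d \<le> eps * sqrt (orig.T v \<bullet> v)" using False by (simp add: d_def[symmetric] mult.commute mult.left_commute)
  also have "\<dots> \<le> (sqrt lam / 2) * sqrt ((norm (orig.T v))\<^sup>2 / lam)"
    using eps orig.T_inner_le orig.T_inner_nonneg lam by (intro mult_mono) auto
  also have "\<dots> = norm (orig.T v) / 2" using lam by (simp add: real_sqrt_divide)
  finally show ?thesis by (simp add: d_def)
qed simp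

lemma norm_T_le: "norm (C v + lam *\<^sub>R v) \<le> 2 * norm (Ch v + lam *\<^sub>R v)"
proof -
  have "norm (orig.T v) \<le> norm (pert.T v) + norm (C v - Ch v)"
    using norm_triangle_ineq[of "pert.T v" "C v - Ch v"] by (simp add: diff_T)
  then show ?thesis using norm_diff_le[of v] by (simp add: orig.T_def pert.T_def)
qed

text \<open>Since \<open>sqrt lam * norm v\<close> is at most the energy norm of \<open>v\<close>,
  the perturbation consumes at most half of \<open>T v \<bullet> v\<close>.\<close>

lemma T_inner_pert: "orig.T v \<bullet> v \<le> 2 * (pert.T v \<bullet> v)"
proof -
  have "orig.T v \<bullet> v - pert.T v \<bullet> v = (C v - Ch v) \<bullet> v" by (simp add: diff_T inner_diff_left)
  also have "\<dots> \<le> eps * norm v * sqrt (orig.T v \<bullet> v)" by (rule perturbation_T)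
  also have "\<dots> \<le> (sqrt lam / 2) * norm v * sqrt (orig.T v \<bullet> v)"
    using eps orig.T_inner_nonneg by (intro mult_right_mono) auto
  also have "\<dots> = sqrt (lam * (norm v)\<^sup>2) * sqrt (orig.T v \<bullet> v) / 2" using lam by (simp add: real_sqrt_mult)
  also have "\<dots> \<le> sqrt (orig.T v \<bullet> v) * sqrt (orig.T v \<bullet> v) / 2"
    using orig.T_lower by (intro divide_right_mono mult_right_mono) (auto simp: orig.T_inner_nonneg)
  also have "\<dots> = (orig.T v \<bullet> v) / 2" using orig.T_inner_nonneg by simp
  finally show ?thesis by simp
qed

lemma expansion:
  obtains F where "finite F" "F \<subseteq> eigenvalues Ch" "v = (\<Sum>\<sigma>\<in>F. eproj Ch \<sigma> v)"
  using finite_rank finite_rank_eigen_expansion[OF symCh] by metis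

lemma inner_expansion:
  assumes "finite F" "v = (\<Sum>\<sigma>\<in>F. eproj Ch \<sigma> v)"
  shows "v \<bullet> u = (\<Sum>\<sigma>\<in>F. eproj Ch \<sigma> v \<bullet> eproj Ch \<sigma> u)"
  by (subst assms(2), unfold inner_sum_left) (rule sum.cong[OF refl eproj_inner_eq])

lemma norm_expansion:
  assumes "finite F" "v = (\<Sum>\<sigma>\<in>F. eproj Ch \<sigma> v)"
  shows "(norm v)\<^sup>2 = (\<Sum>\<sigma>\<in>F. (norm (eproj Ch \<sigma> v))\<^sup>2)"
  by (simp add: power2_norm_eq_inner inner_expansion[OF assms, of v])

lemma fun_calc_expansion:
  assumes "bounded (f ` eigenvalues Ch)" "finite F" "F \<subseteq> eigenvalues Ch" "v = (\<Sum>\<sigma>\<in>F. eproj Ch \<sigma> v)"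
  shows "fun_calc f Ch v = (\<Sum>\<sigma>\<in>F. f \<sigma> *\<^sub>R eproj Ch \<sigma> v)"
proof -
  have z: "eproj Ch \<sigma> v = 0" if "\<sigma> \<notin> F" for \<sigma>
    using that by (subst assms(4)) (auto simp: eproj_sum eproj_eproj[OF symCh] intro!: sum.neutral)
  have "((\<lambda>\<sigma>. f \<sigma> *\<^sub>R eproj Ch \<sigma> v) has_sum (\<Sum>\<sigma>\<in>F. f \<sigma> *\<^sub>R eproj Ch \<sigma> v)) F"
    using assms(2) by (simp add: has_sum_finite)
  then have "((\<lambda>\<sigma>. f \<sigma> *\<^sub>R eproj Ch \<sigma> v) has_sum (\<Sum>\<sigma>\<in>F. f \<sigma> *\<^sub>R eproj Ch \<sigma> v)) (eigenvalues Ch)"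
    by (rule has_sum_cong_neutral[THEN iffD1, rotated -1]) (use assms(3) z in auto)
  then show ?thesis by (rule has_sum_unique[OF fun_calc_has_sum[OF symCh assms(1)]])
qed

text \<open>Completeness of the eigenvectors of \<open>Ch\<close> expands \<open>w\<close>; for
  \<open>u\<close> Bessel is enough.\<close>

lemma norm_le_by_components:
  assumes "\<And>\<sigma>. \<sigma> \<in> eigenvalues Ch \<Longrightarrow> norm (eproj Ch \<sigma> w) \<le> K * norm (eproj Ch \<sigma> u)" "K \<ge> 0"
  shows "norm w \<le> K * norm u"
proof -
  obtain F where F: "finite F" "F \<subseteq> eigenvalues Ch" "w = (\<Sum>\<sigma>\<in>F. eproj Ch \<sigma> w)" by (rule expansion)
  have "(norm w)\<^sup>2 = (\<Sum>\<sigma>\<in>F. (norm (eproj Ch \<sigma> w))\<^sup>2)" by (rule norm_expansion[OF F(1,3)])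
  also have "\<dots> \<le> (\<Sum>\<sigma>\<in>F. (K * norm (eproj Ch \<sigma> u))\<^sup>2)"
    using F(2) assms by (intro sum_mono power_mono) auto
  also have "\<dots> \<le> K\<^sup>2 * (norm u)\<^sup>2"
    by (simp add: power_mult_distrib sum_distrib_left[symmetric] mult_left_mono eproj_bessel[OF symCh F(1)])
  finally have "(norm w)\<^sup>2 \<le> (K * norm u)\<^sup>2" by (simp add: power_mult_distrib)
  then show ?thesis by (rule power2_le_imp_le) (use assms in simp)
qed

text \<open>Induction on \<open>m\<close>, inserting \<open>R (T y) = y\<close> and splitting
  \<open>T\<close> into \<open>Th\<close> plus the difference. The index starts at 0, hence
  \<open>R\<close> occurs with one power more than \<open>Th\<close> in each summand.\<close>

lemma telescope:
  "x = (blinfun_apply orig.R ^^ m) ((pert.T ^^ m) x) + (\<Sum>j<m. (blinfun_apply orig.R ^^ Suc j) (C ((pert.T ^^ j) x) - Ch ((pert.T ^^ j) x)))"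
proof (induction m)
  case (Suc m)
  let ?y = "(pert.T ^^ m) x"
  have lin: "(blinfun_apply orig.R ^^ k) (u + v) = (blinfun_apply orig.R ^^ k) u + (blinfun_apply orig.R ^^ k) v" for k u v
    by (induction k) (auto simp: blinfun.add_right)
  have "(blinfun_apply orig.R ^^ m) ?y = (blinfun_apply orig.R ^^ Suc m) (orig.T ?y)" by (simp add: funpow_swap1 orig.R_T)
  also have "orig.T ?y = pert.T ?y + (C ?y - Ch ?y)" by (simp add: diff_T)
  finally have "(blinfun_apply orig.R ^^ m) ?y = (blinfun_apply orig.R ^^ Suc m) ((pert.T ^^ Suc m) x) + (blinfun_apply orig.R ^^ Suc m) (C ?y - Ch ?y)"
    unfolding lin by simp
  with Suc show ?case by (simp add: algebra_simps)
qed simp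

text \<open>Let \<open>\<rho> \<sigma> = sqrt (\<sigma> + lam) * r \<sigma>\<close> and
  \<open>u = \<rho>(Ch) b\<close>. The energy of \<open>w = r(Ch) b\<close> under
  \<open>Ch + lam\<close> is \<open>(norm u)\<^sup>2 = b \<bullet> x\<close> with
  \<open>x = \<rho>(Ch) u\<close>. Every term of the telescoped \<open>b \<bullet> x\<close> carries
  one factor \<open>norm u\<close>, which is divided out at the end.\<close>

lemma residual_bound:
  fixes \<phi> r :: "real \<Rightarrow> real" and \<nu> \<theta> \<Gamma> M0 :: real and m :: nat
  assumes \<phi>: "bounded (\<phi> ` eigenvalues C)"
      "\<And>\<mu>. \<mu> \<in> eigenvalues C \<Longrightarrow> \<bar>\<phi> \<mu>\<bar> \<le> M0 * (\<mu> + lam) powr (real m + \<theta>)" "M0 \<ge> 0"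
    and \<theta>: "0 \<le> \<theta>" "\<theta> < 1" and \<nu>: "\<nu> = real m + \<theta> + 1 / 2"
    and r: "\<And>\<sigma> t. \<sigma> \<in> eigenvalues Ch \<Longrightarrow> 0 \<le> t \<Longrightarrow> t \<le> \<nu> \<Longrightarrow> \<bar>r \<sigma>\<bar> * (\<sigma> + lam) powr t \<le> 2 powr t * \<Gamma> * lam powr t"
      "bounded (r ` eigenvalues Ch)" "\<Gamma> \<ge> 0"
  shows "sqrt (C (fun_calc r Ch (fun_calc \<phi> C a)) \<bullet> fun_calc r Ch (fun_calc \<phi> C a))
     \<le> 2 powr (2 * \<nu> - real m) * M0 * \<Gamma> * lam powr \<nu> * norm a + real m * 2 ^ m * \<Gamma> * eps * norm (fun_calc \<phi> C a)"
proof -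
  have evC: "\<mu> \<ge> 0" if "\<mu> \<in> eigenvalues C" for \<mu> using eigenvalue_nonneg[OF orig.nonneg that] .
  have evCh: "\<sigma> \<ge> 0" if "\<sigma> \<in> eigenvalues Ch" for \<sigma> using eigenvalue_nonneg[OF pert.nonneg that] .
  have pos: "\<sigma> + lam > 0" if "\<sigma> \<in> eigenvalues Ch" for \<sigma> using evCh[OF that] lam by simp
  \<comment> \<open>Shifting half a power into \<open>\<rho>\<close> leaves the exponent
    \<open>\<nu> - 1/2 = m + \<theta>\<close>, the one that the growth bound on
    \<open>\<phi>\<close> provides.\<close>
  define \<rho> where "\<rho> \<sigma> = sqrt (\<sigma> + lam) * r \<sigma>" for \<sigma>
  have absrho: "\<bar>\<rho> \<sigma>\<bar> * (\<sigma> + lam) powr t = \<bar>r \<sigma>\<bar> * (\<sigma> + lam) powr (t + 1/2)" if "\<sigma> \<in> eigenvalues Ch" for \<sigma> t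
    using pos[OF that] by (simp add: \<rho>_def abs_mult powr_add powr_half_sqrt)
  have \<rho>: "\<bar>\<rho> \<sigma>\<bar> * (\<sigma> + lam) powr t \<le> 2 powr (t + 1/2) * \<Gamma> * lam powr (t + 1/2)"
    if "\<sigma> \<in> eigenvalues Ch" "0 \<le> t" "t + 1/2 \<le> \<nu>" for \<sigma> t
    unfolding absrho[OF that(1)] using r(1)[OF that(1), of "t + 1/2"] that by simp
  have "\<bar>\<rho> \<sigma>\<bar> \<le> 2 powr (1/2) * \<Gamma> * lam powr (1/2)" if "\<sigma> \<in> eigenvalues Ch" for \<sigma>
    using \<rho>[OF that, of 0] pos[OF that] \<theta> \<nu> by simp
  then have bdd\<rho>: "bounded (\<rho> ` eigenvalues Ch)" by (auto simp: bounded_iff)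
  define b where "b = fun_calc \<phi> C a"
  define w where "w = fun_calc r Ch b"
  define u where "u = fun_calc \<rho> Ch b"
  define x where "x = fun_calc \<rho> Ch u"
  have px: "eproj Ch \<sigma> ((pert.T ^^ j) x) = ((\<sigma> + lam) ^ j * \<rho> \<sigma>) *\<^sub>R eproj Ch \<sigma> u" for \<sigma> j
    unfolding x_def by (simp add: pert.eproj_T_pow eproj_fun_calc[OF symCh bdd\<rho>])
  define K where "K = M0 * 2 powr (\<theta> + \<nu>) * \<Gamma> * lam powr \<nu>"
  have K0: "K \<ge> 0" unfolding K_def using \<phi>(3) r(3) by (intro mult_nonneg_nonneg) auto
  \<comment> \<open>Moving \<open>R^m\<close> and \<open>\<phi>(C)\<close> to the other side leaves
    the symbol \<open>\<phi> \<mu> / (\<mu> + lam) ^ m\<close>, bounded by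
    \<open>M0 * (\<mu> + lam) powr \<theta>\<close>. The Heinz inequality passes this fractional
    power to \<open>Ch\<close>, where it recombines with the \<open>m\<close> powers in
    \<open>y\<close>.\<close>
  have first: "b \<bullet> (blinfun_apply orig.R ^^ m) ((pert.T ^^ m) x) \<le> norm a * (K * norm u)"
  proof -
    define y where "y = (pert.T ^^ m) x"
    obtain G where G: "finite G" "G \<subseteq> eigenvalues Ch" "y = (\<Sum>\<sigma>\<in>G. eproj Ch \<sigma> y)" by (rule expansion)
    have "(norm (fun_calc \<phi> C ((blinfun_apply orig.R ^^ m) y)))\<^sup>2 \<le> (K * norm u)\<^sup>2"
    proof (rule has_sum_le_finite_sums[OF fun_calc_norm_has_sum[OF symC \<phi>(1)]])
      fix F assume F: "finite F" "F \<subseteq> eigenvalues C"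
      have "(\<Sum>\<mu>\<in>F. (\<phi> \<mu>)\<^sup>2 * (norm (eproj C \<mu> ((blinfun_apply orig.R ^^ m) y)))\<^sup>2)
        \<le> (\<Sum>\<mu>\<in>F. M0\<^sup>2 * ((\<mu> + lam) powr (2 * \<theta>) * (norm (eproj C \<mu> y))\<^sup>2))"
      proof (rule sum_mono)
        fix \<mu> assume "\<mu> \<in> F"
        then have \<mu>: "\<mu> \<in> eigenvalues C" "\<mu> \<ge> 0" "\<mu> + lam > 0" using F evC[of \<mu>] lam by auto
        have "(\<phi> \<mu>)\<^sup>2 \<le> (M0 * (\<mu> + lam) powr (real m + \<theta>))\<^sup>2"
          using power_mono[OF \<phi>(2)[OF \<mu>(1)], of 2] by simp
        also have "\<dots> = M0\<^sup>2 * (\<mu> + lam) powr (2 * \<theta>) * ((\<mu> + lam) ^ m)\<^sup>2"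
        proof -
          have "(\<mu> + lam) powr (real m + \<theta>) = (\<mu> + lam) ^ m * (\<mu> + lam) powr \<theta>"
            using \<mu> by (simp add: powr_add powr_realpow)
          moreover have "((\<mu> + lam) powr \<theta>)\<^sup>2 = (\<mu> + lam) powr (2 * \<theta>)"
            using \<mu> by (simp add: powr_add[symmetric] power2_eq_square)
          ultimately show ?thesis by (simp add: power_mult_distrib)
        qed
        finally have "(\<phi> \<mu>)\<^sup>2 / ((\<mu> + lam) ^ m)\<^sup>2 \<le> M0\<^sup>2 * (\<mu> + lam) powr (2 * \<theta>)"
          using \<mu> by (simp add: divide_le_eq)
        then have "(\<phi> \<mu>)\<^sup>2 / ((\<mu> + lam) ^ m)\<^sup>2 * (norm (eproj C \<mu> y))\<^sup>2
           \<le> M0\<^sup>2 * (\<mu> + lam) powr (2 * \<theta>) * (norm (eproj C \<mu> y))\<^sup>2" by (rule mult_right_mono) simp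
        then show "(\<phi> \<mu>)\<^sup>2 * (norm (eproj C \<mu> ((blinfun_apply orig.R ^^ m) y)))\<^sup>2
          \<le> M0\<^sup>2 * ((\<mu> + lam) powr (2 * \<theta>) * (norm (eproj C \<mu> y))\<^sup>2)"
          by (simp add: orig.eproj_R_pow[OF \<mu>(2)] power_divide power_mult_distrib mult.assoc)
      qed
      also have "\<dots> \<le> M0\<^sup>2 * (4 powr \<theta> * (\<Sum>\<sigma>\<in>G. (\<sigma> + lam) powr (2 * \<theta>) * (norm (eproj Ch \<sigma> y))\<^sup>2))"
        unfolding sum_distrib_left[symmetric]
        by (intro mult_left_mono heinz_inequality[OF symC symCh lam norm_T_le])
          (use F G \<theta> evC evCh in auto)
      also have "\<dots> \<le> M0\<^sup>2 * (4 powr \<theta> * (\<Sum>\<sigma>\<in>G. (2 powr \<nu> * \<Gamma> * lam powr \<nu>)\<^sup>2 * (norm (eproj Ch \<sigma> u))\<^sup>2))"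
      proof (intro mult_left_mono sum_mono)
        fix \<sigma> assume "\<sigma> \<in> G"
        then have \<sigma>: "\<sigma> \<in> eigenvalues Ch" using G by auto
        have "(\<sigma> + lam) powr \<theta> * ((\<sigma> + lam) ^ m * \<bar>\<rho> \<sigma>\<bar>) = \<bar>\<rho> \<sigma>\<bar> * (\<sigma> + lam) powr (\<nu> - 1/2)"
          using pos[OF \<sigma>] by (simp add: \<nu> powr_add powr_realpow)
        also have "\<dots> \<le> 2 powr \<nu> * \<Gamma> * lam powr \<nu>" using \<rho>[OF \<sigma>, of "\<nu> - 1/2"] \<theta> by (simp add: \<nu>)
        finally have *: "((\<sigma> + lam) powr \<theta> * ((\<sigma> + lam) ^ m * \<bar>\<rho> \<sigma>\<bar>))\<^sup>2 \<le> (2 powr \<nu> * \<Gamma> * lam powr \<nu>)\<^sup>2"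
          using pos[OF \<sigma>] by (intro power_mono) auto
        have "(\<sigma> + lam) powr (2 * \<theta>) = ((\<sigma> + lam) powr \<theta>)\<^sup>2"
          by (simp add: powr_add[symmetric] power2_eq_square)
        then have "(\<sigma> + lam) powr (2 * \<theta>) * (norm (eproj Ch \<sigma> y))\<^sup>2
           = ((\<sigma> + lam) powr \<theta> * ((\<sigma> + lam) ^ m * \<bar>\<rho> \<sigma>\<bar>))\<^sup>2 * (norm (eproj Ch \<sigma> u))\<^sup>2"
          by (simp add: y_def px power_mult_distrib mult.assoc)
        also have "\<dots> \<le> (2 powr \<nu> * \<Gamma> * lam powr \<nu>)\<^sup>2 * (norm (eproj Ch \<sigma> u))\<^sup>2"
          by (rule mult_right_mono[OF *]) simp
        finally show "(\<sigma> + lam) powr (2 * \<theta>) * (norm (eproj Ch \<sigma> y))\<^sup>2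
          \<le> (2 powr \<nu> * \<Gamma> * lam powr \<nu>)\<^sup>2 * (norm (eproj Ch \<sigma> u))\<^sup>2" .
      qed auto
      also have "\<dots> \<le> M0\<^sup>2 * (4 powr \<theta> * ((2 powr \<nu> * \<Gamma> * lam powr \<nu>)\<^sup>2 * (norm u)\<^sup>2))"
        unfolding sum_distrib_left[symmetric]
        by (intro mult_left_mono eproj_bessel[OF symCh G(1)]) auto
      also have "\<dots> = (K * norm u)\<^sup>2"
      proof -
        have "(4::real) powr \<theta> = (2 powr \<theta>)\<^sup>2" by (simp add: power2_eq_square flip: powr_mult)
        then show ?thesis by (simp add: K_def power_mult_distrib powr_add)
      qed
      finally show "(\<Sum>\<mu>\<in>F. (\<phi> \<mu>)\<^sup>2 * (norm (eproj C \<mu> ((blinfun_apply orig.R ^^ m) y)))\<^sup>2) \<le> (K * norm u)\<^sup>2" .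
    qed
    then have n: "norm (fun_calc \<phi> C ((blinfun_apply orig.R ^^ m) y)) \<le> K * norm u"
      by (rule power2_le_imp_le) (use K0 in simp)
    have "b \<bullet> (blinfun_apply orig.R ^^ m) y = a \<bullet> fun_calc \<phi> C ((blinfun_apply orig.R ^^ m) y)"
      unfolding b_def by (rule fun_calc_symmetric[OF symC \<phi>(1)])
    also have "\<dots> \<le> norm a * norm (fun_calc \<phi> C ((blinfun_apply orig.R ^^ m) y))" by (rule norm_cauchy_schwarz)
    also have "\<dots> \<le> norm a * (K * norm u)" by (rule mult_left_mono[OF n]) simp
    finally show ?thesis by (simp add: y_def)
  qed
  \<comment> \<open>The resolvents acting on \<open>b\<close> cost
    \<open>lam powr (- j - 1/2)\<close>; the decay of
    \<open>(\<sigma> + lam) ^ j * \<rho> \<sigma>\<close> in \<open>y\<close> returns exactly this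
    power, so only \<open>eps\<close> remains as a small factor.\<close>
  have rest: "b \<bullet> (blinfun_apply orig.R ^^ Suc j) (C ((pert.T ^^ j) x) - Ch ((pert.T ^^ j) x))
      \<le> eps * 2 powr (real j + 1/2) * \<Gamma> * norm b * norm u" if j: "j < m" for j
  proof -
    define y where "y = (pert.T ^^ j) x"
    define v where "v = (blinfun_apply orig.R ^^ Suc j) b"
    have lp: "lam powr (real j + 1/2) = lam ^ j * sqrt lam"
      using lam by (simp add: powr_add powr_realpow powr_half_sqrt)
    have ny: "norm y \<le> (2 powr (real j + 1/2) * \<Gamma> * lam powr (real j + 1/2)) * norm u"
    proof (rule norm_le_by_components)
      fix \<sigma> assume \<sigma>: "\<sigma> \<in> eigenvalues Ch"
      have "\<bar>\<rho> \<sigma>\<bar> * (\<sigma> + lam) powr real j \<le> 2 powr (real j + 1/2) * \<Gamma> * lam powr (real j + 1/2)"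
        by (rule \<rho>[OF \<sigma>]) (use j \<nu> \<theta> in auto)
      then have "(\<sigma> + lam) ^ j * \<bar>\<rho> \<sigma>\<bar> \<le> 2 powr (real j + 1/2) * \<Gamma> * lam powr (real j + 1/2)"
        using pos[OF \<sigma>] by (simp add: powr_realpow mult.commute)
      from mult_right_mono[OF this, of "norm (eproj Ch \<sigma> u)"] pos[OF \<sigma>]
      show "norm (eproj Ch \<sigma> y) \<le> 2 powr (real j + 1/2) * \<Gamma> * lam powr (real j + 1/2) * norm (eproj Ch \<sigma> u)"
        by (simp add: y_def px abs_mult)
    qed (use r(3) in auto)
    have "b \<bullet> (blinfun_apply orig.R ^^ Suc j) (C y - Ch y) = (C y - Ch y) \<bullet> v"
      unfolding v_def by (metis orig.R_pow_sym inner_commute)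
    also have "\<dots> \<le> eps * norm y * sqrt (orig.T v \<bullet> v)" by (rule perturbation_T)
    also have "\<dots> \<le> eps * norm y * (norm b / (lam ^ j * sqrt lam))"
    proof (intro mult_left_mono real_le_lsqrt)
      show "orig.T v \<bullet> v \<le> (norm b / (lam ^ j * sqrt lam))\<^sup>2" unfolding v_def by (rule orig.T_R_pow_inner)
    qed (use eps lam in auto)
    also have "\<dots> \<le> eps * ((2 powr (real j + 1/2) * \<Gamma> * lam powr (real j + 1/2)) * norm u) * (norm b / (lam ^ j * sqrt lam))"
      using eps lam by (intro mult_right_mono mult_left_mono ny) auto
    also have "\<dots> = eps * 2 powr (real j + 1/2) * \<Gamma> * norm b * norm u"
      using lam unfolding lp by simp
    finally show ?thesis by (simp add: y_def)
  qed
  have "(norm u)\<^sup>2 = b \<bullet> x"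
    unfolding x_def using fun_calc_symmetric[OF symCh bdd\<rho>, of b u] by (simp add: u_def power2_norm_eq_inner)
  also have "\<dots> = b \<bullet> (blinfun_apply orig.R ^^ m) ((pert.T ^^ m) x)
      + (\<Sum>j<m. b \<bullet> (blinfun_apply orig.R ^^ Suc j) (C ((pert.T ^^ j) x) - Ch ((pert.T ^^ j) x)))"
    by (subst telescope[of x m]) (simp add: inner_add_right inner_sum_right)
  also have "\<dots> \<le> norm a * (K * norm u) + (\<Sum>j<m. eps * 2 powr (real j + 1/2) * \<Gamma> * norm b * norm u)"
    by (intro add_mono sum_mono first rest) auto
  \<comment> \<open>The largest index is \<open>j = m - 1\<close>, whence the exponent
    \<open>m - 1/2\<close>.\<close>
  also have "\<dots> \<le> norm a * (K * norm u) + (\<Sum>j<m. eps * 2 powr (real m - 1/2) * \<Gamma> * norm b * norm u)"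
    using eps r(3) by (intro add_mono sum_mono mult_right_mono mult_left_mono) auto
  also have "\<dots> = (norm a * K + real m * eps * 2 powr (real m - 1/2) * \<Gamma> * norm b) * norm u"
    by (simp add: algebra_simps)
  finally have nu: "norm u \<le> norm a * K + real m * eps * 2 powr (real m - 1/2) * \<Gamma> * norm b"
  proof (cases "u = 0")
    case True
    then show ?thesis using K0 eps r(3) by simp
  qed (simp add: power2_eq_square)
  have "pert.T w \<bullet> w = (norm u)\<^sup>2"
  proof -
    obtain F where F: "finite F" "F \<subseteq> eigenvalues Ch" "b = (\<Sum>\<sigma>\<in>F. eproj Ch \<sigma> b)" by (rule expansion)
    have wF: "w = (\<Sum>\<sigma>\<in>F. r \<sigma> *\<^sub>R eproj Ch \<sigma> b)" unfolding w_def by (rule fun_calc_expansion[OF r(2) F])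
    have uF: "u = (\<Sum>\<sigma>\<in>F. \<rho> \<sigma> *\<^sub>R eproj Ch \<sigma> b)" unfolding u_def by (rule fun_calc_expansion[OF bdd\<rho> F])
    have "pert.T w = (\<Sum>\<sigma>\<in>F. (\<sigma> + lam) *\<^sub>R r \<sigma> *\<^sub>R eproj Ch \<sigma> b)"
      by (simp add: wF pert.T_def blinfun.sum_right blinfun.scaleR_right eproj_eigen scaleR_sum_right
          sum.distrib[symmetric] scaleR_add_left[symmetric]) (simp add: algebra_simps)
    then have "pert.T w \<bullet> w = (\<Sum>\<sigma>\<in>F. (\<sigma> + lam) * (r \<sigma> * (eproj Ch \<sigma> b \<bullet> w)))" by (simp add: inner_sum_left mult.assoc)
    also have "\<dots> = (\<Sum>\<sigma>\<in>F. (\<rho> \<sigma>)\<^sup>2 * (norm (eproj Ch \<sigma> b))\<^sup>2)"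
    proof (rule sum.cong)
      fix \<sigma> assume "\<sigma> \<in> F"
      have "eproj Ch \<sigma> b \<bullet> w = r \<sigma> * (norm (eproj Ch \<sigma> b))\<^sup>2"
        by (subst eproj_inner_eq) (simp add: w_def eproj_fun_calc[OF symCh r(2)] power2_norm_eq_inner)
      then show "(\<sigma> + lam) * (r \<sigma> * (eproj Ch \<sigma> b \<bullet> w)) = (\<rho> \<sigma>)\<^sup>2 * (norm (eproj Ch \<sigma> b))\<^sup>2"
        using pos[of \<sigma>] \<open>\<sigma> \<in> F\<close> F(2) by (simp add: \<rho>_def power_mult_distrib subset_iff less_imp_le power2_eq_square)
    qed simp
    also have "\<dots> = (\<Sum>\<sigma>\<in>F. (norm (\<rho> \<sigma> *\<^sub>R eproj Ch \<sigma> b))\<^sup>2)" by (simp add: power_mult_distrib)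
    also have "\<dots> = (norm u)\<^sup>2"
      unfolding uF by (rule norm_orthogonal_sum[symmetric, OF F(1)]) (simp add: eproj_orthogonal[OF symCh])
    finally show ?thesis .
  qed
  \<comment> \<open>Back from \<open>Ch\<close> to \<open>C\<close>: the form comparison doubles the
    energy and contributes the factor \<open>sqrt 2\<close>.\<close>
  then have "C w \<bullet> w \<le> 2 * (norm u)\<^sup>2"
    using T_inner_pert[of w] orig.T_inner[of w] lam by (simp add: add_increasing2) (smt (verit) inner_ge_zero mult_nonneg_nonneg)
  then have "sqrt (C w \<bullet> w) \<le> sqrt 2 * norm u"
    by (metis abs_norm_cancel real_sqrt_abs real_sqrt_le_mono real_sqrt_mult)
  also have "\<dots> \<le> sqrt 2 * (norm a * K + real m * eps * 2 powr (real m - 1/2) * \<Gamma> * norm b)"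
    by (intro mult_left_mono nu) simp
  \<comment> \<open>The exponents of 2 add up as
    \<open>1/2 + \<theta> + \<nu> = 2 * \<nu> - m\<close> and
    \<open>1/2 + (m - 1/2) = m\<close>.\<close>
  also have "\<dots> = 2 powr (2 * \<nu> - real m) * M0 * \<Gamma> * lam powr \<nu> * norm a + real m * 2 ^ m * \<Gamma> * eps * norm b"
  proof -
    have s2: "sqrt 2 = 2 powr (1/2)" by (simp add: powr_half_sqrt)
    have "sqrt 2 * 2 powr (\<theta> + \<nu>) = 2 powr (2 * \<nu> - real m)"
      unfolding s2 powr_add[symmetric] by (simp add: \<nu> add_ac)
    moreover have "sqrt 2 * 2 powr (real m - 1/2) = 2 ^ m"
      unfolding s2 powr_add[symmetric] by (simp add: powr_realpow)
    moreover have "sqrt 2 * (norm a * K + real m * eps * 2 powr (real m - 1/2) * \<Gamma> * norm b)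
       = (sqrt 2 * 2 powr (\<theta> + \<nu>)) * M0 * \<Gamma> * lam powr \<nu> * norm a
         + real m * (sqrt 2 * 2 powr (real m - 1/2)) * \<Gamma> * eps * norm b"
      by (simp add: K_def algebra_simps)
    ultimately show ?thesis by (simp only:)
  qed
  finally show ?thesis by (simp add: w_def b_def)
qed

text \<open>The form comparison is used twice, for \<open>T\<close> and dually for its inverse, each
  time with factor 2. The kernel of \<open>Ch\<close> is excluded because \<open>G\<close> says
  nothing about \<open>g 0\<close>.\<close>

lemma filter_bound:
  assumes g: "bounded (g ` eigenvalues Ch)" "\<And>\<sigma>. \<sigma> \<in> eigenvalues Ch \<Longrightarrow> \<sigma> > 0 \<Longrightarrow> \<bar>g \<sigma>\<bar> * (\<sigma> + lam) \<le> G"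
    and v: "eproj Ch 0 v = 0"
  shows "C (fun_calc g Ch v) \<bullet> fun_calc g Ch v \<le> 4 * G\<^sup>2 * (orig.R v \<bullet> v)"
proof -
  define w where "w = fun_calc g Ch v"
  obtain F where F: "finite F" "F \<subseteq> eigenvalues Ch" "v = (\<Sum>\<sigma>\<in>F. eproj Ch \<sigma> v)" by (rule expansion)
  have evCh: "\<sigma> \<ge> 0" if "\<sigma> \<in> eigenvalues Ch" for \<sigma> using eigenvalue_nonneg[OF pert.nonneg that] .
  have pos: "\<sigma> + lam > 0" if "\<sigma> \<in> eigenvalues Ch" for \<sigma> using evCh[OF that] lam by simp
  \<comment> \<open>\<open>x\<close> is the inverse of \<open>Th\<close> applied to
    \<open>v\<close>, so \<open>v \<bullet> x\<close> is the inverse form of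
    \<open>Th\<close>.\<close>
  define x where "x = (\<Sum>\<sigma>\<in>F. (1 / (\<sigma> + lam)) *\<^sub>R eproj Ch \<sigma> v)"
  have comb: "pert.T (\<Sum>\<sigma>\<in>F. f \<sigma> *\<^sub>R eproj Ch \<sigma> v) = (\<Sum>\<sigma>\<in>F. ((\<sigma> + lam) * f \<sigma>) *\<^sub>R eproj Ch \<sigma> v)" for f
    by (simp add: pert.T_def blinfun.sum_right blinfun.scaleR_right eproj_eigen scaleR_sum_right
          sum.distrib[symmetric] scaleR_add_left[symmetric]) (simp add: algebra_simps)
  have inner: "(\<Sum>\<sigma>\<in>F. f \<sigma> *\<^sub>R eproj Ch \<sigma> v) \<bullet> (\<Sum>\<sigma>\<in>F. h \<sigma> *\<^sub>R eproj Ch \<sigma> v)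
      = (\<Sum>\<sigma>\<in>F. f \<sigma> * h \<sigma> * (norm (eproj Ch \<sigma> v))\<^sup>2)" for f h
    unfolding inner_sum_left
  proof (rule sum.cong)
    fix \<sigma> assume \<sigma>: "\<sigma> \<in> F"
    have "f \<sigma> *\<^sub>R eproj Ch \<sigma> v \<bullet> (\<Sum>\<sigma>\<in>F. h \<sigma> *\<^sub>R eproj Ch \<sigma> v)
      = (\<Sum>\<sigma>'\<in>F. if \<sigma>' = \<sigma> then f \<sigma> * h \<sigma> * (norm (eproj Ch \<sigma> v))\<^sup>2 else 0)"
      unfolding inner_sum_right
      by (rule sum.cong) (auto simp: eproj_orthogonal[OF symCh] power2_norm_eq_inner)
    then show "f \<sigma> *\<^sub>R eproj Ch \<sigma> v \<bullet> (\<Sum>\<sigma>\<in>F. h \<sigma> *\<^sub>R eproj Ch \<sigma> v) = f \<sigma> * h \<sigma> * (norm (eproj Ch \<sigma> v))\<^sup>2"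
      using F(1) \<sigma> by simp
  qed simp
  have "pert.T x = (\<Sum>\<sigma>\<in>F. eproj Ch \<sigma> v)"
    unfolding x_def comb using F(2) pos by (intro sum.cong) (auto simp: subset_iff less_imp_neq[symmetric])
  then have Tx: "pert.T x = v" using F(3) by simp
  have vx: "v \<bullet> x = (\<Sum>\<sigma>\<in>F. 1 / (\<sigma> + lam) * (norm (eproj Ch \<sigma> v))\<^sup>2)"
    using inner[of "\<lambda>_. 1" "\<lambda>\<sigma>. 1 / (\<sigma> + lam)"] F(3) by (simp add: x_def)
  have vx0: "v \<bullet> x \<ge> 0" unfolding vx using F(2) pos by (intro sum_nonneg) (auto simp: subset_iff less_imp_le)
  have "pert.T w \<bullet> w = (\<Sum>\<sigma>\<in>F. ((\<sigma> + lam) * g \<sigma>) * g \<sigma> * (norm (eproj Ch \<sigma> v))\<^sup>2)"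
    unfolding w_def fun_calc_expansion[OF g(1) F] comb inner ..
  also have "\<dots> \<le> (\<Sum>\<sigma>\<in>F. G\<^sup>2 * (1 / (\<sigma> + lam) * (norm (eproj Ch \<sigma> v))\<^sup>2))"
  proof (rule sum_mono)
    fix \<sigma> assume "\<sigma> \<in> F"
    then have \<sigma>: "\<sigma> \<in> eigenvalues Ch" using F by auto
    show "((\<sigma> + lam) * g \<sigma>) * g \<sigma> * (norm (eproj Ch \<sigma> v))\<^sup>2 \<le> G\<^sup>2 * (1 / (\<sigma> + lam) * (norm (eproj Ch \<sigma> v))\<^sup>2)"
    proof (cases "\<sigma> = 0")
      case False
      then have "\<bar>g \<sigma>\<bar> * (\<sigma> + lam) \<le> G" using g(2)[OF \<sigma>] evCh[OF \<sigma>] by simp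
      then have "(\<bar>g \<sigma>\<bar> * (\<sigma> + lam))\<^sup>2 \<le> G\<^sup>2" using pos[OF \<sigma>] by (intro power_mono) auto
      then have "(\<sigma> + lam) * g \<sigma> * g \<sigma> \<le> G\<^sup>2 * (1 / (\<sigma> + lam))"
        using pos[OF \<sigma>] by (simp add: power_mult_distrib field_simps power2_eq_square)
      from mult_right_mono[OF this, of "(norm (eproj Ch \<sigma> v))\<^sup>2"] show ?thesis by (simp add: mult.assoc)
    qed (simp add: v)
  qed
  also have "\<dots> = G\<^sup>2 * (v \<bullet> x)" by (simp add: vx sum_distrib_left)
  finally have 1: "pert.T w \<bullet> w \<le> G\<^sup>2 * (v \<bullet> x)" .
  have 2: "v \<bullet> x \<le> 2 * (orig.R v \<bullet> v)"
  proof (cases "v \<bullet> x = 0")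
    case True
    then show ?thesis using orig.R_inner_nonneg[of v] by simp
  next
    case False
    \<comment> \<open>Duality: pair \<open>v\<close> with \<open>x\<close>, compare the energies of
      \<open>x\<close> under \<open>T\<close> and \<open>Th\<close>, and cancel one factor
      \<open>v \<bullet> x\<close>.\<close>
    have "(v \<bullet> x) * (v \<bullet> x) = (orig.T (orig.R v) \<bullet> x)\<^sup>2" by (simp add: orig.T_R power2_eq_square)
    also have "\<dots> \<le> (orig.T (orig.R v) \<bullet> orig.R v) * (orig.T x \<bullet> x)" by (rule orig.T_cauchy_schwarz)
    also have "\<dots> \<le> (orig.R v \<bullet> v) * (2 * (v \<bullet> x))"
      using T_inner_pert[of x] orig.R_inner_nonneg[of v]
      by (simp add: orig.T_R Tx inner_commute mult_left_mono)
    finally show ?thesis using vx0 False by (simp add: mult.commute mult.left_commute)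
  qed
  have "C w \<bullet> w \<le> orig.T w \<bullet> w" using lam by (simp add: orig.T_inner)
  also have "\<dots> \<le> 2 * (pert.T w \<bullet> w)" by (rule T_inner_pert)
  also have "\<dots> \<le> 2 * (G\<^sup>2 * (2 * (orig.R v \<bullet> v)))"
    using 1 mult_left_mono[OF 2, of "G\<^sup>2"] by simp
  finally show ?thesis by (simp add: w_def)
qed

lemma residual_eq:
  assumes "bounded (g ` eigenvalues Ch)" "bounded ((\<lambda>\<sigma>. 1 - \<sigma> * g \<sigma>) ` eigenvalues Ch)"
  shows "fun_calc (\<lambda>\<sigma>. 1 - \<sigma> * g \<sigma>) Ch v = v - Ch (fun_calc g Ch v)"
proof -
  obtain F where F: "finite F" "F \<subseteq> eigenvalues Ch" "v = (\<Sum>\<sigma>\<in>F. eproj Ch \<sigma> v)" by (rule expansion)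
  have "Ch (fun_calc g Ch v) = (\<Sum>\<sigma>\<in>F. (\<sigma> * g \<sigma>) *\<^sub>R eproj Ch \<sigma> v)"
    unfolding fun_calc_expansion[OF assms(1) F]
    by (simp add: blinfun.sum_right blinfun.scaleR_right eproj_eigen mult.commute)
  then show ?thesis
    unfolding fun_calc_expansion[OF assms(2) F] using F(3) by (simp add: scaleR_diff_left sum_subtractf)
qed

end

section \<open>Concentration of sums of independent vectors\<close>

text \<open>\<open>cosh (sqrt x)\<close> is a power series in \<open>x\<close> with nonnegative
  coefficients, hence convex on the half line. The argument lies between
  \<open>(a - r)\<^sup>2\<close> and \<open>(a + r)\<^sup>2\<close>, and the right side is the
  chord, with \<open>t\<close> in the role of the cosine of an angle.\<close>

lemma cosh_sqrt_chord:
  fixes a r t :: real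
  assumes "\<bar>t\<bar> \<le> 1" "a \<ge> 0" "r \<ge> 0"
  shows "cosh (sqrt (a\<^sup>2 + r\<^sup>2 + 2 * t * a * r)) \<le> cosh a * cosh r + t * (sinh a * sinh r)"
proof -
  define p m where "p = (a + r)\<^sup>2" and "m = (a - r)\<^sup>2"
  define v where "v = a\<^sup>2 + r\<^sup>2 + 2 * t * a * r"
  define s where "s = (1 + t) / 2"
  have s: "0 \<le> s" "s \<le> 1" using assms(1) by (auto simp: s_def)
  have v: "v = s * p + (1 - s) * m"
    by (simp add: v_def p_def m_def s_def power2_eq_square field_simps)
  have pm: "p \<ge> 0" "m \<ge> 0" by (simp_all add: p_def m_def)
  have v0: "v \<ge> 0" unfolding v using s pm by simp
  have term_le: "v ^ n \<le> s * p ^ n + (1 - s) * m ^ n" for n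
  proof -
    have "convex_on {0..} (\<lambda>x::real. x ^ n)"
      by (cases "even n") (auto intro: convex_power_odd convex_on_subset[OF convex_power_even])
    from convex_onD[OF this s, of m p] pm show ?thesis by (simp add: v algebra_simps)
  qed
  have ser: "(\<lambda>n. x ^ n / fact (2 * n)) sums cosh (sqrt x)" if "x \<ge> 0" for x :: real
  proof -
    have "(\<lambda>n. if even n then (sqrt x) ^ n /\<^sub>R fact n else 0) sums cosh (sqrt x)" by (rule cosh_converges)
    then have "(\<lambda>n. (if even (2 * n) then (sqrt x) ^ (2 * n) /\<^sub>R fact (2 * n) else 0)) sums cosh (sqrt x)"
      by (subst sums_mono_reindex) (auto simp: strict_mono_def elim!: evenE)
    moreover have "(sqrt x) ^ (2 * n) = x ^ n" for n using that by (simp add: power_mult)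
    ultimately show ?thesis by (simp add: divide_inverse mult.commute)
  qed
  have "cosh (sqrt v) \<le> s * cosh (sqrt p) + (1 - s) * cosh (sqrt m)"
  proof (rule sums_le)
    show "(\<lambda>n. v ^ n / fact (2 * n)) sums cosh (sqrt v)" by (rule ser[OF v0])
    show "(\<lambda>n. s * (p ^ n / fact (2 * n)) + (1 - s) * (m ^ n / fact (2 * n))) sums (s * cosh (sqrt p) + (1 - s) * cosh (sqrt m))"
      by (intro sums_add sums_mult ser pm)
    show "v ^ n / fact (2 * n) \<le> s * (p ^ n / fact (2 * n)) + (1 - s) * (m ^ n / fact (2 * n))" for n
      using divide_right_mono[OF term_le[of n], of "fact (2 * n)"] by (simp add: add_divide_distrib)
  qed
  also have "sqrt p = a + r" using assms by (simp add: p_def)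
  also have "sqrt m = \<bar>a - r\<bar>" by (simp add: m_def)
  also have "cosh \<bar>a - r\<bar> = cosh (a - r)" by (simp add: cosh_real_abs)
  also have "s * cosh (a + r) + (1 - s) * cosh (a - r) = cosh a * cosh r + t * (sinh a * sinh r)"
    by (simp add: cosh_add cosh_diff s_def field_simps)
  finally show ?thesis by (simp add: v_def)
qed

lemma sinh_ge_self:
  fixes x :: real
  assumes "x \<ge> 0"
  shows "x \<le> sinh x"
proof -
  have "sinh 0 - 0 \<le> sinh x - x"
    by (rule DERIV_nonneg_imp_nondecreasing[OF assms, of "\<lambda>x. sinh x - x"])
      (auto intro!: exI derivative_eq_intros simp: cosh_real_ge_1)
  then show ?thesis by simp
qed

text \<open>To be used with \<open>a = h * norm S\<close>, \<open>r = h * norm \<xi>\<close> and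
  \<open>u = h\<^sup>2 * (S \<bullet> \<xi>)\<close>. The bound is affine in \<open>u\<close>, so
  the cross term disappears on averaging over a centred \<open>\<xi>\<close>. For
  \<open>a = 0\<close> the quotient is 0 by convention, and then \<open>u = 0\<close> as
  well.\<close>

lemma cosh_sqrt_increment:
  fixes a r u :: real
  assumes "\<bar>u\<bar> \<le> a * r" "a \<ge> 0" "r \<ge> 0"
  shows "cosh (sqrt (a\<^sup>2 + r\<^sup>2 + 2 * u)) \<le> cosh a * (exp r - r) + sinh a / a * u"
proof (cases "a * r = 0")
  case True
  then have u: "u = 0" using assms(1) by (simp only: True abs_le_zero_iff)
  have e: "exp r - r = cosh r + (sinh r - r)" by (simp add: cosh_plus_sinh[symmetric])
  have 1: "sinh r - r \<ge> 0" using sinh_ge_self assms by simp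
  have "cosh (sqrt (a\<^sup>2 + r\<^sup>2)) = cosh a * cosh r" using True assms by auto
  also have "\<dots> \<le> cosh a * (exp r - r)" unfolding e using 1 by (intro mult_left_mono) auto
  finally show ?thesis by (simp add: u)
next
  case False
  then have pos: "a > 0" "r > 0" using assms by auto
  define t where "t = u / (a * r)"
  have u: "u = t * a * r" using pos by (simp add: t_def)
  have t: "\<bar>t\<bar> \<le> 1" using assms pos by (simp add: t_def abs_mult)
  have "cosh (sqrt (a\<^sup>2 + r\<^sup>2 + 2 * u)) \<le> cosh a * cosh r + t * (sinh a * sinh r)"
    using cosh_sqrt_chord[OF t assms(2,3)] by (simp add: u mult.assoc)
  also have "\<dots> = cosh a * cosh r + t * (sinh a * (sinh r - r)) + sinh a / a * u"
    using pos by (simp add: u field_simps)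
  \<comment> \<open>Only the part with \<open>sinh r - r \<ge> 0\<close> has its coefficient
    enlarged from \<open>t\<close> to 1; the remaining occurrence of \<open>t\<close> is the term
    linear in \<open>u\<close> and must be kept.\<close>
  also have "\<dots> \<le> cosh a * cosh r + 1 * (sinh a * (sinh r - r)) + sinh a / a * u"
  proof -
    have "t * (sinh a * (sinh r - r)) \<le> 1 * (sinh a * (sinh r - r))"
      using t sinh_ge_self[of r] pos by (intro mult_right_mono) auto
    then show ?thesis by simp
  qed
  also have "\<dots> \<le> cosh a * cosh r + 1 * (cosh a * (sinh r - r)) + sinh a / a * u"
  proof -
    have "sinh a * (sinh r - r) \<le> cosh a * (sinh r - r)"
      using sinh_ge_self[of r] pos by (intro mult_right_mono) (auto intro: less_imp_le sinh_less_cosh_real)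
    then show ?thesis by simp
  qed
  also have "\<dots> = cosh a * (exp r - r) + sinh a / a * u"
    by (simp add: cosh_plus_sinh[symmetric] algebra_simps)
  finally show ?thesis .
qed

text \<open>The factorials beyond the linear term are at least 2, so the tail of the series is
  dominated by \<open>x\<^sup>2 / 2\<close> times a geometric series.\<close>

lemma exp_upper_bound:
  fixes x c :: real
  assumes "0 \<le> x" "x \<le> c" "c < 1"
  shows "exp x - x \<le> 1 + x\<^sup>2 / (2 * (1 - c))"
proof -
  have x1: "x < 1" using assms by simp
  have "exp x = 1 + x + (\<Sum>n. inverse (fact (n + 2)) * (x ^ (n + 2)))" by (simp add: exp_first_two_terms[of x])
  also have "(\<Sum>n. inverse (fact (n + 2)) * (x ^ (n + 2))) \<le> (\<Sum>n. (x\<^sup>2 / 2) * x ^ n)"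
  proof (rule suminf_le)
    show "summable (\<lambda>n. inverse (fact (n + 2)) * (x ^ (n + 2)))"
      by (rule summable_ignore_initial_segment[of _ 2, OF summable_exp])
    show "summable (\<lambda>n. (x\<^sup>2 / 2) * x ^ n)" using x1 assms by (intro summable_mult summable_geometric) auto
    show "inverse (fact (n + 2)) * (x ^ (n + 2)) \<le> (x\<^sup>2 / 2) * x ^ n" for n
    proof -
      have "fact 2 \<le> (fact (n + 2) :: real)" by (rule fact_mono) simp
      then have "inverse (fact (n + 2)) \<le> (1 / 2 :: real)" by (simp add: field_simps)
      then have "inverse (fact (n + 2)) * x ^ (n + 2) \<le> 1 / 2 * x ^ (n + 2)"
        using assms by (intro mult_right_mono) auto
      then show ?thesis by (simp add: power_add power2_eq_square mult_ac)
    qed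
  qed
  also have "\<dots> = (x\<^sup>2 / 2) * (1 / (1 - x))"
    using x1 assms by (subst suminf_mult) (auto simp: suminf_geometric intro: summable_geometric)
  also have "\<dots> = x\<^sup>2 / (2 * (1 - x))" by simp
  also have "\<dots> \<le> x\<^sup>2 / (2 * (1 - c))" using assms by (intro divide_left_mono) auto
  finally show ?thesis by simp
qed

text \<open>The form to be used is a trace that converges on Hilbert-Schmidt operators, a proper
  subspace of a type of bounded operators in general; hence a carrier set \<open>S\<close> instead
  of a type class.\<close>

locale semi_inner_space =
  fixes S :: "'v::real_vector set" and ip :: "'v \<Rightarrow> 'v \<Rightarrow> real"
  assumes subspace: "subspace S"
    and ip_add: "x \<in> S \<Longrightarrow> y \<in> S \<Longrightarrow> z \<in> S \<Longrightarrow> ip (x + y) z = ip x z + ip y z"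
    and ip_scale: "x \<in> S \<Longrightarrow> z \<in> S \<Longrightarrow> ip (c *\<^sub>R x) z = c * ip x z"
    and ip_commute: "x \<in> S \<Longrightarrow> y \<in> S \<Longrightarrow> ip x y = ip y x"
    and ip_nonneg: "x \<in> S \<Longrightarrow> ip x x \<ge> 0"
begin

lemma ip_add_right: "x \<in> S \<Longrightarrow> y \<in> S \<Longrightarrow> z \<in> S \<Longrightarrow> ip z (x + y) = ip z x + ip z y"
  using ip_add[of x y z] ip_commute subspace_add[OF subspace] by simp

lemma ip_scale_right: "x \<in> S \<Longrightarrow> z \<in> S \<Longrightarrow> ip z (c *\<^sub>R x) = c * ip z x"
  using ip_scale[of x z c] ip_commute subspace_scale[OF subspace] by simp

lemma ip_diff: "x \<in> S \<Longrightarrow> y \<in> S \<Longrightarrow> z \<in> S \<Longrightarrow> ip (x - y) z = ip x z - ip y z"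
  using ip_add[of "x - y" y z] subspace_diff[OF subspace] by simp

lemma ip_diff_right: "x \<in> S \<Longrightarrow> y \<in> S \<Longrightarrow> z \<in> S \<Longrightarrow> ip z (x - y) = ip z x - ip z y"
  using ip_add_right[of "x - y" y z] subspace_diff[OF subspace] by simp

lemma ip_zero: "z \<in> S \<Longrightarrow> ip 0 z = 0"
  using ip_scale[of 0 z 0] subspace_0[OF subspace] by simp

lemma ip_sum: "(\<And>i. i \<in> I \<Longrightarrow> f i \<in> S) \<Longrightarrow> z \<in> S \<Longrightarrow> ip (\<Sum>i\<in>I. f i) z = (\<Sum>i\<in>I. ip (f i) z)"
  by (induction I rule: infinite_finite_induct) (simp_all add: ip_zero ip_add subspace_sum[OF subspace])

lemma ip_sum_right: "(\<And>i. i \<in> I \<Longrightarrow> f i \<in> S) \<Longrightarrow> z \<in> S \<Longrightarrow> ip z (\<Sum>i\<in>I. f i) = (\<Sum>i\<in>I. ip z (f i))"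
  using ip_sum[of I f z] ip_commute by (simp add: subspace_sum[OF subspace])

lemma ip_square_add:
  assumes "x \<in> S" "y \<in> S"
  shows "ip (x + y) (x + y) = ip x x + ip y y + 2 * ip x y"
  using assms subspace_add[OF subspace assms] by (simp add: ip_add ip_add_right ip_commute[of y x])

lemma ip_cauchy_schwarz:
  assumes "x \<in> S" "y \<in> S"
  shows "\<bar>ip x y\<bar> \<le> sqrt (ip x x) * sqrt (ip y y)"
proof -
  have q: "0 \<le> ip x x + c\<^sup>2 * ip y y + 2 * c * ip x y" for c
  proof -
    have cy: "c *\<^sub>R y \<in> S" using assms subspace_scale[OF subspace] by blast
    have "0 \<le> ip (x + c *\<^sub>R y) (x + c *\<^sub>R y)" by (rule ip_nonneg) (use assms cy subspace_add[OF subspace] in blast)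
    also have "\<dots> = ip x x + c\<^sup>2 * ip y y + 2 * c * ip x y"
      using assms cy by (simp add: ip_square_add ip_scale ip_scale_right power2_eq_square)
    finally show ?thesis .
  qed
  have "(ip x y)\<^sup>2 \<le> ip x x * ip y y"
  proof (cases "ip y y = 0")
    case True
    have "ip x y = 0"
    proof (rule ccontr)
      assume n: "ip x y \<noteq> 0"
      \<comment> \<open>The quadratic has become affine in its parameter; at this value it equals
        -1.\<close>
      have "0 \<le> ip x x + 2 * (- (ip x x + 1) / (2 * ip x y)) * ip x y"
        using q[of "- (ip x x + 1) / (2 * ip x y)"] True by simp
      moreover have "2 * (- (ip x x + 1) / (2 * ip x y)) * ip x y = - (ip x x + 1)" using n by simp
      ultimately show False by linarith
    qed
    then show ?thesis by (simp add: True)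
  next
    case False
    then have pos: "ip y y > 0" using ip_nonneg[OF assms(2)] by simp
    show ?thesis using q[of "- ip x y / ip y y"] pos by (simp add: field_simps power2_eq_square)
  qed
  then have "\<bar>ip x y\<bar> \<le> sqrt (ip x x * ip y y)" by (simp add: real_le_rsqrt)
  then show ?thesis by (simp add: real_sqrt_mult)
qed

end

text \<open>For \<open>t \<ge> 1\<close> Bernstein's inequality at level \<open>t + ln 2\<close> leaves room for a union bound over
  two events; for smaller \<open>t\<close>, where it does not, Chebyshev's inequality is stronger.\<close>

definition tail_level :: "real \<Rightarrow> real \<Rightarrow> real" where
  "tail_level c t = (if t \<ge> 1 then exp (- t) else 1 / (c * t)\<^sup>2)"

text \<open>Measurability and centring are demanded only of the scalars
  \<open>ip (\<xi> z) (\<xi> w)\<close>, so no measurable structure on an operator space is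
  involved. Centring is tested against the values of \<open>\<xi>\<close>, which suffices for the
  cross terms of a sum.\<close>

locale iid_vectors = semi_inner_space S ip + prob_space P
  for S :: "'v::real_vector set" and ip and P :: "'z measure" +
  fixes \<xi> :: "'z \<Rightarrow> 'v" and L \<sigma> :: real
  assumes in_S: "\<xi> z \<in> S"
    and meas: "(\<lambda>(z, w). ip (\<xi> z) (\<xi> w)) \<in> borel_measurable (P \<Otimes>\<^sub>M P)"
    and centered: "z \<in> space P \<Longrightarrow> (\<integral>w. ip (\<xi> z) (\<xi> w) \<partial>P) = 0"
    and L: "L > 0" and \<sigma>: "\<sigma> > 0"
    and bound: "AE z in P. ip (\<xi> z) (\<xi> z) \<le> L\<^sup>2"
    and variance: "(\<integral>z. ip (\<xi> z) (\<xi> z) \<partial>P) \<le> \<sigma>\<^sup>2"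
begin

section \<open>Moments and tails of the norm of an independent sum\<close>

definition total :: "nat \<Rightarrow> (nat \<Rightarrow> 'z) \<Rightarrow> 'v" where "total n z = (\<Sum>i<n. \<xi> (z i))"

definition sq :: "nat \<Rightarrow> (nat \<Rightarrow> 'z) \<Rightarrow> real" where "sq n z = ip (total n z) (total n z)"

lemma total_in_S: "total n z \<in> S"
  unfolding total_def by (intro subspace_sum subspace in_S)

lemma sq_nonneg: "sq n z \<ge> 0" unfolding sq_def by (intro ip_nonneg total_in_S)

lemma sq_eq: "sq n z = (\<Sum>i<n. \<Sum>j<n. ip (\<xi> (z i)) (\<xi> (z j)))"
proof -
  have "sq n z = (\<Sum>i<n. ip (\<xi> (z i)) (total n z))"
    unfolding sq_def by (subst (1) total_def) (rule ip_sum[OF in_S total_in_S])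
  then show ?thesis by (simp add: total_def ip_sum_right in_S)
qed

lemma sq_measurable [measurable]: "sq n \<in> borel_measurable (Pi\<^sub>M {..<n} (\<lambda>_. P))"
proof -
  have "(\<lambda>z. case (z i, z j) of (z, w) \<Rightarrow> ip (\<xi> z) (\<xi> w)) \<in> borel_measurable (Pi\<^sub>M {..<n} (\<lambda>_. P))"
    if "i < n" "j < n" for i j
    using that by (intro measurable_compose[OF _ meas] measurable_Pair measurable_component_singleton) auto
  then show ?thesis unfolding sq_eq[abs_def] by (intro borel_measurable_sum) auto
qed

lemma diag_measurable: "(\<lambda>z. ip (\<xi> z) (\<xi> z)) \<in> borel_measurable P"
  using measurable_compose[OF measurable_Pair[OF measurable_ident_sets[OF refl] measurable_ident_sets[OF refl]] meas]
  by simp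

lemma section_measurable:
  assumes "z \<in> space P"
  shows "(\<lambda>w. ip (\<xi> z) (\<xi> w)) \<in> borel_measurable P"
  using measurable_compose[OF measurable_Pair1'[OF assms] meas] by simp

lemma diag_integrable: "integrable P (\<lambda>z. ip (\<xi> z) (\<xi> z))"
  by (rule integrable_const_bound[where B = "L\<^sup>2"])
    (use bound diag_measurable in \<open>auto simp: ip_nonneg in_S\<close>)

lemma norm_le_L: "AE z in P. sqrt (ip (\<xi> z) (\<xi> z)) \<le> L"
  using bound L by (auto intro!: real_le_lsqrt simp: ip_nonneg in_S)

lemma section_integrable:
  assumes "z \<in> space P"
  shows "integrable P (\<lambda>w. ip (\<xi> z) (\<xi> w))"
proof (rule integrable_const_bound[where B = "sqrt (ip (\<xi> z) (\<xi> z)) * L"])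
  show "AE w in P. norm (ip (\<xi> z) (\<xi> w)) \<le> sqrt (ip (\<xi> z) (\<xi> z)) * L"
    using norm_le_L
  proof eventually_elim
    case (elim w)
    have "norm (ip (\<xi> z) (\<xi> w)) \<le> sqrt (ip (\<xi> z) (\<xi> z)) * sqrt (ip (\<xi> w) (\<xi> w))"
      using ip_cauchy_schwarz[OF in_S in_S] by simp
    also have "\<dots> \<le> sqrt (ip (\<xi> z) (\<xi> z)) * L" using elim by (intro mult_left_mono) (auto simp: ip_nonneg in_S)
    finally show ?case .
  qed
qed (rule section_measurable[OF assms])

lemma total_section:
  assumes "z \<in> space (Pi\<^sub>M {..<n} (\<lambda>_. P))"
  shows "integrable P (\<lambda>w. ip (total n z) (\<xi> w))" "(\<integral>w. ip (total n z) (\<xi> w) \<partial>P) = 0"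
proof -
  have z: "z i \<in> space P" if "i < n" for i using assms that by (auto simp: space_PiM)
  have eq: "ip (total n z) (\<xi> w) = (\<Sum>i<n. ip (\<xi> (z i)) (\<xi> w))" for w
    unfolding total_def by (simp add: ip_sum in_S)
  show "integrable P (\<lambda>w. ip (total n z) (\<xi> w))"
    unfolding eq by (intro Bochner_Integration.integrable_sum section_integrable z) auto
  show "(\<integral>w. ip (total n z) (\<xi> w) \<partial>P) = 0"
    unfolding eq by (subst Bochner_Integration.integral_sum) (auto intro!: section_integrable z sum.neutral centered)
qed

lemma sq_update: "sq (Suc n) (z(n := w)) = sq n z + ip (\<xi> w) (\<xi> w) + 2 * ip (total n z) (\<xi> w)"
proof -
  have "total (Suc n) (z(n := w)) = total n z + \<xi> w" by (simp add: total_def)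
  then show ?thesis by (simp add: sq_def ip_square_add total_in_S in_S)
qed

lemma nn_integral_Suc:
  assumes "f \<in> borel_measurable (Pi\<^sub>M {..<Suc n} (\<lambda>_. P))"
  shows "(\<integral>\<^sup>+z. f z \<partial>Pi\<^sub>M {..<Suc n} (\<lambda>_. P)) = (\<integral>\<^sup>+z. \<integral>\<^sup>+w. f (z(n := w)) \<partial>P \<partial>Pi\<^sub>M {..<n} (\<lambda>_. P))"
proof -
  interpret product_sigma_finite "\<lambda>_::nat. P" by unfold_locales
  show ?thesis using product_nn_integral_insert[of "{..<n}" n f] assms by (simp add: lessThan_Suc)
qed

lemma prob_space_PiM: "prob_space (Pi\<^sub>M {..<n::nat} (\<lambda>_. P))"
  by (rule prob_space_PiM) (rule prob_space_axioms)

text \<open>The cross term with the newest vector integrates to zero, so the second moments add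
  up.\<close>

lemma second_moment: "(\<integral>\<^sup>+z. ennreal (sq n z) \<partial>Pi\<^sub>M {..<n} (\<lambda>_. P)) \<le> ennreal (real n * \<sigma>\<^sup>2)"
proof (induction n)
  case 0
  then show ?case by (simp add: sq_def total_def ip_zero subspace_0[OF subspace])
next
  case (Suc n)
  interpret pn: prob_space "Pi\<^sub>M {..<n} (\<lambda>_. P)" by (rule prob_space_PiM)
  have "(\<integral>\<^sup>+z. ennreal (sq (Suc n) z) \<partial>Pi\<^sub>M {..<Suc n} (\<lambda>_. P))
      = (\<integral>\<^sup>+z. \<integral>\<^sup>+w. ennreal (sq (Suc n) (z(n := w))) \<partial>P \<partial>Pi\<^sub>M {..<n} (\<lambda>_. P))"
    by (rule nn_integral_Suc) measurable
  also have "\<dots> \<le> (\<integral>\<^sup>+z. ennreal (sq n z) + ennreal (\<sigma>\<^sup>2) \<partial>Pi\<^sub>M {..<n} (\<lambda>_. P))"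
  proof (rule nn_integral_mono)
    fix z assume z: "z \<in> space (Pi\<^sub>M {..<n} (\<lambda>_. P))"
    let ?f = "\<lambda>w. sq n z + ip (\<xi> w) (\<xi> w) + 2 * ip (total n z) (\<xi> w)"
    have int: "integrable P ?f" using total_section(1)[OF z] diag_integrable by auto
    have "(\<integral>\<^sup>+w. ennreal (sq (Suc n) (z(n := w))) \<partial>P) = (\<integral>\<^sup>+w. ennreal (?f w) \<partial>P)" by (simp only: sq_update)
    also have "\<dots> = ennreal (\<integral>w. ?f w \<partial>P)"
      by (rule nn_integral_eq_integral[OF int]) (use sq_nonneg[of "Suc n"] in \<open>simp add: sq_update[symmetric]\<close>)
    also have "(\<integral>w. ?f w \<partial>P) = sq n z + (\<integral>w. ip (\<xi> w) (\<xi> w) \<partial>P)"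
      using total_section[OF z] diag_integrable by (simp add: prob_space)
    also have "ennreal \<dots> \<le> ennreal (sq n z + \<sigma>\<^sup>2)" using variance by (intro ennreal_leI) simp
    also have "\<dots> = ennreal (sq n z) + ennreal (\<sigma>\<^sup>2)" using sq_nonneg by (intro ennreal_plus) auto
    finally show "(\<integral>\<^sup>+w. ennreal (sq (Suc n) (z(n := w))) \<partial>P) \<le> ennreal (sq n z) + ennreal (\<sigma>\<^sup>2)" .
  qed
  also have "\<dots> = (\<integral>\<^sup>+z. ennreal (sq n z) \<partial>Pi\<^sub>M {..<n} (\<lambda>_. P)) + ennreal (\<sigma>\<^sup>2)"
    by (subst nn_integral_add) (auto simp: pn.emeasure_space_1)
  also have "\<dots> \<le> ennreal (real n * \<sigma>\<^sup>2) + ennreal (\<sigma>\<^sup>2)" by (intro add_right_mono Suc)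
  also have "\<dots> = ennreal (real (Suc n) * \<sigma>\<^sup>2)" by (simp add: ennreal_plus[symmetric] algebra_simps del: ennreal_plus)
  finally show ?case .
qed

text \<open>Supermartingale step: integrating out the last sample multiplies the bound by at most
  \<open>m\<close>. The linear term of the increment has mean zero; what remains is the mean of
  \<open>exp r - r\<close>, controlled by the variance because \<open>r \<le> h * L < 1\<close>
  almost surely.\<close>

lemma exponential_moment:
  assumes h: "h > 0" "h * L < 1"
  shows "(\<integral>\<^sup>+z. ennreal (cosh (h * sqrt (sq n z))) \<partial>Pi\<^sub>M {..<n} (\<lambda>_. P))
       \<le> ennreal ((1 + h\<^sup>2 * \<sigma>\<^sup>2 / (2 * (1 - h * L))) ^ n)"
proof (induction n)
  case 0
  then show ?case using prob_space.emeasure_space_1[OF prob_space_PiM[of 0]]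
    by (simp add: sq_def total_def ip_zero subspace_0[OF subspace])
next
  case (Suc n)
  define m where "m = 1 + h\<^sup>2 * \<sigma>\<^sup>2 / (2 * (1 - h * L))"
  have m0: "m \<ge> 0" using h by (simp add: m_def)
  have "(\<integral>\<^sup>+z. ennreal (cosh (h * sqrt (sq (Suc n) z))) \<partial>Pi\<^sub>M {..<Suc n} (\<lambda>_. P))
      = (\<integral>\<^sup>+z. \<integral>\<^sup>+w. ennreal (cosh (h * sqrt (sq (Suc n) (z(n := w))))) \<partial>P \<partial>Pi\<^sub>M {..<n} (\<lambda>_. P))"
    unfolding cosh_def by (rule nn_integral_Suc) measurable
  also have "\<dots> \<le> (\<integral>\<^sup>+z. ennreal m * ennreal (cosh (h * sqrt (sq n z))) \<partial>Pi\<^sub>M {..<n} (\<lambda>_. P))"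
  proof (rule nn_integral_mono)
    fix z assume z: "z \<in> space (Pi\<^sub>M {..<n} (\<lambda>_. P))"
    define a where "a = h * sqrt (sq n z)"
    define r where "r w = h * sqrt (ip (\<xi> w) (\<xi> w))" for w
    define u where "u w = h\<^sup>2 * ip (total n z) (\<xi> w)" for w
    have a0: "a \<ge> 0" and r0: "r w \<ge> 0" for w using h by (auto simp: a_def r_def sq_nonneg ip_nonneg in_S)
    have r2: "(r w)\<^sup>2 = h\<^sup>2 * ip (\<xi> w) (\<xi> w)" for w by (simp add: r_def power_mult_distrib ip_nonneg in_S)
    have step: "cosh (h * sqrt (sq (Suc n) (z(n := w)))) \<le> cosh a * (exp (r w) - r w) + sinh a / a * u w" for w
    proof -
      have "h * sqrt (sq (Suc n) (z(n := w))) = sqrt (h\<^sup>2 * sq (Suc n) (z(n := w)))" using h by (simp add: real_sqrt_mult)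
      also have "h\<^sup>2 * sq (Suc n) (z(n := w)) = a\<^sup>2 + (r w)\<^sup>2 + 2 * u w"
        by (simp add: sq_update a_def r2 u_def power_mult_distrib sq_nonneg algebra_simps)
      finally have *: "h * sqrt (sq (Suc n) (z(n := w))) = sqrt (a\<^sup>2 + (r w)\<^sup>2 + 2 * u w)" .
      have "\<bar>ip (total n z) (\<xi> w)\<bar> \<le> sqrt (sq n z) * sqrt (ip (\<xi> w) (\<xi> w))"
        unfolding sq_def by (rule ip_cauchy_schwarz[OF total_in_S in_S])
      then have "h\<^sup>2 * \<bar>ip (total n z) (\<xi> w)\<bar> \<le> h\<^sup>2 * (sqrt (sq n z) * sqrt (ip (\<xi> w) (\<xi> w)))"
        by (intro mult_left_mono) auto
      then have "\<bar>u w\<bar> \<le> a * r w" by (simp add: u_def a_def r_def abs_mult power2_eq_square mult_ac)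
      then show ?thesis unfolding * using a0 r0 by (intro cosh_sqrt_increment)
    qed
    have rm: "r \<in> borel_measurable P" unfolding r_def using diag_measurable by measurable
    have rL: "AE w in P. r w \<le> h * L" using norm_le_L by eventually_elim (use h in \<open>simp add: r_def\<close>)
    have int1: "integrable P (\<lambda>w. exp (r w) - r w)"
    proof (rule integrable_const_bound[where B = "exp (h * L)"])
      show "AE w in P. norm (exp (r w) - r w) \<le> exp (h * L)"
        using rL
      proof eventually_elim
        case (elim w)
        have "exp (r w) \<le> exp (h * L)" using elim by simp
        moreover have "r w \<le> exp (r w)" using exp_ge_add_one_self[of "r w"] by linarith
        ultimately show ?case using r0[of w] unfolding real_norm_def by linarith
      qed
    qed (use rm in measurable)
    have int2: "integrable P u" unfolding u_def using total_section(1)[OF z] by simp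
    have int3: "integrable P (\<lambda>w. 1 + (r w)\<^sup>2 / (2 * (1 - h * L)))"
      unfolding r2 using diag_integrable by simp
    have "(\<integral>w. exp (r w) - r w \<partial>P) \<le> (\<integral>w. 1 + (r w)\<^sup>2 / (2 * (1 - h * L)) \<partial>P)"
    proof (intro integral_mono_AE int1 int3)
      show "AE w in P. exp (r w) - r w \<le> 1 + (r w)\<^sup>2 / (2 * (1 - h * L))"
        using rL by eventually_elim (rule exp_upper_bound[OF r0 _ h(2)])
    qed
    also have "\<dots> = 1 + h\<^sup>2 * (\<integral>w. ip (\<xi> w) (\<xi> w) \<partial>P) / (2 * (1 - h * L))"
      unfolding r2 using diag_integrable by (simp add: prob_space)
    also have "\<dots> \<le> m"
      unfolding m_def using h variance by (intro add_mono divide_right_mono mult_left_mono) auto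
    finally have em: "(\<integral>w. exp (r w) - r w \<partial>P) \<le> m" .
    let ?f = "\<lambda>w. cosh a * (exp (r w) - r w) + sinh a / a * u w"
    have intf: "integrable P ?f" using int1 int2 by auto
    have "(\<integral>\<^sup>+w. ennreal (cosh (h * sqrt (sq (Suc n) (z(n := w))))) \<partial>P) \<le> (\<integral>\<^sup>+w. ennreal (?f w) \<partial>P)"
      by (intro nn_integral_mono ennreal_leI step)
    also have "\<dots> = ennreal (\<integral>w. ?f w \<partial>P)"
    proof (rule nn_integral_eq_integral[OF intf])
      have "0 \<le> ?f w" for w by (rule order.trans[OF _ step]) simp
      then show "AE w in P. 0 \<le> ?f w" by simp
    qed
    also have "(\<integral>w. ?f w \<partial>P) = cosh a * (\<integral>w. exp (r w) - r w \<partial>P) + sinh a / a * (\<integral>w. u w \<partial>P)"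
      using int1 int2 by (subst Bochner_Integration.integral_add) auto
    also have "(\<integral>w. u w \<partial>P) = 0" unfolding u_def using total_section(2)[OF z] by simp
    also have "ennreal (cosh a * (\<integral>w. exp (r w) - r w \<partial>P) + sinh a / a * 0) \<le> ennreal (m * cosh a)"
      using mult_left_mono[OF em, of "cosh a"] by (intro ennreal_leI) (simp add: mult.commute)
    also have "\<dots> = ennreal m * ennreal (cosh (h * sqrt (sq n z)))" using m0 by (simp add: ennreal_mult a_def)
    finally show "(\<integral>\<^sup>+w. ennreal (cosh (h * sqrt (sq (Suc n) (z(n := w))))) \<partial>P)
      \<le> ennreal m * ennreal (cosh (h * sqrt (sq n z)))" .
  qed
  also have "\<dots> = ennreal m * (\<integral>\<^sup>+z. ennreal (cosh (h * sqrt (sq n z))) \<partial>Pi\<^sub>M {..<n} (\<lambda>_. P))"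
    unfolding cosh_def by (rule nn_integral_cmult) measurable
  also have "\<dots> \<le> ennreal m * ennreal (m ^ n)" by (intro mult_left_mono Suc.IH[folded m_def]) simp
  also have "\<dots> = ennreal (m ^ Suc n)" using m0 by (simp add: ennreal_mult)
  finally show ?case by (simp add: m_def)
qed

lemma chebyshev_tail:
  assumes "n \<ge> 1" "\<epsilon> > 0"
  shows "measure (Pi\<^sub>M {..<n} (\<lambda>_. P)) {z \<in> space (Pi\<^sub>M {..<n} (\<lambda>_. P)). sqrt (sq n z) / real n > \<epsilon>}
      \<le> \<sigma>\<^sup>2 / (real n * \<epsilon>\<^sup>2)"
proof -
  let ?M = "Pi\<^sub>M {..<n} (\<lambda>_. P)"
  interpret pn: prob_space ?M by (rule prob_space_PiM)
  have n: "real n > 0" using assms by simp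
  have c: "c > 0" if "c = 1 / (real n * \<epsilon>)\<^sup>2" for c using n assms that by simp
  define c where "c = 1 / (real n * \<epsilon>)\<^sup>2"
  have "emeasure ?M {z \<in> space ?M. sqrt (sq n z) / real n > \<epsilon>} \<le> emeasure ?M {z \<in> space ?M. 1 \<le> ennreal c * ennreal (sq n z)}"
  proof (rule emeasure_mono)
    show "{z \<in> space ?M. sqrt (sq n z) / real n > \<epsilon>} \<subseteq> {z \<in> space ?M. 1 \<le> ennreal c * ennreal (sq n z)}"
    proof safe
      fix z assume "sqrt (sq n z) / real n > \<epsilon>"
      then have "real n * \<epsilon> < sqrt (sq n z)" using n by (simp add: field_simps)
      then have "(real n * \<epsilon>)\<^sup>2 \<le> (sqrt (sq n z))\<^sup>2" using n assms by (intro power_mono) auto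
      then have "1 \<le> c * sq n z" using n assms sq_nonneg[of n z] by (simp add: c_def field_simps)
      then show "1 \<le> ennreal c * ennreal (sq n z)" using c[OF c_def] by (simp add: ennreal_mult'[symmetric])
    qed
  qed measurable
  also have "\<dots> \<le> ennreal c * (\<integral>\<^sup>+z. ennreal (sq n z) * indicator (space ?M) z \<partial>?M)"
    by (rule nn_integral_Markov_inequality) measurable
  also have "(\<integral>\<^sup>+z. ennreal (sq n z) * indicator (space ?M) z \<partial>?M) = (\<integral>\<^sup>+z. ennreal (sq n z) \<partial>?M)"
    by (intro nn_integral_cong) simp
  also have "ennreal c * \<dots> \<le> ennreal c * ennreal (real n * \<sigma>\<^sup>2)" by (intro mult_left_mono second_moment) simp
  also have "\<dots> = ennreal (\<sigma>\<^sup>2 / (real n * \<epsilon>\<^sup>2))"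
    using c[OF c_def] n by (simp add: ennreal_mult'[symmetric] c_def power_mult_distrib) (simp add: power2_eq_square)
  finally show ?thesis using n assms by (simp add: pn.emeasure_eq_measure)
qed

text \<open>Markov's inequality for \<open>cosh (h * sqrt (sq n z))\<close>; the factor 2 comes from
  \<open>exp x \<le> 2 * cosh x\<close>.\<close>

lemma bernstein_tail:
  assumes "n \<ge> 1" "u > 0"
  shows "measure (Pi\<^sub>M {..<n} (\<lambda>_. P)) {z \<in> space (Pi\<^sub>M {..<n} (\<lambda>_. P)).
            sqrt (sq n z) / real n > sqrt (2 * u) * \<sigma> / sqrt (real n) + L * u / real n}
      \<le> 2 * exp (- u)"
proof -
  let ?M = "Pi\<^sub>M {..<n} (\<lambda>_. P)"
  interpret pn: prob_space ?M by (rule prob_space_PiM)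
  have n: "real n > 0" using assms by simp
  \<comment> \<open>\<open>w\<close> is the optimal parameter for the Gaussian part alone; dividing
    by \<open>1 + L * w\<close> keeps \<open>h * L < 1\<close> and makes the exponent equal to
    \<open>- u\<close> without remainder.\<close>
  define w where "w = sqrt (2 * u / real n) / \<sigma>"
  define h where "h = w / (1 + L * w)"
  define \<epsilon> where "\<epsilon> = sqrt (2 * u) * \<sigma> / sqrt (real n) + L * u / real n"
  have w: "w > 0" using assms n \<sigma> by (simp add: w_def)
  have Lw: "1 + L * w > 0" using w L by (simp add: add_pos_pos)
  have hL: "1 - h * L = 1 / (1 + L * w)" using Lw by (simp add: h_def field_simps)
  have h: "h > 0" "h * L < 1" using w Lw hL by (simp_all add: h_def)
  have w2: "w\<^sup>2 * \<sigma>\<^sup>2 * real n = 2 * u" using assms n \<sigma> by (simp add: w_def power_divide)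
  have ne: "real n * \<epsilon> = w * \<sigma>\<^sup>2 * real n + L * u"
  proof -
    have "w * \<sigma>\<^sup>2 * real n = sqrt (2 * u / real n) * \<sigma> * real n" using \<sigma> by (simp add: w_def power2_eq_square)
    also have "\<dots> = sqrt (2 * u) * \<sigma> / sqrt (real n) * real n" by (simp add: real_sqrt_divide)
    finally show ?thesis using n by (simp add: \<epsilon>_def field_simps)
  qed
  have eps0: "\<epsilon> > 0" using assms n \<sigma> L by (auto simp: \<epsilon>_def intro!: add_pos_pos)
  define m where "m = 1 + h\<^sup>2 * \<sigma>\<^sup>2 / (2 * (1 - h * L))"
  have exponent: "real n * (h\<^sup>2 * \<sigma>\<^sup>2 / (2 * (1 - h * L))) - h * (real n * \<epsilon>) = - u"
  proof -
    have 1: "real n * (h\<^sup>2 * \<sigma>\<^sup>2 / (2 * (1 - h * L))) = u / (1 + L * w)"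
    proof -
      have "real n * (h\<^sup>2 * \<sigma>\<^sup>2 / (2 * (1 - h * L))) = (w\<^sup>2 * \<sigma>\<^sup>2 * real n) / (2 * (1 + L * w))"
      proof -
        have "real n * ((w / d)\<^sup>2 * \<sigma>\<^sup>2 / (2 * (1 / d))) = (w\<^sup>2 * \<sigma>\<^sup>2 * real n) / (2 * d)" if "d > 0" for d
          using that by (simp add: power2_eq_square field_simps)
        from this[OF Lw] show ?thesis unfolding hL unfolding h_def .
      qed
      also have "\<dots> = u / (1 + L * w)"
        unfolding w2 by (rule mult_divide_mult_cancel_left) simp
      finally show ?thesis .
    qed
    have 2: "h * (real n * \<epsilon>) = (2 * u + L * w * u) / (1 + L * w)"
    proof -
      have "h * (real n * \<epsilon>) = (w\<^sup>2 * \<sigma>\<^sup>2 * real n + L * w * u) / (1 + L * w)"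
        unfolding ne h_def by (simp add: power2_eq_square add_divide_distrib algebra_simps)
      then show ?thesis unfolding w2 .
    qed
    have "u / (1 + L * w) - (2 * u + L * w * u) / (1 + L * w) = (- u * (1 + L * w)) / (1 + L * w)"
      by (simp add: diff_divide_distrib[symmetric] algebra_simps)
    also have "\<dots> = - u" using Lw by simp
    finally show ?thesis unfolding 1 2 .
  qed
  define c where "c = 1 / cosh (h * (real n * \<epsilon>))"
  have c0: "c > 0" by (simp add: c_def)
  have "emeasure ?M {z \<in> space ?M. sqrt (sq n z) / real n > \<epsilon>}
     \<le> emeasure ?M {z \<in> space ?M. 1 \<le> ennreal c * ennreal (cosh (h * sqrt (sq n z)))}"
  proof (rule emeasure_mono)
    show "{z \<in> space ?M. sqrt (sq n z) / real n > \<epsilon>} \<subseteq> {z \<in> space ?M. 1 \<le> ennreal c * ennreal (cosh (h * sqrt (sq n z)))}"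
    proof safe
      fix z assume "sqrt (sq n z) / real n > \<epsilon>"
      then have "real n * \<epsilon> \<le> sqrt (sq n z)" using n by (simp add: field_simps)
      then have "h * (real n * \<epsilon>) \<le> h * sqrt (sq n z)" using h by simp
      then have "cosh (h * (real n * \<epsilon>)) \<le> cosh (h * sqrt (sq n z))"
        using h n eps0 sq_nonneg by (subst cosh_real_nonneg_le_iff) auto
      then have "1 \<le> c * cosh (h * sqrt (sq n z))" by (simp add: c_def)
      then show "1 \<le> ennreal c * ennreal (cosh (h * sqrt (sq n z)))" using c0 by (simp add: ennreal_mult'[symmetric])
    qed
  next
    show "{z \<in> space ?M. 1 \<le> ennreal c * ennreal (cosh (h * sqrt (sq n z)))} \<in> sets ?M" unfolding cosh_def by measurable
  qed
  also have "\<dots> \<le> ennreal c * (\<integral>\<^sup>+z. ennreal (cosh (h * sqrt (sq n z))) * indicator (space ?M) z \<partial>?M)"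
    unfolding cosh_def by (rule nn_integral_Markov_inequality) measurable
  also have "(\<integral>\<^sup>+z. ennreal (cosh (h * sqrt (sq n z))) * indicator (space ?M) z \<partial>?M) = (\<integral>\<^sup>+z. ennreal (cosh (h * sqrt (sq n z))) \<partial>?M)"
    by (intro nn_integral_cong) simp
  also have "ennreal c * \<dots> \<le> ennreal c * ennreal (m ^ n)"
    unfolding m_def by (intro mult_left_mono exponential_moment h) simp
  also have "\<dots> = ennreal (c * m ^ n)" using c0 by (simp add: ennreal_mult')
  also have "\<dots> \<le> ennreal (2 * exp (- u))"
  proof (rule ennreal_leI)
    have "m \<le> exp (h\<^sup>2 * \<sigma>\<^sup>2 / (2 * (1 - h * L)))" unfolding m_def by (rule exp_ge_add_one_self)
    then have "m ^ n \<le> exp (h\<^sup>2 * \<sigma>\<^sup>2 / (2 * (1 - h * L))) ^ n"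
      using h by (intro power_mono) (auto simp: m_def)
    also have "\<dots> = exp (real n * (h\<^sup>2 * \<sigma>\<^sup>2 / (2 * (1 - h * L))))" by (rule exp_of_nat_mult[symmetric])
    finally have 1: "m ^ n \<le> exp (real n * (h\<^sup>2 * \<sigma>\<^sup>2 / (2 * (1 - h * L))))" .
    have "exp (h * (real n * \<epsilon>)) \<le> 2 * cosh (h * (real n * \<epsilon>))" by (simp add: cosh_def)
    then have 2: "c \<le> 2 * exp (- (h * (real n * \<epsilon>)))"
      by (simp add: c_def exp_minus field_simps)
    have "c * m ^ n \<le> (2 * exp (- (h * (real n * \<epsilon>)))) * exp (real n * (h\<^sup>2 * \<sigma>\<^sup>2 / (2 * (1 - h * L))))"
      by (rule mult_mono[OF 2 1]) (use h in \<open>auto simp: m_def\<close>)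
    also have "\<dots> = 2 * exp (real n * (h\<^sup>2 * \<sigma>\<^sup>2 / (2 * (1 - h * L))) - h * (real n * \<epsilon>))"
      by (simp add: exp_diff exp_minus field_simps)
    finally show "c * m ^ n \<le> 2 * exp (- u)" unfolding exponent .
  qed
  finally show ?thesis by (simp add: \<epsilon>_def pn.emeasure_eq_measure)
qed

lemma deviation_tail:
  assumes "n \<ge> 1" "t > 0" "c \<ge> 2"
  shows "measure (Pi\<^sub>M {..<n} (\<lambda>_. P)) {z \<in> space (Pi\<^sub>M {..<n} (\<lambda>_. P)).
            sqrt (sq n z) / real n > c * t * (L / real n + \<sigma> / sqrt (real n))} \<le> tail_level c t"
proof -
  let ?M = "Pi\<^sub>M {..<n} (\<lambda>_. P)"
  interpret pn: prob_space ?M by (rule prob_space_PiM)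
  have n: "real n > 0" using assms by simp
  show ?thesis
  proof (cases "t \<ge> 1")
    case True
    \<comment> \<open>The shift by \<open>ln 2\<close> pays for the factor 2 in Bernstein's bound.
      For \<open>t \<ge> 1\<close> both \<open>u\<close> and \<open>sqrt (2 * u)\<close> are at most
      \<open>2 * t\<close>, which is why \<open>c \<ge> 2\<close> suffices.\<close>
    define u where "u = t + ln 2"
    have ln2: "0 < ln (2::real)" "ln (2::real) < 1" using ln_2_less_1 by simp_all
    have u: "u > 0" "u \<le> 2 * t" using True ln2 unfolding u_def by linarith+
    have "2 * u \<le> (2 * t)\<^sup>2" using u True by (simp add: power2_eq_square) (smt (verit) mult_le_cancel_right1)
    then have su: "sqrt (2 * u) \<le> 2 * t" using True by (intro real_le_lsqrt) auto
    have "sqrt (2 * u) * \<sigma> / sqrt (real n) + L * u / real n \<le> c * t * (\<sigma> / sqrt (real n)) + c * t * (L / real n)"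
    proof (rule add_mono)
      have ct: "2 * t \<le> c * t" using assms True by (intro mult_right_mono) auto
      have "sqrt (2 * u) * (\<sigma> / sqrt (real n)) \<le> c * t * (\<sigma> / sqrt (real n))"
        using su ct \<sigma> by (intro mult_right_mono) auto
      then show "sqrt (2 * u) * \<sigma> / sqrt (real n) \<le> c * t * (\<sigma> / sqrt (real n))" by simp
      have "u * (L / real n) \<le> c * t * (L / real n)" using order.trans[OF u(2) ct] L by (intro mult_right_mono) auto
      then show "L * u / real n \<le> c * t * (L / real n)" by (simp add: mult.commute)
    qed
    then have "measure ?M {z \<in> space ?M. sqrt (sq n z) / real n > c * t * (L / real n + \<sigma> / sqrt (real n))}
      \<le> measure ?M {z \<in> space ?M. sqrt (sq n z) / real n > sqrt (2 * u) * \<sigma> / sqrt (real n) + L * u / real n}"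
      by (intro pn.finite_measure_mono) (auto simp: distrib_left add.commute)
    also have "\<dots> \<le> 2 * exp (- u)" by (rule bernstein_tail[OF assms(1) u(1)])
    also have "\<dots> = exp (- t)" by (simp add: u_def exp_diff exp_minus exp_add)
    finally show ?thesis using True by (simp add: tail_level_def)
  next
    case False
    have e: "c * t * (\<sigma> / sqrt (real n)) > 0" using assms \<sigma> n by simp
    \<comment> \<open>For small \<open>t\<close> the threshold is lowered to its variance part, the
      one that Chebyshev handles.\<close>
    have "measure ?M {z \<in> space ?M. sqrt (sq n z) / real n > c * t * (L / real n + \<sigma> / sqrt (real n))}
      \<le> measure ?M {z \<in> space ?M. sqrt (sq n z) / real n > c * t * (\<sigma> / sqrt (real n))}"
    proof (rule pn.finite_measure_mono)
      have "0 \<le> c * t * (L / real n)" using assms L by simp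
      then have "c * t * (\<sigma> / sqrt (real n)) \<le> c * t * (L / real n + \<sigma> / sqrt (real n))" by (simp add: distrib_left)
      then show "{z \<in> space ?M. sqrt (sq n z) / real n > c * t * (L / real n + \<sigma> / sqrt (real n))}
        \<subseteq> {z \<in> space ?M. sqrt (sq n z) / real n > c * t * (\<sigma> / sqrt (real n))}" by force
    qed measurable
    also have "\<dots> \<le> \<sigma>\<^sup>2 / (real n * (c * t * (\<sigma> / sqrt (real n)))\<^sup>2)" by (rule chebyshev_tail[OF assms(1) e])
    also have "\<dots> = 1 / (c * t)\<^sup>2" using n \<sigma> by (simp add: power_mult_distrib power_divide)
    finally show ?thesis using False by (simp add: tail_level_def)
  qed
qed

end

text \<open>Here \<open>L\<close> and \<open>\<sigma>\<close> may vanish, for instance when the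
  effective dimension is 0. Both are enlarged by \<open>1 / Suc k\<close>; the events for the
  enlarged levels increase to the event in question, and continuity from below preserves the
  bound.\<close>

lemma semi_inner_deviation_tail:
  fixes S :: "'v::real_vector set" and P :: "'z measure" and \<xi> :: "'z \<Rightarrow> 'v"
  assumes ip: "semi_inner_space S ip" and P: "prob_space P" and in_S: "\<And>z. \<xi> z \<in> S"
    and meas: "(\<lambda>(z, w). ip (\<xi> z) (\<xi> w)) \<in> borel_measurable (P \<Otimes>\<^sub>M P)"
    and centered: "\<And>z. z \<in> space P \<Longrightarrow> (\<integral>w. ip (\<xi> z) (\<xi> w) \<partial>P) = 0"
    and L: "L \<ge> 0" and \<sigma>: "\<sigma> \<ge> 0"
    and bound: "AE z in P. ip (\<xi> z) (\<xi> z) \<le> L\<^sup>2"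
    and variance: "(\<integral>z. ip (\<xi> z) (\<xi> z) \<partial>P) \<le> \<sigma>\<^sup>2"
    and n: "n \<ge> 1" and t: "t > 0" and c: "c \<ge> 2"
  defines "d \<equiv> \<lambda>z. sqrt (ip (\<Sum>i<n. \<xi> (z i)) (\<Sum>i<n. \<xi> (z i))) / real n"
  shows "{z \<in> space (Pi\<^sub>M {..<n} (\<lambda>_. P)). d z > c * t * (L / real n + \<sigma> / sqrt (real n))} \<in> sets (Pi\<^sub>M {..<n} (\<lambda>_. P))"
    and "measure (Pi\<^sub>M {..<n} (\<lambda>_. P)) {z \<in> space (Pi\<^sub>M {..<n} (\<lambda>_. P)). d z > c * t * (L / real n + \<sigma> / sqrt (real n))}
      \<le> tail_level c t"
proof -
  let ?M = "Pi\<^sub>M {..<n} (\<lambda>_. P)"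
  interpret pn: prob_space ?M by (rule prob_space_PiM) (rule P)
  define \<epsilon> where "\<epsilon> k = c * t * ((L + 1 / real (Suc k)) / real n + (\<sigma> + 1 / real (Suc k)) / sqrt (real n))" for k
  define \<epsilon>0 where "\<epsilon>0 = c * t * (L / real n + \<sigma> / sqrt (real n))"
  have n0: "real n > 0" using n by simp
  have iid: "iid_vectors S ip P \<xi> (L + 1 / real (Suc k)) (\<sigma> + 1 / real (Suc k))" for k
  proof (intro iid_vectors.intro iid_vectors_axioms.intro ip P in_S meas centered)
    have e: "1 / real (Suc k) > 0" by simp
    show "L + 1 / real (Suc k) > 0" "\<sigma> + 1 / real (Suc k) > 0" using L \<sigma> e by linarith+
    have "L\<^sup>2 \<le> (L + 1 / real (Suc k))\<^sup>2" "\<sigma>\<^sup>2 \<le> (\<sigma> + 1 / real (Suc k))\<^sup>2" using L \<sigma> by (simp_all add: power_mono)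
    then show "AE z in P. ip (\<xi> z) (\<xi> z) \<le> (L + 1 / real (Suc k))\<^sup>2"
      "(\<integral>z. ip (\<xi> z) (\<xi> z) \<partial>P) \<le> (\<sigma> + 1 / real (Suc k))\<^sup>2" using bound variance by auto
  qed
  have d_eq: "sqrt (iid_vectors.sq ip \<xi> n z) / real n = d z" for z
    by (simp add: d_def iid_vectors.sq_def[OF iid] iid_vectors.total_def[OF iid])
  have dm [measurable]: "d \<in> borel_measurable ?M"
    using iid_vectors.sq_measurable[OF iid, of n] unfolding d_eq[abs_def, symmetric] by measurable
  show "{z \<in> space ?M. d z > c * t * (L / real n + \<sigma> / sqrt (real n))} \<in> sets ?M" by measurable
  define A where "A k = {z \<in> space ?M. d z > \<epsilon> k}" for k
  have dec: "\<epsilon> (Suc k) \<le> \<epsilon> k" for k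
  proof -
    have "1 / real (Suc (Suc k)) \<le> 1 / real (Suc k)" by (simp add: frac_le)
    then show ?thesis unfolding \<epsilon>_def using c t n0
      by (intro mult_left_mono add_mono divide_right_mono) auto
  qed
  have lim: "\<epsilon> \<longlonglongrightarrow> \<epsilon>0"
  proof -
    have "(\<lambda>k. 1 / real (Suc k)) \<longlonglongrightarrow> 0" by (rule LIMSEQ_Suc[OF lim_1_over_n])
    then have "\<epsilon> \<longlonglongrightarrow> c * t * ((L + 0) / real n + (\<sigma> + 0) / sqrt (real n))"
      unfolding \<epsilon>_def by (intro tendsto_intros) (use n0 in auto)
    then show ?thesis by (simp add: \<epsilon>0_def)
  qed
  have \<epsilon>_ge: "\<epsilon>0 \<le> \<epsilon> k" for k
  proof -
    have "decseq \<epsilon>" by (rule decseq_SucI) (rule dec)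
    then show ?thesis using lim by (rule decseq_ge)
  qed
  have "(\<lambda>k. pn.prob (A k)) \<longlonglongrightarrow> pn.prob (\<Union>k. A k)"
  proof (rule pn.finite_Lim_measure_incseq)
    show "range A \<subseteq> sets ?M" unfolding A_def by auto
    show "incseq A" unfolding A_def using dec by (intro incseq_SucI) (auto intro: order.strict_trans1)
  qed
  moreover have "(\<Union>k. A k) = {z \<in> space ?M. d z > \<epsilon>0}"
  proof safe
    fix z assume "z \<in> space ?M" "d z > \<epsilon>0"
    then have "\<forall>\<^sub>F k in sequentially. \<epsilon> k < d z" using lim by (simp add: order_tendstoD(2))
    then obtain k where "\<epsilon> k < d z" by (auto simp: eventually_sequentially)
    with \<open>z \<in> space ?M\<close> show "z \<in> (\<Union>k. A k)" by (auto simp: A_def)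
  next
    fix z k assume "z \<in> A k"
    then show "z \<in> space ?M" "\<epsilon>0 < d z" using \<epsilon>_ge[of k] by (auto simp: A_def)
  qed
  moreover have "pn.prob (A k) \<le> tail_level c t" for k
    using iid_vectors.deviation_tail[OF iid n t c] by (simp add: A_def \<epsilon>_def d_eq)
  ultimately have "pn.prob {z \<in> space ?M. d z > \<epsilon>0} \<le> tail_level c t"
    by (intro LIMSEQ_le_const2) auto
  then show "measure ?M {z \<in> space ?M. d z > c * t * (L / real n + \<sigma> / sqrt (real n))} \<le> tail_level c t"
    by (simp add: \<epsilon>0_def)
qed

text \<open>For \<open>t \<ge> 1\<close> the two tails are \<open>exp (- t)\<close> each. Below 1
  they sum to \<open>(1/4 + 4/25) / t\<^sup>2\<close>, and
  \<open>41/200 * exp t \<le> t\<^sup>2\<close> is checked on two intervals, split at 3/4.\<close>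

lemma tail_level_union:
  assumes "t \<ge> ln 2"
  shows "tail_level 2 t + tail_level (5 / 2) t \<le> 2 * exp (- t)"
proof (cases "t \<ge> 1")
  case False
  have t23: "t \<ge> 2 / 3" using assms ln2_ge_two_thirds by simp
  have e3: "exp (3::real) \<le> (272 / 100) ^ 3"
  proof -
    have "exp (3::real) = exp 1 ^ 3" by (simp add: exp_of_nat_mult[symmetric])
    also have "\<dots> \<le> (272 / 100) ^ 3" using e_less_272 by (intro power_mono) auto
    finally show ?thesis .
  qed
  have "41 / 200 * exp t \<le> t\<^sup>2"
  proof (cases "t \<le> 3 / 4")
    case True
    \<comment> \<open>\<open>exp (3/4)\<close> is estimated through its fourth power. The margin is
      thin: \<open>41/200 * 2.16 = 0.4428\<close> against \<open>(2/3)\<^sup>2\<close>.\<close>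
    have "exp t \<le> 216 / 100"
    proof (rule power_le_imp_le_base)
      have "exp t ^ Suc 3 = exp (4 * t)" by (simp add: exp_of_nat_mult[symmetric])
      also have "\<dots> \<le> exp 3" using True by simp
      also have "\<dots> \<le> (216 / 100) ^ Suc 3" by (rule order.trans[OF e3]) (simp add: power_divide)
      finally show "exp t ^ Suc 3 \<le> (216 / 100) ^ Suc 3" .
    qed simp
    moreover have "(2 / 3)\<^sup>2 \<le> t\<^sup>2" using t23 by (intro power_mono) auto
    ultimately show ?thesis by (simp add: power_divide)
  next
    case 2: False
    have "exp t \<le> exp 1" using False by simp
    then have "exp t \<le> 272 / 100" using e_less_272 by linarith
    moreover have "(3 / 4)\<^sup>2 \<le> t\<^sup>2" using 2 by (intro power_mono) auto
    ultimately show ?thesis by (simp add: power_divide)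
  qed
  then have "41 / 100 / t\<^sup>2 \<le> 2 * exp (- t)"
    using t23 by (simp add: exp_minus field_simps)
  moreover have "tail_level 2 t + tail_level (5 / 2) t = 41 / 100 / t\<^sup>2"
    using False by (simp add: tail_level_def power_mult_distrib power_divide)
  ultimately show ?thesis by simp
qed (simp add: tail_level_def)

section \<open>Covariance operators\<close>

lemma (in finite_measure) sums_integral_bounded:
  fixes f :: "nat \<Rightarrow> 'a \<Rightarrow> real"
  assumes meas: "\<And>n. f n \<in> borel_measurable M"
    and sums: "\<And>x. x \<in> space M \<Longrightarrow> (\<lambda>n. f n x) sums s x"
    and bound: "\<And>x N. x \<in> space M \<Longrightarrow> \<bar>\<Sum>n<N. f n x\<bar> \<le> K"
    and int: "\<And>n. integrable M (f n)"
  shows "(\<lambda>n. \<integral>x. f n x \<partial>M) sums (\<integral>x. s x \<partial>M)"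
proof -
  have "s \<in> borel_measurable M"
    by (rule borel_measurable_LIMSEQ_metric[where f = "\<lambda>N x. \<Sum>n<N. f n x"])
      (use meas sums in \<open>auto simp: sums_def\<close>)
  then have "(\<lambda>N. \<integral>x. (\<Sum>n<N. f n x) \<partial>M) \<longlonglongrightarrow> (\<integral>x. s x \<partial>M)"
    by (intro integral_dominated_convergence[where w = "\<lambda>_. K"])
      (use meas sums bound in \<open>auto simp: sums_def\<close>)
  then show ?thesis unfolding sums_def by (simp add: int)
qed

lemma abs_prod_le_half_squares: "\<bar>a * b\<bar> \<le> (a\<^sup>2 + b\<^sup>2) / (2::real)"
proof -
  have "0 \<le> (\<bar>a\<bar> - \<bar>b\<bar>)\<^sup>2" by simp
  also have "\<dots> = a\<^sup>2 + b\<^sup>2 - 2 * \<bar>a * b\<bar>" by (simp add: power2_diff abs_mult)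
  finally show ?thesis by simp
qed

text \<open>A bound uniform in \<open>N\<close>, so that Parseval expansions may be integrated term
  by term.\<close>

lemma parseval_partial_sum_le:
  fixes u v :: "'a::{real_inner,banach,second_countable_topology}"
  shows "\<bar>\<Sum>n<N. (u \<bullet> onb_seq n) * (onb_seq n \<bullet> v)\<bar> \<le> ((norm u)\<^sup>2 + (norm v)\<^sup>2) / 2"
proof -
  have le: "(\<Sum>n<N. (w \<bullet> onb_seq n)\<^sup>2) \<le> (norm w)\<^sup>2" for w :: 'a
    using sum_le_suminf[of "\<lambda>n. (w \<bullet> onb_seq n)\<^sup>2" "{..<N}"] onb_seq_norm[of w] by (auto simp: sums_iff)
  have "\<bar>\<Sum>n<N. (u \<bullet> onb_seq n) * (onb_seq n \<bullet> v)\<bar> \<le> (\<Sum>n<N. \<bar>(u \<bullet> onb_seq n) * (onb_seq n \<bullet> v)\<bar>)"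
    by (rule sum_abs)
  also have "\<dots> \<le> (\<Sum>n<N. ((u \<bullet> onb_seq n)\<^sup>2 + (v \<bullet> onb_seq n)\<^sup>2) / 2)"
    using abs_prod_le_half_squares by (intro sum_mono) (metis inner_commute)
  also have "\<dots> = ((\<Sum>n<N. (u \<bullet> onb_seq n)\<^sup>2) + (\<Sum>n<N. (v \<bullet> onb_seq n)\<^sup>2)) / 2"
    by (simp add: sum.distrib sum_divide_distrib[symmetric])
  also have "\<dots> \<le> ((norm u)\<^sup>2 + (norm v)\<^sup>2) / 2" using le[of u] le[of v] by simp
  finally show ?thesis .
qed

locale feature_measure = prob_space M
  for M :: "'x::topological_space measure" +
  fixes \<phi> :: "'x \<Rightarrow> 'h::{real_inner,banach,second_countable_topology}" and \<kappa> :: real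
  assumes sets_M: "sets M = sets borel" and \<phi>_meas: "\<phi> \<in> borel_measurable borel"
    and \<phi>_bound: "norm (\<phi> x) \<le> \<kappa>"
begin

abbreviation C :: "'h \<Rightarrow>\<^sub>L 'h" where "C \<equiv> cov_op M \<phi>"

lemma \<kappa>_nonneg: "\<kappa> \<ge> 0"
  using \<phi>_bound[of undefined] norm_ge_zero order.trans by blast

lemma \<phi>_measurable [measurable]: "\<phi> \<in> borel_measurable M"
  using \<phi>_meas by (simp add: measurable_cong_sets[OF sets_M refl])

lemma inner_\<phi>_bound: "\<bar>v \<bullet> \<phi> x\<bar> \<le> norm v * \<kappa>"
  by (rule order.trans[OF Cauchy_Schwarz_ineq2]) (simp add: mult_left_mono \<phi>_bound)

lemma integrable_bounded_real:
  fixes f :: "'x \<Rightarrow> real"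
  assumes "f \<in> borel_measurable M" "\<And>x. \<bar>f x\<bar> \<le> K"
  shows "integrable M f"
  by (rule integrable_const_bound[where B = K]) (use assms in auto)

lemma integrable_inner_prod: "integrable M (\<lambda>x. (u \<bullet> \<phi> x) * (v \<bullet> \<phi> x))"
proof (rule integrable_bounded_real[where K = "(norm u * \<kappa>) * (norm v * \<kappa>)"])
  show "\<bar>(u \<bullet> \<phi> x) * (v \<bullet> \<phi> x)\<bar> \<le> norm u * \<kappa> * (norm v * \<kappa>)" for x
    unfolding abs_mult using inner_\<phi>_bound \<kappa>_nonneg by (intro mult_mono) auto
qed measurable

lemma cov_integrable: "integrable M (\<lambda>x. (v \<bullet> \<phi> x) *\<^sub>R \<phi> x)"
proof (rule integrable_const_bound[where B = "(norm v * \<kappa>) * \<kappa>"])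
  show "AE x in M. norm ((v \<bullet> \<phi> x) *\<^sub>R \<phi> x) \<le> norm v * \<kappa> * \<kappa>"
    using inner_\<phi>_bound \<phi>_bound \<kappa>_nonneg by (auto intro!: AE_I2 mult_mono)
qed measurable

lemma C_apply: "C v = (\<integral>x. (v \<bullet> \<phi> x) *\<^sub>R \<phi> x \<partial>M)"
proof -
  have "bounded_linear (\<lambda>v. \<integral>x. (v \<bullet> \<phi> x) *\<^sub>R \<phi> x \<partial>M)"
  proof (rule bounded_linear_intro)
    show "(\<integral>x. ((u + v) \<bullet> \<phi> x) *\<^sub>R \<phi> x \<partial>M) = (\<integral>x. (u \<bullet> \<phi> x) *\<^sub>R \<phi> x \<partial>M) + (\<integral>x. (v \<bullet> \<phi> x) *\<^sub>R \<phi> x \<partial>M)" for u v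
      by (simp add: inner_add_left scaleR_add_left cov_integrable)
    show "(\<integral>x. ((r *\<^sub>R v) \<bullet> \<phi> x) *\<^sub>R \<phi> x \<partial>M) = r *\<^sub>R (\<integral>x. (v \<bullet> \<phi> x) *\<^sub>R \<phi> x \<partial>M)" for r v
      by (simp flip: scaleR_scaleR)
    show "norm (\<integral>x. (v \<bullet> \<phi> x) *\<^sub>R \<phi> x \<partial>M) \<le> norm v * (\<kappa> * \<kappa>)" for v
    proof -
      have "norm (\<integral>x. (v \<bullet> \<phi> x) *\<^sub>R \<phi> x \<partial>M) \<le> (\<integral>x. norm ((v \<bullet> \<phi> x) *\<^sub>R \<phi> x) \<partial>M)"
        by (rule integral_norm_bound)
      also have "\<dots> \<le> (\<integral>x. (norm v * \<kappa>) * \<kappa> \<partial>M)"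
        using inner_\<phi>_bound \<phi>_bound \<kappa>_nonneg cov_integrable[of v]
        by (intro integral_mono integrable_norm) (auto intro!: mult_mono)
      finally show ?thesis by (simp add: prob_space mult.assoc)
    qed
  qed
  then show ?thesis by (simp add: cov_op_def tensor_op.rep_eq bounded_linear_Blinfun_apply)
qed

lemma C_inner: "C u \<bullet> v = (\<integral>x. (u \<bullet> \<phi> x) * (v \<bullet> \<phi> x) \<partial>M)"
proof -
  have "C u \<bullet> v = (\<integral>x. ((u \<bullet> \<phi> x) *\<^sub>R \<phi> x) \<bullet> v \<partial>M)"
    unfolding C_apply by (rule integral_inner_left[symmetric]) (simp add: cov_integrable)
  then show ?thesis by (simp add: inner_commute)
qed

lemma C_symmetric: "symmetric C"
proof -
  have "C u \<bullet> v = C v \<bullet> u" for u v unfolding C_inner by (simp only: mult.commute)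
  then show ?thesis by (simp add: symmetric_def inner_commute)
qed

lemma C_nonneg: "C v \<bullet> v \<ge> 0"
  by (simp add: C_inner)

lemma C_inner_le: "C v \<bullet> v \<le> (\<kappa> * norm v)\<^sup>2"
proof -
  have "(\<integral>x. (v \<bullet> \<phi> x) * (v \<bullet> \<phi> x) \<partial>M) \<le> (\<integral>x. (\<kappa> * norm v)\<^sup>2 \<partial>M)"
  proof (intro integral_mono integrable_inner_prod)
    fix x
    have "\<bar>v \<bullet> \<phi> x\<bar>\<^sup>2 \<le> (\<kappa> * norm v)\<^sup>2" using inner_\<phi>_bound[of v x] by (intro power_mono) (auto simp: mult.commute)
    then show "(v \<bullet> \<phi> x) * (v \<bullet> \<phi> x) \<le> (\<kappa> * norm v)\<^sup>2" by (simp add: power2_eq_square)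
  qed simp
  then show ?thesis by (simp add: C_inner prob_space)
qed

text \<open>The operator inequality \<open>C C \<le> \<kappa>\<^sup>2 C\<close>, read off from the
  form of \<open>C\<close> at \<open>\<kappa>\<^sup>2 *\<^sub>R v - C v\<close>. Together with the
  finite trace it makes \<open>C\<close> Hilbert-Schmidt.\<close>

lemma norm_C_square_le: "(norm (C v))\<^sup>2 \<le> \<kappa>\<^sup>2 * (C v \<bullet> v)"
proof -
  let ?w = "C v"
  let ?c = "\<kappa>\<^sup>2 *\<^sub>R v - ?w"
  have "0 \<le> C ?c \<bullet> ?c" by (rule C_nonneg)
  also have "\<dots> = \<kappa>\<^sup>2 * \<kappa>\<^sup>2 * (C v \<bullet> v) - 2 * \<kappa>\<^sup>2 * (norm ?w)\<^sup>2 + C ?w \<bullet> ?w"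
    using symmetricD[OF C_symmetric, of ?w v]
    by (simp add: blinfun.diff_right blinfun.scaleR_right inner_diff_left inner_diff_right power2_norm_eq_inner
        inner_commute algebra_simps)
  also have "\<dots> \<le> \<kappa>\<^sup>2 * \<kappa>\<^sup>2 * (C v \<bullet> v) - 2 * \<kappa>\<^sup>2 * (norm ?w)\<^sup>2 + (\<kappa> * norm ?w)\<^sup>2"
    using C_inner_le[of ?w] by simp
  finally have *: "\<kappa>\<^sup>2 * (norm ?w)\<^sup>2 \<le> \<kappa>\<^sup>2 * (\<kappa>\<^sup>2 * (C v \<bullet> v))" by (simp add: power_mult_distrib)
  show ?thesis
  proof (cases "\<kappa> = 0")
    case True
    \<comment> \<open>For \<open>\<kappa> = 0\<close> the factor cannot be cancelled, but then the
      feature map vanishes.\<close>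
    then have "\<phi> x = 0" for x using \<phi>_bound[of x] by simp
    then have "C v = 0" by (simp add: C_apply)
    then show ?thesis by simp
  next
    case False
    then show ?thesis by (intro mult_left_le_imp_le[OF *]) simp
  qed
qed

lemma norm_C_le: "norm (C v) \<le> \<kappa>\<^sup>2 * norm v"
proof -
  have "(norm (C v))\<^sup>2 \<le> \<kappa>\<^sup>2 * (\<kappa> * norm v)\<^sup>2"
    using norm_C_square_le[of v] mult_left_mono[OF C_inner_le[of v], of "\<kappa>\<^sup>2"] by simp
  also have "\<dots> = (\<kappa>\<^sup>2 * norm v)\<^sup>2" by (simp add: power_mult_distrib power2_eq_square mult_ac)
  finally show ?thesis by (rule power2_le_imp_le) simp
qed

text \<open>Parseval under the integral sign. It is applied to \<open>adj B (\<phi> x)\<close> and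
  \<open>\<phi> x\<close>, because moving \<open>B\<close> off the basis vector is what brings the
  integrand into Parseval form.\<close>

lemma trace_sums:
  fixes B :: "'h \<Rightarrow>\<^sub>L 'h"
  shows "(\<lambda>n. C (B (onb_seq n)) \<bullet> onb_seq n) sums (\<integral>x. B (\<phi> x) \<bullet> \<phi> x \<partial>M)"
proof -
  have "(\<lambda>n. \<integral>x. (adj B (\<phi> x) \<bullet> onb_seq n) * (onb_seq n \<bullet> \<phi> x) \<partial>M) sums (\<integral>x. adj B (\<phi> x) \<bullet> \<phi> x \<partial>M)"
  proof (rule sums_integral_bounded[where K = "((norm (adj B) * \<kappa>)\<^sup>2 + \<kappa>\<^sup>2) / 2"])
    show "(\<lambda>x. adj B (\<phi> x) \<bullet> onb_seq n * (onb_seq n \<bullet> \<phi> x)) \<in> borel_measurable M" for n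
      unfolding adj_inner' by measurable
    show "integrable M (\<lambda>x. adj B (\<phi> x) \<bullet> onb_seq n * (onb_seq n \<bullet> \<phi> x))" for n
      unfolding adj_inner' using integrable_inner_prod[of "B (onb_seq n)" "onb_seq n"] by (simp add: inner_commute)
    show "(\<lambda>n. adj B (\<phi> x) \<bullet> onb_seq n * (onb_seq n \<bullet> \<phi> x)) sums (adj B (\<phi> x) \<bullet> \<phi> x)" for x
      by (rule onb_seq_parseval)
    fix x N
    have "(norm (adj B (\<phi> x)))\<^sup>2 \<le> (norm (adj B) * \<kappa>)\<^sup>2"
      using order.trans[OF norm_blinfun mult_left_mono[OF \<phi>_bound norm_ge_zero]] by (intro power_mono) auto
    moreover have "(norm (\<phi> x))\<^sup>2 \<le> \<kappa>\<^sup>2" using \<phi>_bound by (intro power_mono) auto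
    ultimately show "\<bar>\<Sum>n<N. adj B (\<phi> x) \<bullet> onb_seq n * (onb_seq n \<bullet> \<phi> x)\<bar> \<le> ((norm (adj B) * \<kappa>)\<^sup>2 + \<kappa>\<^sup>2) / 2"
      using parseval_partial_sum_le[where u = "adj B (\<phi> x)" and v = "\<phi> x" and N = N] by simp
  qed
  moreover have "(\<integral>x. (adj B (\<phi> x) \<bullet> onb_seq n) * (onb_seq n \<bullet> \<phi> x) \<partial>M) = C (B (onb_seq n)) \<bullet> onb_seq n" for n
    unfolding C_inner adj_inner' by (simp only: inner_commute)
  moreover have "adj B (\<phi> x) \<bullet> \<phi> x = B (\<phi> x) \<bullet> \<phi> x" for x by (metis adj_inner' inner_commute)
  ultimately show ?thesis by simp
qed

lemma C_hilbert_schmidt: "summable (\<lambda>n. (norm (C (onb_seq n)))\<^sup>2)"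
proof (rule summable_comparison_test')
  show "summable (\<lambda>n. \<kappa>\<^sup>2 * (C (onb_seq n) \<bullet> onb_seq n))"
    using trace_sums[of id_blinfun] by (intro summable_mult) (auto simp: sums_iff)
  show "norm ((norm (C (onb_seq n)))\<^sup>2) \<le> \<kappa>\<^sup>2 * (C (onb_seq n) \<bullet> onb_seq n)" for n
    using norm_C_square_le by simp
qed

lemma shifted: "lam > 0 \<Longrightarrow> shifted_operator C lam"
  by unfold_locales (auto simp: C_symmetric C_nonneg)

text \<open>The effective dimension is the mean squared length of the feature map in the form of the
  resolvent, hence the variance in the concentration bounds.\<close>

lemma effective_dim_eq:
  assumes "lam > 0"
  shows "effective_dim C lam = (\<integral>x. resolvent C lam (\<phi> x) \<bullet> \<phi> x \<partial>M)"
proof -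
  interpret shifted_operator C lam by (rule shifted[OF assms])
  show ?thesis unfolding effective_dim_def T_eq R_eq[symmetric]
  proof (rule op_trace_eqI)
    show "(\<lambda>n. (C \<circ> R) (onb_seq n) \<bullet> onb_seq n) sums (\<integral>x. R (\<phi> x) \<bullet> \<phi> x \<partial>M)"
      using trace_sums[of R] by simp
    fix e
    \<comment> \<open>\<open>C R = 1 - lam R\<close> is nonnegative because the form of
      \<open>R\<close> is at most \<open>1 / lam\<close> times the squared norm.\<close>
    have "lam * (R e \<bullet> e) \<le> e \<bullet> e"
      using R_inner_le[of e] lam by (simp add: power2_norm_eq_inner field_simps)
    moreover have "C (R e) = e - lam *\<^sub>R R e" using T_R[of e] by (simp add: T_def algebra_simps)
    ultimately show "(C \<circ> R) e \<bullet> e \<ge> 0" by (simp add: inner_diff_left)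
  qed
qed

text \<open>The bridge from the risk to quadratic forms: expand the values of \<open>A\<close> in
  the basis of the output space and move \<open>A\<close> onto the basis vectors.\<close>

lemma L2_sums:
  fixes A :: "'h \<Rightarrow>\<^sub>L 'y::{real_inner,banach,second_countable_topology}"
  shows "(\<lambda>n. C (adj A (onb_seq n)) \<bullet> adj A (onb_seq n)) sums (\<integral>x. (norm (A (\<phi> x)))\<^sup>2 \<partial>M)"
proof -
  have "(\<lambda>n. \<integral>x. (A (\<phi> x) \<bullet> onb_seq n)\<^sup>2 \<partial>M) sums (\<integral>x. (norm (A (\<phi> x)))\<^sup>2 \<partial>M)"
  proof (rule sums_integral_bounded[where K = "(norm A * \<kappa>)\<^sup>2"])
    show "(\<lambda>x. (A (\<phi> x) \<bullet> onb_seq n)\<^sup>2) \<in> borel_measurable M" for n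
      unfolding adj_inner by measurable
    show "integrable M (\<lambda>x. (A (\<phi> x) \<bullet> onb_seq n)\<^sup>2)" for n
      unfolding adj_inner power2_eq_square
      using integrable_inner_prod[of "adj A (onb_seq n)" "adj A (onb_seq n)"] by (simp add: inner_commute)
    show "(\<lambda>n. (A (\<phi> x) \<bullet> onb_seq n)\<^sup>2) sums (norm (A (\<phi> x)))\<^sup>2" for x by (rule onb_seq_norm)
    fix x N
    have "\<bar>\<Sum>n<N. (A (\<phi> x) \<bullet> onb_seq n)\<^sup>2\<bar> = (\<Sum>n<N. (A (\<phi> x) \<bullet> onb_seq n)\<^sup>2)" by (simp add: sum_nonneg)
    also have "\<dots> \<le> (norm (A (\<phi> x)))\<^sup>2"
      using sum_le_suminf[of "\<lambda>n. (A (\<phi> x) \<bullet> onb_seq n)\<^sup>2" "{..<N}"] onb_seq_norm[of "A (\<phi> x)"]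
      by (auto simp: sums_iff)
    also have "\<dots> \<le> (norm A * \<kappa>)\<^sup>2"
      using order.trans[OF norm_blinfun mult_left_mono[OF \<phi>_bound norm_ge_zero]] by (intro power_mono) auto
    finally show "\<bar>\<Sum>n<N. (A (\<phi> x) \<bullet> onb_seq n)\<^sup>2\<bar> \<le> (norm A * \<kappa>)\<^sup>2" .
  qed
  moreover have "(\<integral>x. (A (\<phi> x) \<bullet> onb_seq n)\<^sup>2 \<partial>M) = C (adj A (onb_seq n)) \<bullet> adj A (onb_seq n)" for n
  proof -
    have "(A (\<phi> x) \<bullet> onb_seq n)\<^sup>2 = (adj A (onb_seq n) \<bullet> \<phi> x) * (adj A (onb_seq n) \<bullet> \<phi> x)" for x
      unfolding power2_eq_square adj_inner' by (simp only: inner_commute)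
    then show ?thesis unfolding C_inner by simp
  qed
  ultimately show ?thesis by simp
qed

end

section \<open>A weighted inner product of Hilbert--Schmidt operators\<close>

lemma tensor_op_apply: "tensor_op a a' v = (v \<bullet> a') *\<^sub>R a"
  by (simp add: tensor_op.rep_eq)

lemma tensor_op_square_summable:
  fixes a' :: "'b::{real_inner,banach,second_countable_topology}"
  shows "summable (\<lambda>n. (norm (tensor_op a a' (onb_seq n)))\<^sup>2)"
proof -
  have "summable (\<lambda>n. (a' \<bullet> onb_seq n)\<^sup>2 * (norm a)\<^sup>2)"
    using onb_seq_norm[of a'] by (intro summable_mult2) (auto simp: sums_iff)
  then show ?thesis by (simp add: tensor_op_apply power_mult_distrib inner_commute)
qed

text \<open>The condition of \<open>hilbert_schmidt_iff\<close> as a set, since these operators have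
  to form the carrier of a semi-inner product.\<close>

definition hs_space :: "('b::{real_inner,banach,second_countable_topology} \<Rightarrow>\<^sub>L 'a::{real_inner,banach}) set" where
  "hs_space = {A. summable (\<lambda>n. (norm (blinfun_apply A (onb_seq n)))\<^sup>2)}"

text \<open>\<open>weighted_ip W A B\<close> is the trace of \<open>A\<^sup>* W B\<close>.\<close>

definition weighted_ip :: "('a::{real_inner,banach} \<Rightarrow>\<^sub>L 'a) \<Rightarrow>
    ('b::{real_inner,banach,second_countable_topology} \<Rightarrow>\<^sub>L 'a) \<Rightarrow> ('b \<Rightarrow>\<^sub>L 'a) \<Rightarrow> real" where
  "weighted_ip W A B = (\<Sum>n. blinfun_apply A (onb_seq n) \<bullet> blinfun_apply W (blinfun_apply B (onb_seq n)))"

lemma subspace_hs_space: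
  "subspace (hs_space :: ('b::{real_inner,banach,second_countable_topology} \<Rightarrow>\<^sub>L 'a::{real_inner,banach}) set)"
proof (rule subspaceI)
  show "(0 :: 'b \<Rightarrow>\<^sub>L 'a) \<in> hs_space" by (simp add: hs_space_def blinfun.zero_left)
  fix A :: "'b \<Rightarrow>\<^sub>L 'a"
  assume A: "A \<in> hs_space"
  show "c *\<^sub>R A \<in> hs_space" for c
    using summable_mult[of "\<lambda>n. (norm (A (onb_seq n)))\<^sup>2" "c\<^sup>2"] A
    by (simp add: hs_space_def blinfun.scaleR_left power_mult_distrib)
  fix B :: "'b \<Rightarrow>\<^sub>L 'a" assume B: "B \<in> hs_space"
  show "A + B \<in> hs_space" unfolding hs_space_def mem_Collect_eq
  proof (rule summable_comparison_test')
    show "summable (\<lambda>n. 2 * (norm (A (onb_seq n)))\<^sup>2 + 2 * (norm (B (onb_seq n)))\<^sup>2)"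
      using A B unfolding hs_space_def by (intro summable_add summable_mult) auto
    show "norm ((norm ((A + B) (onb_seq n)))\<^sup>2) \<le> 2 * (norm (A (onb_seq n)))\<^sup>2 + 2 * (norm (B (onb_seq n)))\<^sup>2" for n
      using parallelogram_law[of "A (onb_seq n)" "B (onb_seq n)"]
      by (simp add: blinfun.add_left) (smt (verit) zero_le_power2)
  qed
qed

lemma tensor_op_hs: "tensor_op a a' \<in> hs_space"
  by (simp add: hs_space_def tensor_op_square_summable)

context shifted_operator
begin

lemma weighted_ip_summable:
  fixes A B :: "'b::{real_inner,banach,second_countable_topology} \<Rightarrow>\<^sub>L 'a"
  assumes "A \<in> hs_space" "B \<in> hs_space"
  shows "summable (\<lambda>n. A (onb_seq n) \<bullet> R (B (onb_seq n)))"
proof (rule summable_comparison_test')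
  show "summable (\<lambda>n. ((norm (A (onb_seq n)))\<^sup>2 + (norm (B (onb_seq n)))\<^sup>2 / lam\<^sup>2) / 2)"
    using assms unfolding hs_space_def by (intro summable_divide summable_add) auto
  fix n
  have "norm (A (onb_seq n) \<bullet> R (B (onb_seq n))) \<le> norm (A (onb_seq n)) * norm (R (B (onb_seq n)))"
    using Cauchy_Schwarz_ineq2 by simp
  also have "\<dots> \<le> norm (A (onb_seq n)) * (norm (B (onb_seq n)) / lam)" by (intro mult_left_mono R_norm) simp
  also have "\<dots> \<le> ((norm (A (onb_seq n)))\<^sup>2 + (norm (B (onb_seq n)))\<^sup>2 / lam\<^sup>2) / 2"
    using abs_prod_le_half_squares[of "norm (A (onb_seq n))" "norm (B (onb_seq n)) / lam"] lam
    by (simp add: power_divide)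
  finally show "norm (A (onb_seq n) \<bullet> R (B (onb_seq n))) \<le> ((norm (A (onb_seq n)))\<^sup>2 + (norm (B (onb_seq n)))\<^sup>2 / lam\<^sup>2) / 2" .
qed

lemma weighted_ip_semi_inner:
  "semi_inner_space (hs_space :: ('b::{real_inner,banach,second_countable_topology} \<Rightarrow>\<^sub>L 'a) set) (weighted_ip R)"
proof
  show "subspace (hs_space :: ('b \<Rightarrow>\<^sub>L 'a) set)" by (rule subspace_hs_space)
  fix x y z :: "'b \<Rightarrow>\<^sub>L 'a" and c :: real
  assume x: "x \<in> hs_space"
  show "weighted_ip R x x \<ge> 0" unfolding weighted_ip_def
    by (rule suminf_nonneg[OF weighted_ip_summable[OF x x]]) (metis R_inner_nonneg inner_commute)
  { assume z: "z \<in> hs_space"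
    show "weighted_ip R (c *\<^sub>R x) z = c * weighted_ip R x z" unfolding weighted_ip_def
      using weighted_ip_summable[OF x z] by (simp add: blinfun.scaleR_left suminf_mult) }
  assume y: "y \<in> hs_space"
  show "weighted_ip R x y = weighted_ip R y x" unfolding weighted_ip_def
    by (metis R_sym inner_commute)
  assume z: "z \<in> hs_space"
  show "weighted_ip R (x + y) z = weighted_ip R x z + weighted_ip R y z"
    unfolding weighted_ip_def
    using weighted_ip_summable[OF x z] weighted_ip_summable[OF y z]
    by (simp add: blinfun.add_left inner_add_left suminf_add)
qed

text \<open>For a rank-one argument the trace collapses to a scalar by Parseval, so measurability
  and integrals of the samples become elementary.\<close>

lemma weighted_ip_tensor: "weighted_ip R (tensor_op a a') B = R a \<bullet> B a'"
proof -
  have "(\<lambda>n. (a' \<bullet> onb_seq n) * (onb_seq n \<bullet> adj B (R a))) sums (a' \<bullet> adj B (R a))" by (rule onb_seq_parseval)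
  moreover have "(a' \<bullet> onb_seq n) * (onb_seq n \<bullet> adj B (R a)) = tensor_op a a' (onb_seq n) \<bullet> R (B (onb_seq n))" for n
  proof -
    have "a \<bullet> R (B (onb_seq n)) = R a \<bullet> B (onb_seq n)" by (rule R_sym[symmetric])
    moreover have "onb_seq n \<bullet> adj B (R a) = R a \<bullet> B (onb_seq n)"
      by (metis adj_inner inner_commute)
    ultimately show ?thesis by (simp add: tensor_op_apply inner_commute[of a'])
  qed
  moreover have "a' \<bullet> adj B (R a) = R a \<bullet> B a'" by (simp add: adj_inner[symmetric] inner_commute)
  ultimately show ?thesis unfolding weighted_ip_def by (simp add: sums_iff)
qed

text \<open>The weighted norm of \<open>A\<close> is the Hilbert-Schmidt norm of
  \<open>T powr (- 1/2)\<close> times \<open>A\<close>, which dominates the operator norm. Testing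
  with \<open>v\<close> in the energy norm of \<open>T\<close> gives the form required by
  \<open>perturbed_operator\<close>.\<close>

lemma weighted_ip_operator_bound:
  fixes A :: "'b::{real_inner,banach,second_countable_topology} \<Rightarrow>\<^sub>L 'a"
  assumes "A \<in> hs_space"
  shows "\<bar>A u \<bullet> v\<bar> \<le> sqrt (weighted_ip R A A) * norm u * sqrt (T v \<bullet> v)"
proof -
  have "(norm (adj A v))\<^sup>2 \<le> weighted_ip R A A * (T v \<bullet> v)"
  proof (rule sums_le)
    show "(\<lambda>n. (adj A v \<bullet> onb_seq n)\<^sup>2) sums (norm (adj A v))\<^sup>2" by (rule onb_seq_norm)
    show "(\<lambda>n. (A (onb_seq n) \<bullet> R (A (onb_seq n))) * (T v \<bullet> v)) sums (weighted_ip R A A * (T v \<bullet> v))"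
      unfolding weighted_ip_def by (intro sums_mult2 summable_sums weighted_ip_summable assms)
    show "(adj A v \<bullet> onb_seq n)\<^sup>2 \<le> (A (onb_seq n) \<bullet> R (A (onb_seq n))) * (T v \<bullet> v)" for n
      using T_cauchy_schwarz[of "R (A (onb_seq n))" v] unfolding T_R adj_inner' by (simp only: inner_commute)
  qed
  then have "norm (adj A v) \<le> sqrt (weighted_ip R A A) * sqrt (T v \<bullet> v)"
    by (simp add: real_le_rsqrt flip: real_sqrt_mult)
  then have "norm u * norm (adj A v) \<le> norm u * (sqrt (weighted_ip R A A) * sqrt (T v \<bullet> v))"
    by (intro mult_left_mono) auto
  moreover have "\<bar>A u \<bullet> v\<bar> \<le> norm u * norm (adj A v)" unfolding adj_inner by (rule Cauchy_Schwarz_ineq2)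
  ultimately show ?thesis by (simp add: mult_ac)
qed

end

section \<open>Sampling under covariate shift\<close>

text \<open>Fubini along the disintegration of \<open>P\<close>. The regression function has to
  equal \<open>f\<close> only where the weight \<open>h\<close> is nonzero, since the source
  condition holds almost everywhere for the target marginal only.\<close>

lemma centered_noise:
  fixes P :: "('x::second_countable_topology \<times> 'y::{real_inner,banach,second_countable_topology}) measure"
    and K :: "'x \<Rightarrow> 'y measure" and h :: "'x \<Rightarrow> real" and f :: "'x \<Rightarrow> 'y"
  assumes P: "prob_space P" "sets P = sets (borel \<Otimes>\<^sub>M borel)"
    and K: "K \<in> borel \<rightarrow>\<^sub>M prob_algebra borel" and cond: "has_conditional P K"
    and y: "AE z in P. norm (snd z) \<le> M'"
    and h: "h \<in> borel_measurable borel" "\<And>x. \<bar>h x\<bar> \<le> c"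
    and f: "f \<in> borel_measurable borel" "\<And>x. norm (f x) \<le> c'"
    and reg: "AE x in marginal_X P. h x = 0 \<or> regression_fun K x = f x"
  shows "(\<integral>z. h (fst z) * (v \<bullet> (snd z - f (fst z))) \<partial>P) = 0"
proof -
  interpret P: prob_space P by (rule P(1))
  let ?N = "marginal_X P"
  note [measurable] = h(1) f(1)
  have fst_P: "fst \<in> P \<rightarrow>\<^sub>M borel" and snd_P: "snd \<in> P \<rightarrow>\<^sub>M borel"
    by (simp_all add: measurable_cong_sets[OF P(2) refl])
  have sets_N: "sets ?N = sets borel" by (simp add: marginal_X_def)
  interpret N: prob_space ?N unfolding marginal_X_def by (rule P.prob_space_distr[OF fst_P])
  have K_sub: "K \<in> ?N \<rightarrow>\<^sub>M subprob_algebra borel"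
    using measurable_prob_algebraD[OF K] by (simp add: measurable_cong_sets[OF sets_N refl])
  have K_prob: "prob_space (K x)" and sets_K: "sets (K x) = sets borel" for x
    using measurable_space[OF K, of x] by (auto simp: space_prob_algebra)
  have ret: "return (borel \<Otimes>\<^sub>M borel) \<in> (borel \<Otimes>\<^sub>M borel :: ('x \<times> 'y) measure) \<rightarrow>\<^sub>M subprob_algebra (borel \<Otimes>\<^sub>M borel)"
    by (rule return_measurable)
  have inner: "(\<lambda>x. K x \<bind> (\<lambda>y. return (borel \<Otimes>\<^sub>M borel) (x, y))) \<in> ?N \<rightarrow>\<^sub>M subprob_algebra (borel \<Otimes>\<^sub>M borel)"
  proof (rule measurable_bind[OF K_sub])
    have "(\<lambda>z. z) \<in> ?N \<Otimes>\<^sub>M borel \<rightarrow>\<^sub>M (borel \<Otimes>\<^sub>M borel :: ('x \<times> 'y) measure)"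
      by (rule measurable_ident_sets) (rule sets_pair_measure_cong[OF sets_N refl])
    from measurable_compose[OF this ret]
    show "(\<lambda>z. return (borel \<Otimes>\<^sub>M borel) (fst z, snd z)) \<in> ?N \<Otimes>\<^sub>M borel \<rightarrow>\<^sub>M subprob_algebra (borel \<Otimes>\<^sub>M (borel :: 'y measure))" by simp
  qed
  have pair_ret: "(\<lambda>y. return (borel \<Otimes>\<^sub>M borel) (x, y)) \<in> K x \<rightarrow>\<^sub>M subprob_algebra (borel \<Otimes>\<^sub>M borel)" for x
    by (rule measurable_compose[OF _ ret]) (simp add: measurable_cong_sets[OF sets_K refl] measurable_Pair1')
  have Pe: "P = ?N \<bind> (\<lambda>x. K x \<bind> (\<lambda>y. return (borel \<Otimes>\<^sub>M borel) (x, y)))"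
    using cond by (simp add: has_conditional_def)
  \<comment> \<open>Stated for nonnegative functions; the signed integrand is treated below through
    its positive and negative parts.\<close>
  have nn: "(\<integral>\<^sup>+z. F z \<partial>P) = (\<integral>\<^sup>+x. \<integral>\<^sup>+y. F (x, y) \<partial>K x \<partial>?N)"
    if F: "F \<in> borel_measurable (borel \<Otimes>\<^sub>M borel)" for F :: "'x \<times> 'y \<Rightarrow> ennreal"
  proof -
    have "(\<integral>\<^sup>+z. F z \<partial>P) = (\<integral>\<^sup>+x. \<integral>\<^sup>+z. F z \<partial>(K x \<bind> (\<lambda>y. return (borel \<Otimes>\<^sub>M borel) (x, y))) \<partial>?N)"
      by (subst Pe, rule nn_integral_bind[OF F inner])
    also have "\<dots> = (\<integral>\<^sup>+x. \<integral>\<^sup>+y. F (x, y) \<partial>K x \<partial>?N)"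
    proof (rule nn_integral_cong)
      fix x
      have "(\<integral>\<^sup>+z. F z \<partial>(K x \<bind> (\<lambda>y. return (borel \<Otimes>\<^sub>M borel) (x, y)))) = (\<integral>\<^sup>+y. \<integral>\<^sup>+z. F z \<partial>return (borel \<Otimes>\<^sub>M borel) (x, y) \<partial>K x)"
        by (rule nn_integral_bind[OF F pair_ret])
      also have "\<dots> = (\<integral>\<^sup>+y. F (x, y) \<partial>K x)"
        by (intro nn_integral_cong nn_integral_return F) (simp add: space_pair_measure)
      finally show "(\<integral>\<^sup>+z. F z \<partial>(K x \<bind> (\<lambda>y. return (borel \<Otimes>\<^sub>M borel) (x, y)))) = (\<integral>\<^sup>+y. F (x, y) \<partial>K x)" .
    qed
    finally show ?thesis .
  qed
  have AE_K: "AE x in ?N. AE y in K x. norm y \<le> M'"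
  proof -
    have "AE z in ?N \<bind> (\<lambda>x. K x \<bind> (\<lambda>y. return (borel \<Otimes>\<^sub>M borel) (x, y))). norm (snd z) \<le> M'"
      using y by (subst (asm) Pe)
    then have "AE x in ?N. AE z in K x \<bind> (\<lambda>y. return (borel \<Otimes>\<^sub>M borel) (x, y)). norm (snd z) \<le> M'"
      by (subst (asm) AE_bind[OF inner]) measurable
    then show ?thesis
    proof eventually_elim
      case (elim x)
      then have "AE y in K x. AE z in return (borel \<Otimes>\<^sub>M borel) (x, y). norm (snd z) \<le> M'"
        by (subst (asm) AE_bind[OF pair_ret]) measurable
      then show ?case
        by (auto simp: AE_return space_pair_measure)
    qed
  qed
  define F where "F z = h (fst z) * (v \<bullet> (snd z - f (fst z)))" for z
  have Fm: "F \<in> borel_measurable (borel \<Otimes>\<^sub>M borel)" unfolding F_def by measurable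
  have FP: "F \<in> borel_measurable P" using Fm by (simp add: measurable_cong_sets[OF P(2) refl])
  have Fb: "\<bar>F (x, y)\<bar> \<le> c * (norm v * (M' + c'))" if "norm y \<le> M'" for x y
  proof -
    have "norm (y - f x) \<le> M' + c'" using norm_triangle_ineq4[of y "f x"] f(2)[of x] that by simp
    then have "\<bar>v \<bullet> (y - f x)\<bar> \<le> norm v * (M' + c')"
      by (meson Cauchy_Schwarz_ineq2 mult_left_mono norm_ge_zero order.trans)
    moreover have "0 \<le> c" using h(2)[of x] by linarith
    ultimately show ?thesis unfolding F_def abs_mult using h(2)[of x] by (simp add: mult_mono)
  qed
  have intF: "integrable P F"
    by (rule P.integrable_const_bound[where B = "c * (norm v * (M' + c'))", OF _ FP])
      (use y in eventually_elim, use Fb in \<open>metis prod.collapse real_norm_def\<close>)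
  \<comment> \<open>For integrable \<open>F\<close>, mean zero is the equality of the integrals of
    the positive and negative parts, and this passes through the two-stage integral.\<close>
  have "(\<integral>\<^sup>+z. ennreal (F z) \<partial>P) = (\<integral>\<^sup>+z. ennreal (- F z) \<partial>P)"
  proof -
    have "(\<integral>\<^sup>+x. \<integral>\<^sup>+y. ennreal (F (x, y)) \<partial>K x \<partial>?N) = (\<integral>\<^sup>+x. \<integral>\<^sup>+y. ennreal (- F (x, y)) \<partial>K x \<partial>?N)"
    proof (rule nn_integral_cong_AE)
      show "AE x in ?N. (\<integral>\<^sup>+y. ennreal (F (x, y)) \<partial>K x) = (\<integral>\<^sup>+y. ennreal (- F (x, y)) \<partial>K x)"
        using reg AE_K
      proof eventually_elim
        case (elim x)
        interpret Kx: prob_space "K x" by (rule K_prob)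
        have id_m: "(\<lambda>y. y) \<in> borel_measurable (K x)" by (simp add: measurable_cong_sets[OF sets_K refl])
        have int_y: "integrable (K x) (\<lambda>y. y)"
          using elim(2) by (intro Kx.integrable_const_bound[where B = M'] id_m)
        have eq: "F (x, y) = h x * (v \<bullet> y) - h x * (v \<bullet> f x)" for y
          by (simp add: F_def inner_diff_right algebra_simps)
        have int: "integrable (K x) (\<lambda>y. F (x, y))"
          unfolding eq using int_y by (intro Bochner_Integration.integrable_diff integrable_mult_right integrable_inner_right) auto
        have "(\<integral>y. F (x, y) \<partial>K x) = h x * (v \<bullet> regression_fun K x) - h x * (v \<bullet> f x)"
          unfolding eq regression_fun_def using int_y by (simp add: Kx.prob_space integrable_inner_right)
        also have "\<dots> = 0" using elim(1) by auto
        finally have 0: "(\<integral>y. F (x, y) \<partial>K x) = 0" .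
        show ?case
          using 0 int unfolding real_lebesgue_integral_def[OF int] real_integrable_def
          by (metis ennreal_enn2real_if eq_iff_diff_eq_0 infinity_ennreal_def)
      qed
    qed
    then show ?thesis using Fm by (subst (1 2) nn) auto
  qed
  then have "(\<integral>z. F z \<partial>P) = 0" by (simp add: real_lebesgue_integral_def[OF intF])
  then show ?thesis by (simp add: F_def)
qed

locale covariate_sampling = feature_measure Q \<phi> \<kappa> + pr: prob_space P
  for Q :: "'x::second_countable_topology measure"
    and \<phi> :: "'x \<Rightarrow> 'h::{real_inner,banach,second_countable_topology}" and \<kappa> :: real
    and P :: "('x \<times> 'y::{real_inner,banach,second_countable_topology}) measure" +
  fixes \<beta> :: "'x \<Rightarrow> real" and b lam :: real
  assumes sets_P: "sets P = sets (borel \<Otimes>\<^sub>M borel)" and \<beta>_meas: "\<beta> \<in> borel_measurable borel"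
    and \<beta>_bound: "0 \<le> \<beta> x" "\<beta> x \<le> b"
    and density: "Q = density (marginal_X P) (\<lambda>x. ennreal (\<beta> x))" and lam: "lam > 0"
begin

sublocale op: shifted_operator C lam by (rule shifted[OF lam])

definition N :: real where "N = (\<integral>x. op.R (\<phi> x) \<bullet> \<phi> x \<partial>Q)"

lemma N_eq: "effective_dim C lam = N"
  unfolding N_def by (rule effective_dim_eq[OF lam])

lemma N_nonneg: "N \<ge> 0" unfolding N_def by (rule integral_nonneg_AE) (simp add: op.R_inner_nonneg)

lemma b_nonneg: "b \<ge> 0" using \<beta>_bound[of undefined] by linarith

lemma fst_P: "fst \<in> P \<rightarrow>\<^sub>M borel" and snd_P: "snd \<in> P \<rightarrow>\<^sub>M borel"
  by (simp_all add: measurable_cong_sets[OF sets_P refl])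

lemma R_\<phi>_meas: "(\<lambda>x. op.R (\<phi> x)) \<in> borel_measurable borel"
  by (rule measurable_compose[OF \<phi>_meas]) (intro borel_measurable_continuous_onI continuous_intros)

lemma change_measure:
  assumes "h \<in> borel_measurable borel"
  shows "(\<integral>z. \<beta> (fst z) * h (fst z) \<partial>P) = (\<integral>x. h x \<partial>Q)"
proof -
  have "(\<integral>x. h x \<partial>Q) = (\<integral>x. \<beta> x *\<^sub>R h x \<partial>marginal_X P)"
    unfolding density by (rule integral_density) (use assms \<beta>_meas \<beta>_bound in \<open>auto simp: marginal_X_def\<close>)
  also have "\<dots> = (\<integral>z. \<beta> (fst z) *\<^sub>R h (fst z) \<partial>P)"
    unfolding marginal_X_def by (rule integral_distr[OF fst_P]) (use assms \<beta>_meas in measurable)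
  finally show ?thesis by simp
qed

lemma R_\<phi>_inner_le: "op.R (\<phi> x) \<bullet> \<phi> x \<le> \<kappa>\<^sup>2 / lam"
proof -
  have "op.R (\<phi> x) \<bullet> \<phi> x \<le> (norm (\<phi> x))\<^sup>2 / lam" by (rule op.R_inner_le)
  also have "\<dots> \<le> \<kappa>\<^sup>2 / lam" using \<phi>_bound lam by (intro divide_right_mono power_mono) auto
  finally show ?thesis .
qed

lemma P_integrable:
  fixes f :: "'x \<times> 'y \<Rightarrow> real"
  assumes "f \<in> borel_measurable P" "AE z in P. \<bar>f z\<bar> \<le> c"
  shows "integrable P f"
  by (rule pr.integrable_const_bound[where B = c]) (use assms in auto)

text \<open>Of the two factors \<open>\<beta>\<close> one is bounded by \<open>b\<close>, the other
  changes the sampling measure into \<open>Q\<close>, where the resolvent form integrates to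
  \<open>N\<close>. So the importance weights cost only one factor \<open>b\<close> in the
  variance.\<close>

lemma second_moment_le:
  fixes f :: "'x \<times> 'y \<Rightarrow> real"
  assumes f: "f \<in> borel_measurable P" "AE z in P. f z \<le> c" "\<And>z. f z \<ge> 0"
  shows "(\<integral>z. (\<beta> (fst z))\<^sup>2 * f z * (op.R (\<phi> (fst z)) \<bullet> \<phi> (fst z)) \<partial>P) \<le> b * c * N"
    and "AE z in P. (\<beta> (fst z))\<^sup>2 * f z * (op.R (\<phi> (fst z)) \<bullet> \<phi> (fst z)) \<le> b\<^sup>2 * c * (\<kappa>\<^sup>2 / lam)"
proof -
  note [measurable] = f(1)
  have mg: "(\<lambda>x. op.R (\<phi> x) \<bullet> \<phi> x) \<in> borel_measurable borel" using R_\<phi>_meas \<phi>_meas by measurable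
  have gP: "(\<lambda>z. op.R (\<phi> (fst z)) \<bullet> \<phi> (fst z)) \<in> borel_measurable P" and bP: "(\<lambda>z. \<beta> (fst z)) \<in> borel_measurable P"
    using measurable_compose[OF fst_P mg] measurable_compose[OF fst_P \<beta>_meas] by auto
  note [measurable] = gP bP
  have g0: "op.R (\<phi> x) \<bullet> \<phi> x \<ge> 0" for x by (rule op.R_inner_nonneg)
  show 2: "AE z in P. (\<beta> (fst z))\<^sup>2 * f z * (op.R (\<phi> (fst z)) \<bullet> \<phi> (fst z)) \<le> b\<^sup>2 * c * (\<kappa>\<^sup>2 / lam)"
    using f(2)
  proof eventually_elim
    case (elim z)
    have "c \<ge> 0" using elim f(3)[of z] by linarith
    then show ?case using elim f(3) g0 \<beta>_bound b_nonneg R_\<phi>_inner_le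
      by (intro mult_mono power_mono) auto
  qed
  have le: "AE z in P. (\<beta> (fst z))\<^sup>2 * f z * (op.R (\<phi> (fst z)) \<bullet> \<phi> (fst z)) \<le> b * c * (\<beta> (fst z) * (op.R (\<phi> (fst z)) \<bullet> \<phi> (fst z)))"
    using f(2)
  proof eventually_elim
    case (elim z)
    have "c \<ge> 0" using elim f(3)[of z] by linarith
    then have "(\<beta> (fst z) * f z) * (\<beta> (fst z) * (op.R (\<phi> (fst z)) \<bullet> \<phi> (fst z)))
      \<le> (b * c) * (\<beta> (fst z) * (op.R (\<phi> (fst z)) \<bullet> \<phi> (fst z)))"
      using elim f(3) g0 \<beta>_bound b_nonneg by (intro mult_right_mono mult_mono) auto
    then show ?case by (simp add: power2_eq_square mult_ac)
  qed
  have "(\<integral>z. (\<beta> (fst z))\<^sup>2 * f z * (op.R (\<phi> (fst z)) \<bullet> \<phi> (fst z)) \<partial>P)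
     \<le> (\<integral>z. b * c * (\<beta> (fst z) * (op.R (\<phi> (fst z)) \<bullet> \<phi> (fst z))) \<partial>P)"
  proof (rule integral_mono_AE[OF _ _ le])
    show "integrable P (\<lambda>z. (\<beta> (fst z))\<^sup>2 * f z * (op.R (\<phi> (fst z)) \<bullet> \<phi> (fst z)))"
      by (rule P_integrable[where c = "b\<^sup>2 * c * (\<kappa>\<^sup>2 / lam)"])
        (measurable, use 2 f(3) g0 in \<open>auto simp: abs_mult\<close>)
    show "integrable P (\<lambda>z. b * c * (\<beta> (fst z) * (op.R (\<phi> (fst z)) \<bullet> \<phi> (fst z))))"
    proof (rule integrable_mult_right, rule P_integrable[OF borel_measurable_times[OF bP gP]], rule AE_I2)
      fix z
      show "\<bar>\<beta> (fst z) * (op.R (\<phi> (fst z)) \<bullet> \<phi> (fst z))\<bar> \<le> b * (\<kappa>\<^sup>2 / lam)"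
        unfolding abs_mult using g0[of "fst z"] \<beta>_bound[of "fst z"] b_nonneg R_\<phi>_inner_le[of "fst z"]
        by (intro mult_mono) auto
    qed
  qed
  also have "\<dots> = b * c * N" using change_measure[OF mg] by (simp add: N_def)
  finally show "(\<integral>z. (\<beta> (fst z))\<^sup>2 * f z * (op.R (\<phi> (fst z)) \<bullet> \<phi> (fst z)) \<partial>P) \<le> b * c * N" .
qed

subsection \<open>The noise\<close>

text \<open>The summands are the adjoints of the noise terms of the estimator, so that the resolvent
  of \<open>C\<close> acts on the side of the feature map. The factor \<open>c\<close> stays a
  parameter because the two deviation events use different ones.\<close>

lemma noise_deviation:
  fixes f :: "'x \<Rightarrow> 'y"
  assumes K: "K \<in> borel \<rightarrow>\<^sub>M prob_algebra borel" "has_conditional P K"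
    and y: "AE z in P. norm (snd z) \<le> M'" and f: "f \<in> borel_measurable borel" "\<And>x. norm (f x) \<le> c'"
    and reg: "AE x in Q. regression_fun K x = f x" and n: "n \<ge> 1" and t: "t > 0" and c: "c \<ge> 2"
  defines "V \<equiv> \<lambda>z. \<Sum>i<n. \<beta> (fst (z i)) *\<^sub>R tensor_op (\<phi> (fst (z i))) (snd (z i) - f (fst (z i)))"
    and "M \<equiv> M' + c'"
  defines "E \<equiv> {z \<in> space (Pi\<^sub>M {..<n} (\<lambda>_. P)). sqrt (weighted_ip op.R (V z) (V z)) / real n
        > c * t * (2 * b * M * \<kappa> / sqrt lam / real n + M * sqrt (b * N) / sqrt (real n))}"
  shows "E \<in> sets (Pi\<^sub>M {..<n} (\<lambda>_. P))" "measure (Pi\<^sub>M {..<n} (\<lambda>_. P)) E \<le> tail_level c t"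
proof -
  define \<xi> where "\<xi> z = \<beta> (fst z) *\<^sub>R tensor_op (\<phi> (fst z)) (snd z - f (fst z))" for z :: "'x \<times> 'y"
  interpret ip: semi_inner_space "hs_space :: ('y \<Rightarrow>\<^sub>L 'h) set" "weighted_ip op.R"
    by (rule op.weighted_ip_semi_inner)
  have in_S: "\<xi> z \<in> hs_space" for z
    unfolding \<xi>_def by (intro subspace_scale subspace_hs_space tensor_op_hs)
  have ip_eq: "weighted_ip op.R (\<xi> z) (\<xi> w) = \<beta> (fst z) * (\<beta> (fst w) *
      ((op.R (\<phi> (fst z)) \<bullet> \<phi> (fst w)) * ((snd z - f (fst z)) \<bullet> (snd w - f (fst w)))))" for z w
    unfolding \<xi>_def
    by (simp add: ip.ip_scale ip.ip_scale_right tensor_op_hs subspace_scale[OF subspace_hs_space]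
        op.weighted_ip_tensor tensor_op_apply mult_ac)
  have M': "M' \<ge> 0"
  proof (rule ccontr)
    assume neg: "\<not> M' \<ge> 0"
    have "AE z in P. False" using y
    proof eventually_elim
      case (elim z)
      then show ?case using neg norm_ge_zero[of "snd z"] by linarith
    qed
    then show False by simp
  qed
  have c': "c' \<ge> 0" using f(2)[of undefined] norm_ge_zero order.trans by blast
  have M0: "M \<ge> 0" using M' c' by (simp add: M_def)
  note [measurable] = f(1) \<beta>_meas \<phi>_meas R_\<phi>_meas
  have noise_bound: "AE z in P. (norm (snd z - f (fst z)))\<^sup>2 \<le> M\<^sup>2"
    using y
  proof eventually_elim
    case (elim z)
    have "norm (snd z - f (fst z)) \<le> M" using norm_triangle_ineq4[of "snd z" "f (fst z)"] f(2)[of "fst z"] elim by (simp add: M_def)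
    then show ?case by (intro power_mono) auto
  qed
  have fP: "(\<lambda>z. (norm (snd z - f (fst z)))\<^sup>2) \<in> borel_measurable P"
    by (simp add: measurable_cong_sets[OF sets_P refl])
  have diag: "weighted_ip op.R (\<xi> z) (\<xi> z) = (\<beta> (fst z))\<^sup>2 * (norm (snd z - f (fst z)))\<^sup>2 * (op.R (\<phi> (fst z)) \<bullet> \<phi> (fst z))" for z
    unfolding ip_eq power2_norm_eq_inner by (simp add: power2_eq_square mult_ac)
  have V_eq: "V z = (\<Sum>i<n. \<xi> (z i))" for z by (simp add: V_def \<xi>_def)
  have bd: "AE z in P. weighted_ip op.R (\<xi> z) (\<xi> z) \<le> (2 * b * M * \<kappa> / sqrt lam)\<^sup>2"
    using second_moment_le(2)[OF fP noise_bound zero_le_power2]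
  proof eventually_elim
    case (elim z)
    have "0 \<le> b\<^sup>2 * M\<^sup>2 * (\<kappa>\<^sup>2 / lam)" using lam by simp
    then have "b\<^sup>2 * M\<^sup>2 * (\<kappa>\<^sup>2 / lam) \<le> 4 * (b\<^sup>2 * M\<^sup>2 * (\<kappa>\<^sup>2 / lam))" by linarith
    also have "\<dots> = (2 * b * M * \<kappa> / sqrt lam)\<^sup>2" using lam by (simp add: power_mult_distrib power_divide)
    finally show ?case using elim unfolding diag by simp
  qed
  have var: "(\<integral>z. weighted_ip op.R (\<xi> z) (\<xi> z) \<partial>P) \<le> (M * sqrt (b * N))\<^sup>2"
    unfolding diag using second_moment_le(1)[OF fP noise_bound] b_nonneg N_nonneg
    by (simp add: power_mult_distrib mult_ac)
  have meas: "(\<lambda>(z, w). weighted_ip op.R (\<xi> z) (\<xi> w)) \<in> borel_measurable (P \<Otimes>\<^sub>M P)"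
    unfolding ip_eq by (simp add: measurable_cong_sets[OF sets_pair_measure_cong[OF sets_P sets_P] refl] split_beta)
  have cen: "(\<integral>w. weighted_ip op.R (\<xi> z) (\<xi> w) \<partial>P) = 0" for z
  proof -
    have "(\<integral>w. \<beta> (fst w) * (op.R (\<phi> (fst z)) \<bullet> \<phi> (fst w)) * ((snd z - f (fst z)) \<bullet> (snd w - f (fst w))) \<partial>P) = 0"
    proof (rule centered_noise[OF pr.prob_space_axioms sets_P K y _ _ f, where c = "b * (norm (op.R (\<phi> (fst z))) * \<kappa>)"])
      show "(\<lambda>x. \<beta> x * (op.R (\<phi> (fst z)) \<bullet> \<phi> x)) \<in> borel_measurable borel" by measurable
      show "\<bar>\<beta> x * (op.R (\<phi> (fst z)) \<bullet> \<phi> x)\<bar> \<le> b * (norm (op.R (\<phi> (fst z))) * \<kappa>)" for x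
        unfolding abs_mult using \<beta>_bound[of x] inner_\<phi>_bound by (intro mult_mono) auto
      \<comment> \<open>Almost everywhere for \<open>Q\<close> means almost everywhere on
        \<open>\<beta> > 0\<close> for the source marginal; where \<open>\<beta> = 0\<close> the
        integrand vanishes.\<close>
      have "AE x in marginal_X P. 0 < ennreal (\<beta> x) \<longrightarrow> regression_fun K x = f x"
        using reg unfolding density by (subst (asm) AE_density) (auto simp: marginal_X_def)
      then show "AE x in marginal_X P. \<beta> x * (op.R (\<phi> (fst z)) \<bullet> \<phi> x) = 0 \<or> regression_fun K x = f x"
        by eventually_elim (use \<beta>_bound in \<open>auto simp: less_le\<close>)
    qed
    then have "(\<integral>w. \<beta> (fst z) * (\<beta> (fst w) * (op.R (\<phi> (fst z)) \<bullet> \<phi> (fst w)) * ((snd z - f (fst z)) \<bullet> (snd w - f (fst w)))) \<partial>P) = 0"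
      by simp
    then show ?thesis unfolding ip_eq by (simp only: mult.assoc)
  qed
  have L0: "2 * b * M * \<kappa> / sqrt lam \<ge> 0" using b_nonneg M0 \<kappa>_nonneg lam by simp
  have s0: "M * sqrt (b * N) \<ge> 0" using b_nonneg M0 N_nonneg by simp
  note tail = semi_inner_deviation_tail[OF op.weighted_ip_semi_inner pr.prob_space_axioms in_S meas cen L0 s0 bd var n t c]
  show "E \<in> sets (Pi\<^sub>M {..<n} (\<lambda>_. P))" unfolding E_def V_eq by (rule tail(1))
  show "measure (Pi\<^sub>M {..<n} (\<lambda>_. P)) E \<le> tail_level c t" unfolding E_def V_eq by (rule tail(2))
qed

subsection \<open>The covariance\<close>

lemma C_in_hs: "C \<in> hs_space"
  using C_hilbert_schmidt by (simp add: hs_space_def)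

text \<open>A weak form of the statement that the weighted rank-one operators have mean
  \<open>C\<close>; both sides are the trace of \<open>(adj A) R C\<close>.\<close>

lemma ip_C:
  assumes A: "A \<in> hs_space"
  shows "(\<integral>z. \<beta> (fst z) * (op.R (\<phi> (fst z)) \<bullet> A (\<phi> (fst z))) \<partial>P) = weighted_ip op.R A C"
proof -
  have m: "(\<lambda>x. op.R (\<phi> x) \<bullet> A (\<phi> x)) \<in> borel_measurable borel"
    by (intro borel_measurable_inner R_\<phi>_meas measurable_compose[OF \<phi>_meas] borel_measurable_continuous_onI continuous_intros)
  have "(\<integral>z. \<beta> (fst z) * (op.R (\<phi> (fst z)) \<bullet> A (\<phi> (fst z))) \<partial>P) = (\<integral>x. op.R (\<phi> x) \<bullet> A (\<phi> x) \<partial>Q)"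
    by (rule change_measure[OF m])
  also have "\<dots> = (\<integral>x. (op.R o\<^sub>L A) (\<phi> x) \<bullet> \<phi> x \<partial>Q)"
  proof -
    have "op.R (\<phi> x) \<bullet> A (\<phi> x) = (op.R o\<^sub>L A) (\<phi> x) \<bullet> \<phi> x" for x
      by (metis blinfun_apply_blinfun_compose inner_commute op.R_sym)
    then show ?thesis by simp
  qed
  also have "\<dots> = (\<Sum>n. C ((op.R o\<^sub>L A) (onb_seq n)) \<bullet> onb_seq n)" using trace_sums[of "op.R o\<^sub>L A"] by (simp add: sums_iff)
  also have "\<dots> = (\<Sum>n. A (onb_seq n) \<bullet> op.R (C (onb_seq n)))"
    by (intro arg_cong[where f = suminf] ext) (simp add: symmetricD[OF C_symmetric] op.R_sym)
  finally show ?thesis by (simp add: weighted_ip_def)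
qed

lemma covariance_deviation:
  assumes n: "n \<ge> 1" and t: "t > 0" and c: "c \<ge> 2"
  defines "V \<equiv> \<lambda>z. \<Sum>i<n. (\<beta> (fst (z i)) *\<^sub>R tensor_op (\<phi> (fst (z i))) (\<phi> (fst (z i))) - C)"
  defines "E \<equiv> {z \<in> space (Pi\<^sub>M {..<n} (\<lambda>_. P)). sqrt (weighted_ip op.R (V z) (V z)) / real n
        > c * t * (2 * b * \<kappa>\<^sup>2 / sqrt lam / real n + sqrt (b * \<kappa>\<^sup>2 * N) / sqrt (real n))}"
  shows "E \<in> sets (Pi\<^sub>M {..<n} (\<lambda>_. P))" "measure (Pi\<^sub>M {..<n} (\<lambda>_. P)) E \<le> tail_level c t"
proof -
  let ?ip = "weighted_ip op.R"
  define X where "X z = \<beta> (fst z) *\<^sub>R tensor_op (\<phi> (fst z)) (\<phi> (fst z))" for z :: "'x \<times> 'y"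
  interpret ip: semi_inner_space "hs_space :: ('h \<Rightarrow>\<^sub>L 'h) set" ?ip by (rule op.weighted_ip_semi_inner)
  have X_S: "X z \<in> hs_space" for z
    unfolding X_def by (intro subspace_scale subspace_hs_space tensor_op_hs)
  have in_S: "X z - C \<in> hs_space" for z by (intro subspace_diff subspace_hs_space X_S C_in_hs)
  have expand: "?ip (X z - C) (X w - C) = ?ip (X z) (X w) - ?ip (X z) C - ?ip C (X w) + ?ip C C" for z w
    by (simp add: ip.ip_diff ip.ip_diff_right X_S C_in_hs in_S)
  have XA: "?ip (X w) A = \<beta> (fst w) * (op.R (\<phi> (fst w)) \<bullet> A (\<phi> (fst w)))" if "A \<in> hs_space" for w A
    unfolding X_def using that by (simp add: ip.ip_scale tensor_op_hs op.weighted_ip_tensor)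
  note [measurable] = \<beta>_meas \<phi>_meas R_\<phi>_meas
  have XX: "?ip (X z) (X w) = \<beta> (fst z) * (\<beta> (fst w) * ((\<phi> (fst z) \<bullet> \<phi> (fst w)) * (op.R (\<phi> (fst z)) \<bullet> \<phi> (fst w))))" for z w
    unfolding XA[OF X_S] by (simp add: X_def blinfun.scaleR_left tensor_op_apply)
  have A_meas: "(\<lambda>x. A (\<phi> x)) \<in> borel_measurable borel" for A :: "'h \<Rightarrow>\<^sub>L 'h"
    by (rule measurable_compose[OF \<phi>_meas]) (intro borel_measurable_continuous_onI continuous_intros)
  note [measurable] = A_meas[of C]
  have meas: "(\<lambda>(z, w). ?ip (X z - C) (X w - C)) \<in> borel_measurable (P \<Otimes>\<^sub>M P)"
    unfolding expand ip.ip_commute[OF C_in_hs X_S] XX XA[OF C_in_hs]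
    by (simp add: measurable_cong_sets[OF sets_pair_measure_cong[OF sets_P sets_P] refl] split_beta)
  have intX: "integrable P (\<lambda>w. ?ip (X w) A)" and mean: "(\<integral>w. ?ip (X w) A \<partial>P) = ?ip A C" if A: "A \<in> hs_space" for A
  proof -
    note [measurable] = A_meas[of A]
    have m: "(\<lambda>w. ?ip (X w) A) \<in> borel_measurable P"
      unfolding XA[OF A] by (simp add: measurable_cong_sets[OF sets_P refl])
    show "integrable P (\<lambda>w. ?ip (X w) A)"
    proof (rule P_integrable[OF m, where c = "b * ((\<kappa> / lam) * (norm A * \<kappa>))"], rule AE_I2)
      fix w :: "'x \<times> 'y"
      have 1: "norm (op.R (\<phi> (fst w))) \<le> \<kappa> / lam"
        using op.R_norm[of "\<phi> (fst w)"] divide_right_mono[OF \<phi>_bound, of lam] lam by (meson less_imp_le order.trans)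
      have 2: "norm (A (\<phi> (fst w))) \<le> norm A * \<kappa>"
        by (rule order.trans[OF norm_blinfun mult_left_mono[OF \<phi>_bound norm_ge_zero]])
      have "\<bar>op.R (\<phi> (fst w)) \<bullet> A (\<phi> (fst w))\<bar> \<le> (\<kappa> / lam) * (norm A * \<kappa>)"
        by (rule order.trans[OF Cauchy_Schwarz_ineq2 mult_mono[OF 1 2]]) (use \<kappa>_nonneg lam in auto)
      then show "\<bar>?ip (X w) A\<bar> \<le> b * ((\<kappa> / lam) * (norm A * \<kappa>))"
        unfolding XA[OF A] abs_mult using \<beta>_bound[of "fst w"] b_nonneg by (intro mult_mono) auto
    qed
    show "(\<integral>w. ?ip (X w) A \<partial>P) = ?ip A C" unfolding XA[OF A] by (rule ip_C[OF A])
  qed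
  have cen: "(\<integral>w. ?ip (X z - C) (X w - C) \<partial>P) = 0" for z
  proof -
    let ?A = "X z - C"
    have "?ip ?A (X w - C) = ?ip (X w) ?A - ?ip ?A C" for w
      using ip.ip_diff_right[OF X_S C_in_hs in_S, of z w] ip.ip_commute[OF X_S in_S, of w z] by simp
    then show ?thesis using intX[OF in_S] mean[OF in_S] by (simp add: pr.prob_space)
  qed
  have fP: "(\<lambda>z. (norm (\<phi> (fst z)))\<^sup>2) \<in> borel_measurable P"
    by (simp add: measurable_cong_sets[OF sets_P refl])
  have fb: "AE z in P. (norm (\<phi> (fst z)))\<^sup>2 \<le> \<kappa>\<^sup>2" using \<phi>_bound by (auto intro!: power_mono)
  have diag: "?ip (X z) (X z) = (\<beta> (fst z))\<^sup>2 * (norm (\<phi> (fst z)))\<^sup>2 * (op.R (\<phi> (fst z)) \<bullet> \<phi> (fst z))" for z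
    unfolding XX power2_norm_eq_inner by (simp add: power2_eq_square mult_ac)
  define \<rho> where "\<rho> = b * \<kappa>\<^sup>2 / sqrt lam"
  have \<rho>0: "\<rho> \<ge> 0" using b_nonneg lam by (simp add: \<rho>_def)
  have Xb: "AE z in P. sqrt (?ip (X z) (X z)) \<le> \<rho>"
    using second_moment_le(2)[OF fP fb zero_le_power2]
  proof eventually_elim
    case (elim z)
    have "?ip (X z) (X z) \<le> \<rho>\<^sup>2"
      unfolding diag using elim lam by (simp add: \<rho>_def power_mult_distrib power_divide power2_eq_square mult_ac)
    then show ?case using \<rho>0 by (intro real_le_lsqrt) auto
  qed
  \<comment> \<open>\<open>C\<close> is the mean of \<open>X\<close>, so \<open>?ip C C\<close> is
    the mean of \<open>?ip (X w) C\<close> and at most \<open>\<rho>\<close> times the length of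
    \<open>C\<close>. The lengths of \<open>X\<close> and \<open>C\<close> together give the 2 in
    \<open>2 * b * \<kappa>\<^sup>2\<close>.\<close>
  have Cb: "sqrt (?ip C C) \<le> \<rho>"
  proof -
    have "?ip C C = (\<integral>w. ?ip (X w) C \<partial>P)" by (rule mean[OF C_in_hs, symmetric])
    also have "\<dots> \<le> (\<integral>w. \<rho> * sqrt (?ip C C) \<partial>P)"
    proof (rule integral_mono_AE[OF intX[OF C_in_hs]])
      show "AE w in P. ?ip (X w) C \<le> \<rho> * sqrt (?ip C C)"
        using Xb
      proof eventually_elim
        case (elim w)
        have "?ip (X w) C \<le> sqrt (?ip (X w) (X w)) * sqrt (?ip C C)"
          using ip.ip_cauchy_schwarz[OF X_S C_in_hs, of w] by linarith
        also have "\<dots> \<le> \<rho> * sqrt (?ip C C)" using elim ip.ip_nonneg[OF C_in_hs] by (intro mult_right_mono) auto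
        finally show ?case .
      qed
    qed simp
    finally have le: "sqrt (?ip C C) * sqrt (?ip C C) \<le> \<rho> * sqrt (?ip C C)"
      using ip.ip_nonneg[OF C_in_hs] by (simp add: pr.prob_space)
    show ?thesis
    proof (cases "sqrt (?ip C C) > 0")
      case True
      then show ?thesis by (rule mult_right_le_imp_le[OF le])
    next
      case False
      then show ?thesis using \<rho>0 by linarith
    qed
  qed
  have bd: "AE z in P. ?ip (X z - C) (X z - C) \<le> (2 * b * \<kappa>\<^sup>2 / sqrt lam)\<^sup>2"
    using Xb
  proof eventually_elim
    case (elim z)
    let ?x = "sqrt (?ip (X z) (X z))" and ?c = "sqrt (?ip C C)"
    have "- ?ip (X z) C \<le> ?x * ?c" using ip.ip_cauchy_schwarz[OF X_S C_in_hs, of z] by linarith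
    then have "?ip (X z - C) (X z - C) \<le> ?x\<^sup>2 + ?c\<^sup>2 + 2 * (?x * ?c)"
      unfolding expand ip.ip_commute[OF C_in_hs X_S] by (simp add: ip.ip_nonneg X_S C_in_hs)
    also have "\<dots> = (?x + ?c)\<^sup>2" by (simp add: power2_sum)
    also have "\<dots> \<le> (\<rho> + \<rho>)\<^sup>2" using elim Cb by (intro power_mono add_mono) (auto simp: ip.ip_nonneg X_S C_in_hs)
    also have "\<rho> + \<rho> = 2 * b * \<kappa>\<^sup>2 / sqrt lam" by (simp add: \<rho>_def)
    finally show ?case .
  qed
  \<comment> \<open>Centring lowers the second moment by \<open>?ip C C\<close>, so the bound for
    the uncentred summands applies.\<close>
  have var: "(\<integral>z. ?ip (X z - C) (X z - C) \<partial>P) \<le> (sqrt (b * \<kappa>\<^sup>2 * N))\<^sup>2"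
  proof -
    have "integrable P (\<lambda>z. ?ip (X z) (X z))"
      unfolding diag
      by (rule P_integrable[where c = "b\<^sup>2 * \<kappa>\<^sup>2 * (\<kappa>\<^sup>2 / lam)"])
        (simp add: measurable_cong_sets[OF sets_P refl],
         use second_moment_le(2)[OF fP fb] in \<open>auto simp: abs_mult op.R_inner_nonneg\<close>)
    then have "(\<integral>z. ?ip (X z - C) (X z - C) \<partial>P) = (\<integral>z. ?ip (X z) (X z) \<partial>P) - ?ip C C"
      unfolding expand ip.ip_commute[OF C_in_hs X_S]
      using intX[OF C_in_hs] mean[OF C_in_hs] by (simp add: pr.prob_space)
    also have "\<dots> \<le> (\<integral>z. ?ip (X z) (X z) \<partial>P)" using ip.ip_nonneg[OF C_in_hs] by simp
    also have "\<dots> \<le> b * \<kappa>\<^sup>2 * N" unfolding diag by (rule second_moment_le(1)[OF fP fb]) simp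
    finally show ?thesis using b_nonneg N_nonneg by simp
  qed
  have V_eq: "V z = (\<Sum>i<n. X (z i) - C)" for z by (simp add: V_def X_def)
  have L0: "2 * b * \<kappa>\<^sup>2 / sqrt lam \<ge> 0" using b_nonneg lam by simp
  have s0: "sqrt (b * \<kappa>\<^sup>2 * N) \<ge> 0" using b_nonneg N_nonneg by simp
  note tail = semi_inner_deviation_tail[where \<xi> = "\<lambda>z. X z - C", OF op.weighted_ip_semi_inner pr.prob_space_axioms in_S meas cen L0 s0 bd var n t c]
  show "E \<in> sets (Pi\<^sub>M {..<n} (\<lambda>_. P))" unfolding E_def V_eq by (rule tail(1))
  show "measure (Pi\<^sub>M {..<n} (\<lambda>_. P)) E \<le> tail_level c t" unfolding E_def V_eq by (rule tail(2))
qed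

end

section \<open>Error of the estimator on a good sample\<close>

text \<open>Minkowski's inequality prepared for summation: bounds of the form
  \<open>(1 + \<tau>) * x\<^sup>2 + (1 + 1 / \<tau>) * y\<^sup>2\<close> can be summed or integrated
  termwise, and only at the end is \<open>\<tau>\<close> chosen as
  \<open>\<beta> / \<alpha>\<close>.\<close>

lemma square_sum_from_weighted:
  fixes S \<alpha> \<beta> :: real
  assumes nn: "\<alpha> \<ge> 0" "\<beta> \<ge> 0"
    and le: "\<And>\<tau>. \<tau> > 0 \<Longrightarrow> S \<le> (1 + \<tau>) * \<alpha>\<^sup>2 + (1 + 1 / \<tau>) * \<beta>\<^sup>2"
  shows "S \<le> (\<alpha> + \<beta>)\<^sup>2"
proof (cases "\<alpha> > 0 \<and> \<beta> > 0")
  case True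
  then have "S \<le> (1 + \<beta> / \<alpha>) * \<alpha>\<^sup>2 + (1 + 1 / (\<beta> / \<alpha>)) * \<beta>\<^sup>2" by (intro le) simp
  also have "\<dots> = (\<alpha> + \<beta>)\<^sup>2" using True by (simp add: power2_eq_square field_simps)
  finally show ?thesis .
next
  case False
  define w where "w = \<alpha> + \<beta>"
  have z: "\<alpha> = 0 \<or> \<beta> = 0" using False nn by auto
  \<comment> \<open>If one of the numbers vanishes there is no optimal \<open>\<tau>\<close>; it has
    to tend to 0 or to infinity, depending on which one is zero.\<close>
  have step: "S \<le> (1 + \<tau>) * w\<^sup>2" if "\<tau> > 0" for \<tau>
    using le[of \<tau>] le[of "1 / \<tau>"] z that by (auto simp: w_def)
  have "S \<le> w\<^sup>2 + e" if e: "e > 0" for e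
  proof (cases "w = 0")
    case False
    then show ?thesis using step[of "e / w\<^sup>2"] e by (simp add: distrib_right)
  qed (use step[of 1] e in simp)
  then show ?thesis unfolding w_def by (rule field_le_epsilon)
qed

lemma norm_add_square_weighted:
  fixes a b :: "'a::real_inner"
  assumes "\<tau> > 0"
  shows "(norm (a + b))\<^sup>2 \<le> (1 + \<tau>) * (norm a)\<^sup>2 + (1 + 1 / \<tau>) * (norm b)\<^sup>2"
proof -
  have "0 \<le> (norm (\<tau> *\<^sub>R a - b))\<^sup>2 / \<tau>" using assms by simp
  also have "\<dots> = \<tau> * (norm a)\<^sup>2 + (norm b)\<^sup>2 / \<tau> - 2 * (a \<bullet> b)"
  proof -
    have "(norm (\<tau> *\<^sub>R a - b))\<^sup>2 = \<tau> * (\<tau> * (norm a)\<^sup>2) + (norm b)\<^sup>2 - \<tau> * (2 * (a \<bullet> b))"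
      unfolding power2_norm_eq_inner by (simp add: inner_diff_left inner_diff_right inner_commute[of b a] algebra_simps)
    then show ?thesis using assms by (simp add: add_divide_distrib diff_divide_distrib)
  qed
  finally have "2 * (a \<bullet> b) \<le> \<tau> * (norm a)\<^sup>2 + (norm b)\<^sup>2 / \<tau>" by simp
  moreover have "(norm (a + b))\<^sup>2 = (norm a)\<^sup>2 + (norm b)\<^sup>2 + 2 * (a \<bullet> b)"
    unfolding power2_norm_eq_inner by (simp add: inner_simps inner_commute)
  moreover have "(1 + \<tau>) * (norm a)\<^sup>2 = (norm a)\<^sup>2 + \<tau> * (norm a)\<^sup>2"
    "(1 + 1 / \<tau>) * (norm b)\<^sup>2 = (norm b)\<^sup>2 + (norm b)\<^sup>2 / \<tau>" by (simp_all add: distrib_right)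
  ultimately show ?thesis by linarith
qed

lemma add_square_weighted:
  fixes a b :: real
  assumes "\<tau> > 0"
  shows "(a + b)\<^sup>2 \<le> (1 + \<tau>) * a\<^sup>2 + (1 + 1 / \<tau>) * b\<^sup>2"
  using norm_add_square_weighted[OF assms, of a b] by simp

section \<open>Adjoints of Hilbert-Schmidt operators\<close>

lemma adj_eqI:
  assumes "\<And>u v. blinfun_apply A u \<bullet> v = u \<bullet> blinfun_apply B v"
  shows "adj A = B"
proof (rule blinfun_eqI, rule inner_all_eqI)
  fix u v
  show "u \<bullet> adj A v = u \<bullet> B v" using adj_inner[of A u v] assms[of u v] by (rule trans[OF sym])
qed

lemma adj_adj: "adj (adj A) = A"
  by (rule adj_eqI) (rule adj_inner')

lemma hs_adj_sums:
  fixes A :: "'a::{real_inner,banach,second_countable_topology} \<Rightarrow>\<^sub>L 'b::{real_inner,banach,second_countable_topology}"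
  assumes "hilbert_schmidt A"
  shows "(\<lambda>n. (norm (adj A (onb_seq n)))\<^sup>2) sums (hs_norm A)\<^sup>2"
  by (rule adj_norm_sums[OF hs_norm_sums[OF assms]])

lemma hs_norm_nonneg: "hs_norm A \<ge> 0"
  unfolding hs_norm_def by (simp add: infsum_nonneg)

lemma norm_le_hs_norm:
  fixes A :: "'a::{real_inner,banach,second_countable_topology} \<Rightarrow>\<^sub>L 'b::{real_inner,banach,second_countable_topology}"
  assumes "hilbert_schmidt A"
  shows "norm (A u) \<le> hs_norm A * norm u"
proof -
  have "(norm (A u))\<^sup>2 \<le> (hs_norm A)\<^sup>2 * (norm u)\<^sup>2"
  proof (rule sums_le[OF _ onb_seq_norm sums_mult2[OF hs_adj_sums[OF assms]]])
    fix n
    have "(A u \<bullet> onb_seq n)\<^sup>2 \<le> (norm u * norm (adj A (onb_seq n)))\<^sup>2"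
      unfolding adj_inner using Cauchy_Schwarz_ineq2 by (intro abs_le_square_iff[THEN iffD1]) simp
    then show "(A u \<bullet> onb_seq n)\<^sup>2 \<le> (norm (adj A (onb_seq n)))\<^sup>2 * (norm u)\<^sup>2"
      by (simp add: power_mult_distrib mult.commute)
  qed
  then have "(norm (A u))\<^sup>2 \<le> (hs_norm A * norm u)\<^sup>2" by (simp add: power_mult_distrib)
  then show ?thesis by (rule power2_le_imp_le) (simp add: hs_norm_nonneg)
qed

text \<open>In the adjoint the bounded factor acts last, so its Hilbert-Schmidt sum is bounded
  termwise; \<open>adj_norm_sums\<close> carries summability there and back.\<close>

lemma hilbert_schmidt_comp_symmetric:
  fixes A :: "'a::{real_inner,banach,second_countable_topology} \<Rightarrow>\<^sub>L 'b::{real_inner,banach,second_countable_topology}"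
  assumes A: "hilbert_schmidt A" and F: "symmetric F"
  shows "hilbert_schmidt (A o\<^sub>L F)" "adj (A o\<^sub>L F) = F o\<^sub>L adj A"
proof -
  show a: "adj (A o\<^sub>L F) = F o\<^sub>L adj A"
    by (rule adj_eqI) (metis adj_inner blinfun_apply_blinfun_compose symmetricD[OF F])
  have "summable (\<lambda>n. (norm (adj (A o\<^sub>L F) (onb_seq n)))\<^sup>2)"
  proof (rule summable_comparison_test')
    show "summable (\<lambda>n. (norm F)\<^sup>2 * (norm (adj A (onb_seq n)))\<^sup>2)"
      using hs_adj_sums[OF A] by (intro summable_mult) (auto simp: sums_iff)
    fix n
    have "norm (F (adj A (onb_seq n))) \<le> norm F * norm (adj A (onb_seq n))" by (rule norm_blinfun)
    then have "(norm (F (adj A (onb_seq n))))\<^sup>2 \<le> (norm F * norm (adj A (onb_seq n)))\<^sup>2" by (rule power_mono) simp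
    then show "norm ((norm (adj (A o\<^sub>L F) (onb_seq n)))\<^sup>2) \<le> (norm F)\<^sup>2 * (norm (adj A (onb_seq n)))\<^sup>2"
      by (simp add: a power_mult_distrib)
  qed
  then have "summable (\<lambda>n. (norm (adj (adj (A o\<^sub>L F)) (onb_seq n)))\<^sup>2)"
    using adj_norm_sums by (auto simp: summable_def)
  then show "hilbert_schmidt (A o\<^sub>L F)" by (simp add: adj_adj hilbert_schmidt_iff)
qed

text \<open>For \<open>\<sigma> \<le> lam\<close> use \<open>\<sigma> + lam \<le> 2 * lam\<close>
  and the uniform bound, otherwise \<open>\<sigma> + lam \<le> 2 * \<sigma>\<close> and the
  qualification, lowered from \<open>\<nu>\<close> to \<open>t\<close> by
  \<open>\<sigma> > lam\<close>. At \<open>\<sigma> = 0\<close> the residual is 1, hence the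
  assumption \<open>1 \<le> \<gamma>\<close>.\<close>

lemma residual_weight_bound:
  fixes r :: "real \<Rightarrow> real"
  assumes lam: "0 < lam" "lam \<le> s" and \<sigma>: "0 \<le> \<sigma>" "\<sigma> \<le> s" and t: "0 \<le> t" "t \<le> \<nu>"
    and r0: "r 0 = 1" and \<gamma>: "1 \<le> \<gamma>" "0 \<le> \<gamma>'"
    and r: "\<And>\<sigma>. \<sigma> \<in> {0<..s} \<Longrightarrow> \<bar>r \<sigma>\<bar> \<le> \<gamma>" "\<And>\<sigma>. \<sigma> \<in> {0<..s} \<Longrightarrow> \<bar>r \<sigma>\<bar> * \<sigma> powr \<nu> \<le> \<gamma>' * lam powr \<nu>"
  shows "\<bar>r \<sigma>\<bar> * (\<sigma> + lam) powr t \<le> 2 powr t * (\<gamma>' + \<gamma>) * lam powr t"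
proof (cases "\<sigma> \<le> lam")
  case True
  have "\<bar>r \<sigma>\<bar> \<le> \<gamma>" using r(1)[of \<sigma>] \<sigma> r0 \<gamma> by (cases "\<sigma> = 0") auto
  moreover have "(\<sigma> + lam) powr t \<le> (2 * lam) powr t" using True \<sigma> lam t by (intro powr_mono2) auto
  ultimately have "\<bar>r \<sigma>\<bar> * (\<sigma> + lam) powr t \<le> (\<gamma>' + \<gamma>) * (2 * lam) powr t"
    using \<gamma> by (intro mult_mono) auto
  then show ?thesis using powr_mult[of 2 lam t] by (simp only: mult_ac)
next
  case False
  then have \<sigma>0: "\<sigma> > 0" using lam by simp
  have "\<bar>r \<sigma>\<bar> * \<sigma> powr t = (\<bar>r \<sigma>\<bar> * \<sigma> powr \<nu>) * \<sigma> powr (t - \<nu>)"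
    using \<sigma>0 by (simp add: powr_diff)
  also have "\<dots> \<le> (\<gamma>' * lam powr \<nu>) * lam powr (t - \<nu>)"
  proof (rule mult_mono)
    show "\<bar>r \<sigma>\<bar> * \<sigma> powr \<nu> \<le> \<gamma>' * lam powr \<nu>" using r(2)[of \<sigma>] \<sigma> \<sigma>0 by simp
    show "\<sigma> powr (t - \<nu>) \<le> lam powr (t - \<nu>)" using False t lam by (intro powr_mono2') auto
  qed (use \<gamma> in auto)
  also have "\<dots> = \<gamma>' * lam powr t" using lam by (simp add: powr_diff)
  also have "\<dots> \<le> (\<gamma>' + \<gamma>) * lam powr t" using \<gamma> by (intro mult_right_mono) auto
  finally have 1: "\<bar>r \<sigma>\<bar> * \<sigma> powr t \<le> (\<gamma>' + \<gamma>) * lam powr t" .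
  have "\<bar>r \<sigma>\<bar> * (\<sigma> + lam) powr t \<le> \<bar>r \<sigma>\<bar> * (2 * \<sigma>) powr t"
    using False \<sigma> lam t by (intro mult_left_mono powr_mono2) auto
  also have "\<dots> = 2 powr t * (\<bar>r \<sigma>\<bar> * \<sigma> powr t)" using powr_mult[of 2 \<sigma> t] by (simp only: mult_ac)
  also have "\<dots> \<le> 2 powr t * ((\<gamma>' + \<gamma>) * lam powr t)" by (rule mult_left_mono[OF 1]) simp
  finally show ?thesis by (simp add: mult.assoc)
qed

context covariate_sampling
begin

lemma L2_integrable: "integrable Q (\<lambda>x. (norm (blinfun_apply A (\<phi> x)))\<^sup>2)"
proof (rule integrable_bounded_real[where K = "(norm A * \<kappa>)\<^sup>2"])
  have "(\<lambda>x. A (\<phi> x)) \<in> borel_measurable Q"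
    by (rule measurable_compose[OF \<phi>_measurable]) (intro borel_measurable_continuous_onI continuous_intros)
  then show "(\<lambda>x. (norm (A (\<phi> x)))\<^sup>2) \<in> borel_measurable Q" by measurable
  show "\<bar>(norm (A (\<phi> x)))\<^sup>2\<bar> \<le> (norm A * \<kappa>)\<^sup>2" for x
    using order.trans[OF norm_blinfun mult_left_mono[OF \<phi>_bound norm_ge_zero]] by (auto intro!: power_mono)
qed

text \<open>After passing to adjoints, \<open>residual_bound\<close> treats the bias and
  \<open>filter_bound\<close> the noise, one basis vector of the output space at a time.\<close>

lemma sample_error:
  fixes z :: "nat \<Rightarrow> 'x \<times> 'y" and Co Cs :: "'h \<Rightarrow>\<^sub>L 'y" and g :: "real \<Rightarrow> real" and m n :: nat
  defines "Ch \<equiv> emp_cov \<phi> \<beta> n z"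
  assumes n: "n \<ge> 1"
    and Co: "hilbert_schmidt Co" and Cs: "Cs = Co o\<^sub>L fun_calc \<psi> C"
    and E1: "sqrt (weighted_ip op.R (\<Sum>i<n. (\<beta> (fst (z i)) *\<^sub>R tensor_op (\<phi> (fst (z i))) (\<phi> (fst (z i))) - C))
               (\<Sum>i<n. (\<beta> (fst (z i)) *\<^sub>R tensor_op (\<phi> (fst (z i))) (\<phi> (fst (z i))) - C))) / real n \<le> eps1"
    and E2: "sqrt (weighted_ip op.R (\<Sum>i<n. \<beta> (fst (z i)) *\<^sub>R tensor_op (\<phi> (fst (z i))) (snd (z i) - Cs (\<phi> (fst (z i)))))
               (\<Sum>i<n. \<beta> (fst (z i)) *\<^sub>R tensor_op (\<phi> (fst (z i))) (snd (z i) - Cs (\<phi> (fst (z i)))))) / real n \<le> eps2"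
    and eps1: "eps1 \<le> sqrt lam / 2" and s: "b * \<kappa>\<^sup>2 \<le> s" "\<kappa>\<^sup>2 \<le> s"
    and \<psi>: "bounded (\<psi> ` {0..s})" "\<And>\<mu>. \<mu> \<in> {0..s} \<Longrightarrow> \<bar>\<psi> \<mu>\<bar> \<le> M0 * (\<mu> + lam) powr (real m + \<theta>)" "M0 \<ge> 0"
    and \<theta>: "0 \<le> \<theta>" "\<theta> < 1" and \<nu>: "\<nu> = real m + \<theta> + 1 / 2"
    and r: "\<And>\<sigma> t. \<sigma> \<in> {0..s} \<Longrightarrow> 0 \<le> t \<Longrightarrow> t \<le> \<nu> \<Longrightarrow> \<bar>1 - \<sigma> * g \<sigma>\<bar> * (\<sigma> + lam) powr t \<le> 2 powr t * \<Gamma> * lam powr t" "\<Gamma> \<ge> 0"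
    and g: "bounded (g ` {0..s})" "\<And>\<sigma>. \<sigma> \<in> {0<..s} \<Longrightarrow> \<bar>g \<sigma>\<bar> * (\<sigma> + lam) \<le> G" "G \<ge> 0"
  shows "sqrt (\<integral>x. (norm (Cs (\<phi> x) - (emp_cross_cov \<phi> \<beta> n z o\<^sub>L fun_calc g Ch) (\<phi> x)))\<^sup>2 \<partial>Q)
     \<le> 2 powr (2 * \<nu> - real m) * M0 * \<Gamma> * lam powr \<nu> * hs_norm Co
        + real m * 2 ^ m * \<Gamma> * eps1 * hs_norm Cs + 2 * G * eps2"
proof -
  have n0: "real n > 0" using n by simp
  have Ch_apply: "Ch v = (1 / real n) *\<^sub>R (\<Sum>i<n. (\<beta> (fst (z i)) * (v \<bullet> \<phi> (fst (z i)))) *\<^sub>R \<phi> (fst (z i)))" for v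
    by (simp add: Ch_def emp_cov_def blinfun.scaleR_left blinfun.sum_left tensor_op_apply)
  have Ch_inner: "Ch u \<bullet> v = (1 / real n) * (\<Sum>i<n. \<beta> (fst (z i)) * (u \<bullet> \<phi> (fst (z i))) * (v \<bullet> \<phi> (fst (z i))))" for u v
    by (simp add: Ch_apply inner_sum_left inner_sum_right inner_commute[of _ v])
  have symCh: "symmetric Ch" unfolding symmetric_def
  proof (intro allI)
    fix u v
    have "Ch u \<bullet> v = Ch v \<bullet> u" unfolding Ch_inner by (simp add: mult_ac)
    then show "Ch u \<bullet> v = u \<bullet> Ch v" by (simp add: inner_commute)
  qed
  have Ch_nonneg: "Ch v \<bullet> v \<ge> 0" for v
  proof -
    have "0 \<le> \<beta> x * (v \<bullet> \<phi> x) * (v \<bullet> \<phi> x)" for x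
      using mult_nonneg_nonneg[OF \<beta>_bound(1) zero_le_square] by (simp add: mult.assoc)
    then show ?thesis unfolding Ch_inner using n0 by (simp add: sum_nonneg)
  qed
  have rank: "\<exists>B. finite B \<and> range (blinfun_apply Ch) \<subseteq> span B"
  proof (intro exI conjI)
    show "range (blinfun_apply Ch) \<subseteq> span ((\<lambda>i. \<phi> (fst (z i))) ` {..<n})"
      unfolding Ch_apply by (auto intro!: span_scale span_sum intro: span_base)
  qed simp
  have norm_Ch: "norm (Ch v) \<le> (b * \<kappa>\<^sup>2) * norm v" for v
  proof -
    have "norm (Ch v) = (1 / real n) * norm (\<Sum>i<n. (\<beta> (fst (z i)) * (v \<bullet> \<phi> (fst (z i)))) *\<^sub>R \<phi> (fst (z i)))"
      unfolding Ch_apply using n0 by simp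
    also have "\<dots> \<le> (1 / real n) * (\<Sum>i<n. norm ((\<beta> (fst (z i)) * (v \<bullet> \<phi> (fst (z i)))) *\<^sub>R \<phi> (fst (z i))))"
      by (intro mult_left_mono norm_sum) (use n0 in simp)
    also have "\<dots> \<le> (1 / real n) * (\<Sum>i<n. b * (norm v * \<kappa>) * \<kappa>)"
    proof (intro mult_left_mono sum_mono)
      fix i
      show "norm ((\<beta> (fst (z i)) * (v \<bullet> \<phi> (fst (z i)))) *\<^sub>R \<phi> (fst (z i))) \<le> b * (norm v * \<kappa>) * \<kappa>"
        unfolding norm_scaleR abs_mult using \<beta>_bound inner_\<phi>_bound \<phi>_bound \<kappa>_nonneg b_nonneg
        by (intro mult_mono) auto
    qed (use n0 in simp)
    also have "\<dots> = (b * \<kappa>\<^sup>2) * norm v" using n0 by (simp add: power2_eq_square)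
    finally show ?thesis .
  qed
  \<comment> \<open>Both spectra lie in \<open>[0, s]\<close>, the interval on which
    \<open>g\<close> and \<open>\<psi>\<close> are controlled.\<close>
  have evCh: "\<sigma> \<in> {0..s}" if "\<sigma> \<in> eigenvalues Ch" for \<sigma>
    using eigenvalue_nonneg[OF Ch_nonneg that] eigenvalue_le[OF norm_Ch that] s by auto
  have evC: "\<mu> \<in> {0..s}" if "\<mu> \<in> eigenvalues C" for \<mu>
    using eigenvalue_nonneg[OF C_nonneg that] eigenvalue_le[OF norm_C_le that] s by auto
  have bdd\<psi>: "bounded (\<psi> ` eigenvalues C)" by (rule bounded_subset[OF \<psi>(1)]) (use evC in blast)
  have bddg: "bounded (g ` eigenvalues Ch)" by (rule bounded_subset[OF g(1)]) (use evCh in blast)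
  let ?r = "\<lambda>\<sigma>. 1 - \<sigma> * g \<sigma>"
  have "\<bar>?r \<sigma>\<bar> \<le> \<Gamma>" if "\<sigma> \<in> eigenvalues Ch" for \<sigma>
    using r(1)[OF evCh[OF that], of 0] evCh[OF that] lam \<theta> \<nu> by simp
  then have bddr: "bounded (?r ` eigenvalues Ch)" by (auto simp: bounded_iff)
  define V1 where "V1 = (\<Sum>i<n. (\<beta> (fst (z i)) *\<^sub>R tensor_op (\<phi> (fst (z i))) (\<phi> (fst (z i))) - C))"
  have V1: "(1 / real n) *\<^sub>R V1 = Ch - C"
    using n0 by (simp add: V1_def sum_subtractf scaleR_diff_right Ch_def emp_cov_def sum_constant_scaleR)
  have V1_hs: "V1 \<in> hs_space" unfolding V1_def
    by (intro subspace_sum subspace_diff subspace_scale subspace_hs_space tensor_op_hs C_in_hs)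
  have ip1: "sqrt (weighted_ip op.R V1 V1) \<le> real n * eps1" using E1 n0 by (simp add: V1_def field_simps)
  interpret ipy: semi_inner_space "hs_space :: ('y \<Rightarrow>\<^sub>L 'h) set" "weighted_ip op.R" by (rule op.weighted_ip_semi_inner)
  interpret iph: semi_inner_space "hs_space :: ('h \<Rightarrow>\<^sub>L 'h) set" "weighted_ip op.R" by (rule op.weighted_ip_semi_inner)
  have eps1_0: "eps1 \<ge> 0"
    using E1 n0 iph.ip_nonneg[OF V1_hs] unfolding V1_def[symmetric]
    by (meson divide_nonneg_pos order.trans real_sqrt_ge_zero)
  interpret po: perturbed_operator C Ch lam eps1
  proof unfold_locales
    fix u v
    have "(C u - Ch u) \<bullet> v = - (1 / real n) * (V1 u \<bullet> v)"
      using arg_cong[OF V1, of "\<lambda>A. blinfun_apply A u \<bullet> v"]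
      by (simp add: blinfun.scaleR_left blinfun.diff_left inner_diff_left)
    also have "\<dots> \<le> (1 / real n) * \<bar>V1 u \<bullet> v\<bar>"
      using mult_left_mono[OF abs_ge_minus_self[of "V1 u \<bullet> v"], of "1 / real n"] n0 by simp
    also have "\<dots> \<le> (1 / real n) * (sqrt (weighted_ip op.R V1 V1) * norm u * sqrt (op.T v \<bullet> v))"
      using op.weighted_ip_operator_bound[OF V1_hs] n0 by (intro mult_left_mono) auto
    also have "\<dots> \<le> (1 / real n) * ((real n * eps1) * norm u * sqrt (op.T v \<bullet> v))"
      using ip1 n0 by (intro mult_left_mono mult_right_mono) (auto simp: op.T_inner_nonneg)
    finally show "(C u - Ch u) \<bullet> v \<le> eps1 * norm u * sqrt (C v \<bullet> v + lam * (v \<bullet> v))"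
      using n0 by (simp add: op.T_inner)
  qed (use symCh Ch_nonneg lam rank eps1 eps1_0 in auto)
  define a where "a k = adj Co (onb_seq k)" for k
  have sym\<psi>: "symmetric (fun_calc \<psi> C)"
    unfolding symmetric_def using fun_calc_symmetric[OF C_symmetric bdd\<psi>] by blast
  have symr: "symmetric (fun_calc ?r Ch)"
    unfolding symmetric_def using fun_calc_symmetric[OF symCh bddr] by blast
  have symg: "symmetric (fun_calc g Ch)"
    unfolding symmetric_def using fun_calc_symmetric[OF symCh bddg] by blast
  have hsCs: "hilbert_schmidt Cs" and adjCs: "adj Cs = fun_calc \<psi> C o\<^sub>L adj Co"
    unfolding Cs using hilbert_schmidt_comp_symmetric[OF Co sym\<psi>] by auto
  have adjCsr: "adj (Cs o\<^sub>L fun_calc ?r Ch) = fun_calc ?r Ch o\<^sub>L adj Cs"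
    by (rule hilbert_schmidt_comp_symmetric(2)[OF hsCs symr])
  define X where "X = 2 powr (2 * \<nu> - real m) * M0 * \<Gamma> * lam powr \<nu>"
  define Y where "Y = real m * 2 ^ m * \<Gamma> * eps1"
  have X0: "X \<ge> 0" and Y0: "Y \<ge> 0" using \<psi>(3) r(2) eps1_0 by (auto simp: X_def Y_def)
  \<comment> \<open>\<open>residual_bound\<close> has one term proportional to
    \<open>norm (adj Co e)\<close> and one proportional to \<open>norm (adj Cs e)\<close>; squaring
    and summing over the basis turns them into the two Hilbert-Schmidt norms.\<close>
  have bias: "(\<integral>x. (norm ((Cs o\<^sub>L fun_calc ?r Ch) (\<phi> x)))\<^sup>2 \<partial>Q) \<le> (X * hs_norm Co + Y * hs_norm Cs)\<^sup>2"
  proof (rule square_sum_from_weighted)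
    fix \<tau> :: real assume \<tau>: "\<tau> > 0"
    show "(\<integral>x. (norm ((Cs o\<^sub>L fun_calc ?r Ch) (\<phi> x)))\<^sup>2 \<partial>Q)
      \<le> (1 + \<tau>) * (X * hs_norm Co)\<^sup>2 + (1 + 1 / \<tau>) * (Y * hs_norm Cs)\<^sup>2"
    proof (rule sums_le[OF _ L2_sums])
      show "(\<lambda>k. (1 + \<tau>) * (X\<^sup>2 * (norm (adj Co (onb_seq k)))\<^sup>2) + (1 + 1 / \<tau>) * (Y\<^sup>2 * (norm (adj Cs (onb_seq k)))\<^sup>2))
         sums ((1 + \<tau>) * (X * hs_norm Co)\<^sup>2 + (1 + 1 / \<tau>) * (Y * hs_norm Cs)\<^sup>2)"
        unfolding power_mult_distrib by (intro sums_add sums_mult hs_adj_sums Co hsCs)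
      fix k
      define w where "w = fun_calc ?r Ch (fun_calc \<psi> C (a k))"
      have adjw: "adj (Cs o\<^sub>L fun_calc ?r Ch) (onb_seq k) = w" by (simp add: adjCsr adjCs w_def a_def)
      have "sqrt (C w \<bullet> w) \<le> X * norm (a k) + Y * norm (fun_calc \<psi> C (a k))"
        unfolding w_def X_def Y_def
        by (rule po.residual_bound[OF bdd\<psi> _ \<psi>(3) \<theta> \<nu> _ bddr r(2)]) (use \<psi>(2) evC r(1) evCh in auto)
      then have "(sqrt (C w \<bullet> w))\<^sup>2 \<le> (X * norm (a k) + Y * norm (fun_calc \<psi> C (a k)))\<^sup>2"
        by (rule power_mono) (simp add: C_nonneg)
      also have "\<dots> \<le> (1 + \<tau>) * (X * norm (a k))\<^sup>2 + (1 + 1 / \<tau>) * (Y * norm (fun_calc \<psi> C (a k)))\<^sup>2"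
        by (rule add_square_weighted[OF \<tau>])
      finally show "C (adj (Cs o\<^sub>L fun_calc ?r Ch) (onb_seq k)) \<bullet> adj (Cs o\<^sub>L fun_calc ?r Ch) (onb_seq k)
        \<le> (1 + \<tau>) * (X\<^sup>2 * (norm (adj Co (onb_seq k)))\<^sup>2) + (1 + 1 / \<tau>) * (Y\<^sup>2 * (norm (adj Cs (onb_seq k)))\<^sup>2)"
        unfolding adjw by (simp add: C_nonneg power_mult_distrib adjCs a_def)
    qed
  qed (auto intro!: mult_nonneg_nonneg X0 Y0 hs_norm_nonneg)
  define V2 where "V2 = (\<Sum>i<n. \<beta> (fst (z i)) *\<^sub>R tensor_op (\<phi> (fst (z i))) (snd (z i) - Cs (\<phi> (fst (z i)))))"
  \<comment> \<open>\<open>W\<close> is the negative of the averaged noise; its adjoint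
    \<open>V\<close> has weighted norm at most \<open>eps2\<close>.\<close>
  define W where "W = (Cs o\<^sub>L Ch) - emp_cross_cov \<phi> \<beta> n z"
  have V2_hs: "V2 \<in> hs_space" unfolding V2_def
    by (intro subspace_sum subspace_scale subspace_hs_space tensor_op_hs)
  define V where "V = (- (1 / real n)) *\<^sub>R V2"
  have V_hs: "V \<in> hs_space" unfolding V_def by (intro subspace_scale subspace_hs_space V2_hs)
  have V_apply: "V f = (- (1 / real n)) *\<^sub>R (\<Sum>i<n. (\<beta> (fst (z i)) * (f \<bullet> (snd (z i) - Cs (\<phi> (fst (z i)))))) *\<^sub>R \<phi> (fst (z i)))" for f
    by (simp add: V_def V2_def blinfun.minus_left blinfun.scaleR_left blinfun.sum_left tensor_op_apply)
  have adjW: "adj W = V"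
  proof (rule adj_eqI)
    fix u :: 'h and f :: 'y
    have "W u \<bullet> f = (1 / real n) * (\<Sum>i<n. \<beta> (fst (z i)) * (u \<bullet> \<phi> (fst (z i))) * (Cs (\<phi> (fst (z i))) \<bullet> f))
       - (1 / real n) * (\<Sum>i<n. \<beta> (fst (z i)) * (u \<bullet> \<phi> (fst (z i))) * (snd (z i) \<bullet> f))"
      by (simp add: W_def blinfun.diff_left Ch_apply blinfun.scaleR_right blinfun.sum_right emp_cross_cov_def
          blinfun.scaleR_left blinfun.sum_left tensor_op_apply inner_diff_left inner_sum_left)
    also have "\<dots> = - (1 / real n) * (\<Sum>i<n. \<beta> (fst (z i)) * (f \<bullet> (snd (z i) - Cs (\<phi> (fst (z i))))) * (u \<bullet> \<phi> (fst (z i))))"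
    proof -
      have "\<beta> (fst (z i)) * (f \<bullet> (snd (z i) - Cs (\<phi> (fst (z i))))) * (u \<bullet> \<phi> (fst (z i)))
        = \<beta> (fst (z i)) * (u \<bullet> \<phi> (fst (z i))) * (snd (z i) \<bullet> f)
          - \<beta> (fst (z i)) * (u \<bullet> \<phi> (fst (z i))) * (Cs (\<phi> (fst (z i))) \<bullet> f)" for i
        unfolding inner_commute[of f] inner_diff_left right_diff_distrib left_diff_distrib by (simp only: mult_ac)
      then show ?thesis by (simp only: sum_subtractf right_diff_distrib)
    qed
    also have "\<dots> = u \<bullet> V f" by (simp add: V_apply inner_sum_right)
    finally show "W u \<bullet> f = u \<bullet> V f" .
  qed
  have adjWg: "adj (W o\<^sub>L fun_calc g Ch) = fun_calc g Ch o\<^sub>L V"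
    by (rule adj_eqI) (metis adj_inner adjW blinfun_apply_blinfun_compose symmetricD[OF symg])
  \<comment> \<open>\<open>V f\<close> is a combination of the vectors
    \<open>\<beta>_i \<phi>_i\<close>. For \<open>w\<close> in the kernel of \<open>Ch\<close> the
    sum of \<open>\<beta>_i * (w \<bullet> \<phi>_i)\<^sup>2\<close> is 0, so \<open>w\<close> is
    orthogonal to each of them. This keeps the value \<open>g 0\<close> out of the noise
    bound.\<close>
  have V_ker: "eproj Ch 0 (V f) = 0" for f
  proof (rule eprojI)
    fix w assume "w \<in> eigenspace Ch 0"
    then have "Ch w \<bullet> w = 0" by (simp add: eigenspace_def)
    then have "(\<Sum>i<n. \<beta> (fst (z i)) * (w \<bullet> \<phi> (fst (z i))) * (w \<bullet> \<phi> (fst (z i)))) = 0"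
      using n0 unfolding Ch_inner by simp
    then have "\<forall>i\<in>{..<n}. \<beta> (fst (z i)) * (w \<bullet> \<phi> (fst (z i))) * (w \<bullet> \<phi> (fst (z i))) = 0"
      by (subst (asm) sum_nonneg_eq_0_iff) (use \<beta>_bound in \<open>auto simp: mult.assoc\<close>)
    then have "\<forall>i\<in>{..<n}. \<beta> (fst (z i)) * (w \<bullet> \<phi> (fst (z i))) = 0" by auto
    then have "(\<Sum>i<n. (\<beta> (fst (z i)) * (f \<bullet> (snd (z i) - Cs (\<phi> (fst (z i)))))) * (\<phi> (fst (z i)) \<bullet> w)) = 0"
      by (intro sum.neutral) (auto simp: inner_commute[of w])
    then show "0 \<bullet> w = V f \<bullet> w"
      by (simp add: V_apply inner_sum_left)
  qed (simp add: subspace_0 subspace_eigenspace)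
  have ip2: "weighted_ip op.R V V \<le> eps2\<^sup>2"
  proof -
    have "weighted_ip op.R V V = weighted_ip op.R V2 V2 / (real n)\<^sup>2"
    proof -
      have "weighted_ip op.R (c *\<^sub>R V2) (c *\<^sub>R V2) = c * (c * weighted_ip op.R V2 V2)" for c
        using V2_hs subspace_scale[OF subspace_hs_space V2_hs] by (simp add: ipy.ip_scale ipy.ip_scale_right)
      then show ?thesis unfolding V_def by (simp only:) (simp add: power2_eq_square)
    qed
    also have "\<dots> = (sqrt (weighted_ip op.R V2 V2) / real n)\<^sup>2"
      using ipy.ip_nonneg[OF V2_hs] by (simp add: power_divide)
    also have "\<dots> \<le> eps2\<^sup>2"
      using E2 ipy.ip_nonneg[OF V2_hs] unfolding V2_def[symmetric] by (intro power_mono) auto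
    finally show ?thesis .
  qed
  have eps2_0: "eps2 \<ge> 0"
    using E2 n0 ipy.ip_nonneg[OF V2_hs] unfolding V2_def[symmetric]
    by (meson divide_nonneg_pos order.trans real_sqrt_ge_zero)
  have variance: "(\<integral>x. (norm ((W o\<^sub>L fun_calc g Ch) (\<phi> x)))\<^sup>2 \<partial>Q) \<le> (2 * G * eps2)\<^sup>2"
  proof -
    have "(\<integral>x. (norm ((W o\<^sub>L fun_calc g Ch) (\<phi> x)))\<^sup>2 \<partial>Q) \<le> 4 * G\<^sup>2 * weighted_ip op.R V V"
    proof (rule sums_le[OF _ L2_sums])
      show "(\<lambda>k. 4 * G\<^sup>2 * (V (onb_seq k) \<bullet> op.R (V (onb_seq k)))) sums (4 * G\<^sup>2 * weighted_ip op.R V V)"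
        unfolding weighted_ip_def by (intro sums_mult summable_sums op.weighted_ip_summable V_hs)
      fix k
      have "C (fun_calc g Ch (V (onb_seq k))) \<bullet> fun_calc g Ch (V (onb_seq k)) \<le> 4 * G\<^sup>2 * (op.R (V (onb_seq k)) \<bullet> V (onb_seq k))"
        by (rule po.filter_bound[OF bddg _ V_ker]) (use g(2) evCh in auto)
      then show "C (adj (W o\<^sub>L fun_calc g Ch) (onb_seq k)) \<bullet> adj (W o\<^sub>L fun_calc g Ch) (onb_seq k)
        \<le> 4 * G\<^sup>2 * (V (onb_seq k) \<bullet> op.R (V (onb_seq k)))"
        by (simp add: adjWg inner_commute)
    qed
    also have "\<dots> \<le> 4 * G\<^sup>2 * eps2\<^sup>2" by (intro mult_left_mono ip2) simp
    finally show ?thesis by (simp add: power_mult_distrib)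
  qed
  \<comment> \<open>\<open>Cs = Cs r(Ch) + Cs Ch g(Ch)\<close>; subtracting the estimator leaves the
    bias and \<open>W g(Ch)\<close>.\<close>
  have split: "Cs (\<phi> x) - (emp_cross_cov \<phi> \<beta> n z o\<^sub>L fun_calc g Ch) (\<phi> x)
     = (Cs o\<^sub>L fun_calc ?r Ch) (\<phi> x) + (W o\<^sub>L fun_calc g Ch) (\<phi> x)" for x
    by (simp add: po.residual_eq[OF bddg bddr] W_def blinfun.diff_left blinfun.diff_right)
  have "(\<integral>x. (norm (Cs (\<phi> x) - (emp_cross_cov \<phi> \<beta> n z o\<^sub>L fun_calc g Ch) (\<phi> x)))\<^sup>2 \<partial>Q)
     \<le> ((X * hs_norm Co + Y * hs_norm Cs) + 2 * G * eps2)\<^sup>2"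
  proof (rule square_sum_from_weighted)
    fix \<tau> :: real assume \<tau>: "\<tau> > 0"
    let ?A = "Cs o\<^sub>L fun_calc ?r Ch" and ?B = "W o\<^sub>L fun_calc g Ch"
    have "(\<integral>x. (norm (Cs (\<phi> x) - (emp_cross_cov \<phi> \<beta> n z o\<^sub>L fun_calc g Ch) (\<phi> x)))\<^sup>2 \<partial>Q)
       = (\<integral>x. (norm ((?A + ?B) (\<phi> x)))\<^sup>2 \<partial>Q)" unfolding split by (simp add: blinfun.add_left)
    also have "\<dots> \<le> (\<integral>x. (1 + \<tau>) * (norm (?A (\<phi> x)))\<^sup>2 + (1 + 1 / \<tau>) * (norm (?B (\<phi> x)))\<^sup>2 \<partial>Q)"
    proof (rule integral_mono)
      show "(norm ((?A + ?B) (\<phi> x)))\<^sup>2 \<le> (1 + \<tau>) * (norm (?A (\<phi> x)))\<^sup>2 + (1 + 1 / \<tau>) * (norm (?B (\<phi> x)))\<^sup>2" for x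
        unfolding blinfun.add_left by (rule norm_add_square_weighted[OF \<tau>])
      show "integrable Q (\<lambda>x. (1 + \<tau>) * (norm (?A (\<phi> x)))\<^sup>2 + (1 + 1 / \<tau>) * (norm (?B (\<phi> x)))\<^sup>2)"
        by (intro Bochner_Integration.integrable_add integrable_mult_right L2_integrable)
    qed (rule L2_integrable)
    also have "\<dots> = (1 + \<tau>) * (\<integral>x. (norm (?A (\<phi> x)))\<^sup>2 \<partial>Q) + (1 + 1 / \<tau>) * (\<integral>x. (norm (?B (\<phi> x)))\<^sup>2 \<partial>Q)"
      using L2_integrable[of ?A] L2_integrable[of ?B]
      by (subst Bochner_Integration.integral_add) (auto simp del: blinfun_apply_blinfun_compose)
    also have "\<dots> \<le> (1 + \<tau>) * (X * hs_norm Co + Y * hs_norm Cs)\<^sup>2 + (1 + 1 / \<tau>) * (2 * G * eps2)\<^sup>2"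
      using \<tau> by (intro add_mono mult_left_mono bias variance) auto
    finally show "(\<integral>x. (norm (Cs (\<phi> x) - (emp_cross_cov \<phi> \<beta> n z o\<^sub>L fun_calc g Ch) (\<phi> x)))\<^sup>2 \<partial>Q)
      \<le> (1 + \<tau>) * (X * hs_norm Co + Y * hs_norm Cs)\<^sup>2 + (1 + 1 / \<tau>) * (2 * G * eps2)\<^sup>2" .
  qed (auto intro!: mult_nonneg_nonneg add_nonneg_nonneg X0 Y0 hs_norm_nonneg g(3) eps2_0)
  then have "sqrt (\<integral>x. (norm (Cs (\<phi> x) - (emp_cross_cov \<phi> \<beta> n z o\<^sub>L fun_calc g Ch) (\<phi> x)))\<^sup>2 \<partial>Q)
     \<le> (X * hs_norm Co + Y * hs_norm Cs) + 2 * G * eps2"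
    by (rule real_le_lsqrt[rotated -1])
      (auto intro!: mult_nonneg_nonneg add_nonneg_nonneg X0 Y0 hs_norm_nonneg g(3) eps2_0)
  then show ?thesis by (simp add: X_def Y_def)
qed

end

theorem theorem16:
  fixes k :: "'x::{second_countable_topology,t2_space} \<Rightarrow> 'x \<Rightarrow> real"
    and fn :: "'h::{real_inner,banach,second_countable_topology} \<Rightarrow> 'x \<Rightarrow> real"
    and p q :: "('x \<times> 'y::{real_inner,banach,second_countable_topology}) measure"
    and K :: "'x \<Rightarrow> 'y measure"
    and \<beta> :: "'x \<Rightarrow> real"
    and g :: "real \<Rightarrow> real \<Rightarrow> real"
    and \<phi>\<^sub>i :: "real \<Rightarrow> real"
    and C\<^sub>o :: "'h \<Rightarrow>\<^sub>L 'y"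
    and \<delta> lam s b \<kappa> M' B D \<gamma> \<nu> \<gamma>\<^sub>\<nu> c :: real
    and n :: nat
  defines "\<phi> \<equiv> feature_map k fn"
    and "p\<^sub>X \<equiv> marginal_X p"
    and "q\<^sub>X \<equiv> marginal_X q"
    and "C\<^sub>X \<equiv> cov_op (marginal_X q) (feature_map k fn)"
  defines "\<N> \<equiv> effective_dim C\<^sub>X lam"
    and "C\<^sub>s \<equiv> C\<^sub>o o\<^sub>L fun_calc \<phi>\<^sub>i C\<^sub>X"
  defines "M \<equiv> M' + \<kappa> * hs_norm C\<^sub>s"
    and "\<nu>\<^sub>b \<equiv> real_of_int \<lfloor>\<nu> - 1 / 2\<rfloor>"
    and "B\<^sub>n \<equiv> 2 * (2 * b * \<kappa>\<^sup>2 / (sqrt lam * real n) + sqrt (b * \<kappa>\<^sup>2 * \<N> / real n))"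
  defines "A\<^sub>1 \<equiv> 2 powr (2 * \<nu> - \<nu>\<^sub>b + 2) * (\<gamma>\<^sub>\<nu> + \<gamma>) * max 1 (1 / c) * \<nu>\<^sub>b * b * \<kappa>\<^sup>2 * hs_norm C\<^sub>s
                   + 10 * b * M * \<kappa> * (B + D)"
    and "A\<^sub>2 \<equiv> 2 powr (2 * \<nu> - \<nu>\<^sub>b + 1) * (\<gamma>\<^sub>\<nu> + \<gamma>) * max 1 (1 / c) * \<nu>\<^sub>b * sqrt b * \<kappa> * hs_norm C\<^sub>s
                   + 5 * M * sqrt b * (B + D)"
    and "A\<^sub>3 \<equiv> 2 powr (2 * \<nu> - \<nu>\<^sub>b) * (\<gamma>\<^sub>\<nu> + \<gamma>) * max 1 (1 / c) * hs_norm C\<^sub>o"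
  assumes X_lc: "locally_compact_space (euclidean :: 'x topology)"
    and Y_infdim: "\<nexists>S :: 'y set. finite S \<and> span S = UNIV"
    and rkhs: "is_rkhs k fn"
    and \<phi>_meas: "\<phi> \<in> borel_measurable borel"
    and shift: "covariate_shift p q K"
    and \<beta>_meas: "\<beta> \<in> borel_measurable borel"
    and \<delta>: "0 < \<delta>" "\<delta> < 1"
    and n: "n \<ge> 1"
    and \<kappa>: "\<kappa> \<ge> 0"
    and s: "b * \<kappa>\<^sup>2 \<le> s"
    and lam: "0 < lam" "lam \<le> s"
    and reg: "regularization_family s g B D \<gamma>"
    and qual: "is_qualification s g \<nu>" "qualification_bound s g \<nu> \<gamma>\<^sub>\<nu>"
    and B\<^sub>n_le: "B\<^sub>n * ln (2 / \<delta>) \<le> sqrt lam / 2"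
    and k_bound: "\<And>x. k x x \<le> \<kappa>\<^sup>2"
    and density: "q\<^sub>X = density p\<^sub>X (\<lambda>x. ennreal (\<beta> x))"
    and \<beta>_bound: "\<And>x. 0 \<le> \<beta> x" "\<And>x. \<beta> x \<le> b"
    and y_bound: "AE z in p. norm (snd z) \<le> M'"
    and C\<^sub>o: "hilbert_schmidt C\<^sub>o"
    and index: "index_function \<phi>\<^sub>i"
    and source: "AE x in q\<^sub>X. regression_fun K x = blinfun_apply C\<^sub>s (\<phi> x)"
    and cover: "covers s \<nu> c (\<lambda>t. \<phi>\<^sub>i t * sqrt t)"
  shows "\<exists>E \<in> sets (Pi\<^sub>M {..<n} (\<lambda>_. p)).
           measure (Pi\<^sub>M {..<n} (\<lambda>_. p)) E \<ge> 1 - \<delta> \<and>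
           (\<forall>z\<in>E.
              in_L2 q\<^sub>X (\<lambda>x. regression_fun K x - estimator \<phi> \<beta> g lam n z x) \<and>
              L2_norm q\<^sub>X (\<lambda>x. regression_fun K x - estimator \<phi> \<beta> g lam n z x)
                \<le> (A\<^sub>1 / real n * sqrt (1 / lam) + A\<^sub>2 * sqrt (\<N> / real n)) * ln (2 / \<delta>)
                   + A\<^sub>3 * sqrt lam * \<phi>\<^sub>i lam)"
proof -
  define L where "L = ln (2 / \<delta>)"
  \<comment> \<open>\<open>\<delta> < 1\<close> gives the lower bound on the level under which
    \<open>tail_level_union\<close> holds.\<close>
  have L2: "L \<ge> ln 2" using \<delta> unfolding L_def by (subst ln_le_cancel_iff) (auto simp: field_simps)
  have L0: "L > 0" using L2 ln_gt_zero[of "2::real"] by linarith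
  have expL: "2 * exp (- L) = \<delta>" using \<delta> by (simp add: L_def exp_minus)
  have s0: "s > 0" using lam by linarith
  have n0: "real n > 0" using n by simp

  have p: "prob_space p" "sets p = sets (borel \<Otimes>\<^sub>M borel)" and q: "prob_space q" "sets q = sets (borel \<Otimes>\<^sub>M borel)"
    and K: "K \<in> borel \<rightarrow>\<^sub>M prob_algebra borel" "has_conditional p K"
    using shift by (auto simp: covariate_shift_def)
  have \<phi>_inner: "\<phi> x \<bullet> \<phi> x = k x x" for x
  proof -
    have inj: "inj fn" and "\<exists>u. fn u = k x \<and> (\<forall>h. fn h x = h \<bullet> u)" using rkhs unfolding is_rkhs_def by auto
    then obtain u where u: "fn u = k x" "\<And>h. fn h x = h \<bullet> u" by blast
    have "\<phi> x = u" unfolding \<phi>_def feature_map_def u(1)[symmetric] by (rule the_inv_f_f[OF inj])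
    then show ?thesis using u(1) u(2)[of u] by simp
  qed
  have \<phi>_bd: "norm (\<phi> x) \<le> \<kappa>" for x
    using \<phi>_inner[of x] k_bound[of x] \<kappa> by (simp add: norm_eq_sqrt_inner real_le_lsqrt)
  have fst_q: "fst \<in> q \<rightarrow>\<^sub>M borel" by (simp add: measurable_cong_sets[OF q(2) refl])
  have cs: "covariate_sampling q\<^sub>X \<phi> \<kappa> p \<beta> b lam"
  proof (intro covariate_sampling.intro feature_measure.intro feature_measure_axioms.intro covariate_sampling_axioms.intro)
    show "prob_space q\<^sub>X" unfolding q\<^sub>X_def marginal_X_def by (rule prob_space.prob_space_distr[OF q(1) fst_q])
    show "sets q\<^sub>X = sets borel" by (simp add: q\<^sub>X_def marginal_X_def)
    show "q\<^sub>X = density (marginal_X p) (\<lambda>x. ennreal (\<beta> x))" using density by (simp add: p\<^sub>X_def)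
  qed (use p \<phi>_meas \<phi>_bd \<beta>_meas \<beta>_bound lam in auto)
  interpret cs: covariate_sampling q\<^sub>X \<phi> \<kappa> p \<beta> b lam by (rule cs)
  have C_eq: "C\<^sub>X = cov_op q\<^sub>X \<phi>" by (simp add: C\<^sub>X_def q\<^sub>X_def \<phi>_def)
  have N_eq: "\<N> = cs.N" unfolding \<N>_def C_eq by (rule cs.N_eq)
  have N0: "\<N> \<ge> 0" unfolding N_eq by (rule cs.N_nonneg)
  \<comment> \<open>The weights integrate to 1, so their upper bound is at least 1; hence
    \<open>\<kappa>\<^sup>2 \<le> b * \<kappa>\<^sup>2 \<le> s\<close>, and the spectrum of
    \<open>C\<^sub>X\<close> also lies in \<open>[0, s]\<close>.\<close>
  have b1: "b \<ge> 1"
  proof -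
    have "1 = (\<integral>z. \<beta> (fst z) * 1 \<partial>p)" using cs.change_measure[of "\<lambda>_. 1"] by (simp add: cs.prob_space)
    also have "\<dots> \<le> (\<integral>z. b \<partial>p)"
    proof (rule integral_mono)
      show "integrable p (\<lambda>z. \<beta> (fst z) * 1)"
        by (rule cs.P_integrable[where c = b]) (use \<beta>_bound measurable_compose[OF cs.fst_P \<beta>_meas] in auto)
    qed (use \<beta>_bound in auto)
    also have "\<dots> = b" by (simp add: cs.pr.prob_space)
    finally show ?thesis .
  qed
  have \<kappa>s: "\<kappa>\<^sup>2 \<le> s" using s b1 mult_right_mono[of 1 b "\<kappa>\<^sup>2"] by simp

  have B0: "B > 0" "D > 0" using reg by (simp_all add: regularization_family_def)
  have regD: "\<bar>\<sigma> * g lam \<sigma>\<bar> \<le> D" "\<bar>g lam \<sigma>\<bar> \<le> B / lam" "\<bar>1 - \<sigma> * g lam \<sigma>\<bar> \<le> \<gamma>"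
    if "\<sigma> \<in> {0<..s}" for \<sigma>
    using reg lam that unfolding regularization_family_def by auto
  have qb: "\<bar>1 - \<sigma> * g lam \<sigma>\<bar> * \<sigma> powr \<nu> \<le> \<gamma>\<^sub>\<nu> * lam powr \<nu>" if "\<sigma> \<in> {0<..s}" for \<sigma>
    using qual(2) lam that unfolding qualification_bound_def by auto
  \<comment> \<open>As \<open>\<sigma>\<close> tends to 0, \<open>\<sigma> * g lam \<sigma>\<close>
    is at most \<open>\<sigma> * (B / lam)\<close> and the residual tends to 1. The witness makes
    this product at most \<open>(1 - \<gamma>) / 2\<close>.\<close>
  have \<gamma>1: "\<gamma> \<ge> 1"
  proof (rule ccontr)
    assume neg: "\<not> \<gamma> \<ge> 1"
    define \<sigma> where "\<sigma> = min s ((1 - \<gamma>) * lam / (2 * B))"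
    have \<sigma>: "\<sigma> \<in> {0<..s}" using neg lam s0 B0 by (auto simp: \<sigma>_def)
    have "\<sigma> * (B / lam) \<le> ((1 - \<gamma>) * lam / (2 * B)) * (B / lam)"
      using B0 lam by (intro mult_right_mono) (auto simp: \<sigma>_def)
    also have "\<dots> = (1 - \<gamma>) / 2" using B0 lam by simp
    finally have 1: "\<sigma> * (B / lam) \<le> (1 - \<gamma>) / 2" .
    have 2: "\<bar>\<sigma> * g lam \<sigma>\<bar> \<le> \<sigma> * (B / lam)" using mult_left_mono[OF regD(2)[OF \<sigma>], of \<sigma>] \<sigma> by (simp add: abs_mult)
    have "\<sigma> * g lam \<sigma> \<le> (1 - \<gamma>) / 2" by (rule order.trans[OF abs_ge_self order.trans[OF 2 1]])
    moreover have "1 - \<sigma> * g lam \<sigma> \<le> \<gamma>" by (rule order.trans[OF abs_ge_self regD(3)[OF \<sigma>]])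
    ultimately show False using neg by argo
  qed
  have \<gamma>\<nu>0: "\<gamma>\<^sub>\<nu> \<ge> 0"
  proof -
    have "0 \<le> \<gamma>\<^sub>\<nu> * lam powr \<nu>" using qb[of s] s0 by (rule_tac order.trans) auto
    then show ?thesis using lam by (simp add: zero_le_mult_iff)
  qed

  have \<phi>i_cont: "continuous_on {0..} \<phi>\<^sub>i" and \<phi>i_mono: "strict_mono_on {0..} \<phi>\<^sub>i" and \<phi>i_0: "\<phi>\<^sub>i 0 = 0"
    using index by (auto simp: index_function_def)
  have \<phi>i_less: "\<phi>\<^sub>i x < \<phi>\<^sub>i y" if "0 \<le> x" "x < y" for x y
    using strict_mono_onD[OF \<phi>i_mono, of x y] that by auto
  have \<phi>i_le: "\<phi>\<^sub>i x \<le> \<phi>\<^sub>i y" if "0 \<le> x" "x \<le> y" for x y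
    using \<phi>i_less[of x y] that by (cases "x = y") auto
  have \<phi>i_pos: "\<phi>\<^sub>i x > 0" if "x > 0" for x using \<phi>i_less[of 0 x] that \<phi>i_0 by simp
  have c0: "c > 0" using cover by (simp add: covers_def)
  have cover': "c * (t powr \<nu> / (\<phi>\<^sub>i t * sqrt t)) \<le> \<sigma> powr \<nu> / (\<phi>\<^sub>i \<sigma> * sqrt \<sigma>)" if "0 < t" "t \<le> \<sigma>" "\<sigma> \<le> s" for t \<sigma>
  proof -
    have "c * (t powr \<nu> / (\<phi>\<^sub>i t * sqrt t)) \<le> (INF \<sigma>\<in>{t..s}. \<sigma> powr \<nu> / (\<phi>\<^sub>i \<sigma> * sqrt \<sigma>))"
      using cover that unfolding covers_def by auto
    also have "\<dots> \<le> \<sigma> powr \<nu> / (\<phi>\<^sub>i \<sigma> * sqrt \<sigma>)"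
    proof (rule cINF_lower)
      show "bdd_below ((\<lambda>\<sigma>. \<sigma> powr \<nu> / (\<phi>\<^sub>i \<sigma> * sqrt \<sigma>)) ` {t..s})"
        by (rule bdd_belowI2[of _ 0]) (use that \<phi>i_pos in \<open>auto intro!: divide_nonneg_nonneg mult_nonneg_nonneg simp: less_imp_le\<close>)
    qed (use that in auto)
    finally show ?thesis .
  qed
  have cover'': "\<phi>\<^sub>i \<sigma> * (c * t powr (\<nu> - 1/2)) \<le> \<phi>\<^sub>i t * \<sigma> powr (\<nu> - 1/2)" if "0 < t" "t \<le> \<sigma>" "\<sigma> \<le> s" for t \<sigma>
  proof -
    have eq: "x powr \<nu> / (\<phi>\<^sub>i x * sqrt x) = x powr (\<nu> - 1/2) / \<phi>\<^sub>i x" if "x > 0" for x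
      using that by (simp add: powr_diff powr_half_sqrt)
    have \<sigma>0: "\<sigma> > 0" using that by linarith
    have "c * (t powr (\<nu> - 1/2) / \<phi>\<^sub>i t) \<le> \<sigma> powr (\<nu> - 1/2) / \<phi>\<^sub>i \<sigma>"
      using cover'[OF that] unfolding eq[OF that(1)] eq[OF \<sigma>0] .
    then show ?thesis using \<phi>i_pos[OF that(1)] \<phi>i_pos[OF \<sigma>0] by (simp add: field_simps)
  qed
  \<comment> \<open>The covering forces \<open>\<nu> > 1/2\<close>, so that the floor in the constants is nonnegative.\<close>
  have \<nu>_gt: "\<nu> > 1 / 2"
  proof (rule ccontr)
    assume neg: "\<not> \<nu> > 1 / 2"
    \<comment> \<open>For \<open>\<nu> \<le> 1/2\<close> the covering bounds
      \<open>\<phi>\<^sub>i t\<close> away from 0 as \<open>t\<close> tends to 0, against continuity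
      at 0.\<close>
    have low: "c * \<phi>\<^sub>i s \<le> \<phi>\<^sub>i t" if "0 < t" "t \<le> s" for t
    proof -
      have "s powr (\<nu> - 1/2) \<le> t powr (\<nu> - 1/2)" using neg that by (intro powr_mono2') auto
      then have "\<phi>\<^sub>i s * (c * s powr (\<nu> - 1/2)) \<le> \<phi>\<^sub>i s * (c * t powr (\<nu> - 1/2))"
        using \<phi>i_pos[OF s0] c0 by (intro mult_left_mono) auto
      also have "\<dots> \<le> \<phi>\<^sub>i t * s powr (\<nu> - 1/2)" by (rule cover'') (use that in auto)
      finally have "(c * \<phi>\<^sub>i s) * s powr (\<nu> - 1/2) \<le> \<phi>\<^sub>i t * s powr (\<nu> - 1/2)" by (simp add: mult_ac)
      then show ?thesis by (rule mult_right_le_imp_le) (use s0 in simp)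
    qed
    have e: "c * \<phi>\<^sub>i s > 0" using c0 \<phi>i_pos[OF s0] by simp
    obtain d where d: "d > 0" "\<And>x. x \<in> {0..} \<Longrightarrow> dist x 0 < d \<Longrightarrow> dist (\<phi>\<^sub>i x) (\<phi>\<^sub>i 0) < c * \<phi>\<^sub>i s"
      using \<phi>i_cont e unfolding continuous_on_iff by (metis atLeast_iff order.refl)
    define t where "t = min s (d / 2)"
    have t: "0 < t" "t \<le> s" "t < d" using d s0 by (auto simp: t_def)
    show False using low[OF t(1,2)] d(2)[of t] t by (simp add: \<phi>i_0 dist_real_def)
  qed
  define m where "m = nat \<lfloor>\<nu> - 1 / 2\<rfloor>"
  define \<theta> where "\<theta> = \<nu> - 1 / 2 - real m"
  have m: "\<nu>\<^sub>b = real m" using \<nu>_gt unfolding \<nu>\<^sub>b_def m_def by simp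
  have \<theta>: "0 \<le> \<theta>" "\<theta> < 1" using m unfolding \<theta>_def \<nu>\<^sub>b_def by linarith+
  have \<nu>: "\<nu> = real m + \<theta> + 1 / 2" by (simp add: \<theta>_def)
  define mc where "mc = max 1 (1 / c)"
  \<comment> \<open>Normalised so that
    \<open>M0 * lam powr \<nu> = mc * \<phi>\<^sub>i lam * sqrt lam\<close>, the shape of the last
    term of the bound. In \<open>mc\<close>, the 1 serves \<open>\<mu> \<le> lam\<close> by
    monotonicity and \<open>1 / c\<close> serves \<open>\<mu> > lam\<close> by covering.\<close>
  define M0 where "M0 = mc * \<phi>\<^sub>i lam * lam powr (- (real m + \<theta>))"
  have mc: "mc \<ge> 1" "mc \<ge> 1 / c" by (auto simp: mc_def)
  have M00: "M0 \<ge> 0" using mc \<phi>i_pos[OF lam(1)] by (simp add: M0_def)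
  have \<phi>i_bound: "\<bar>\<phi>\<^sub>i \<mu>\<bar> \<le> M0 * (\<mu> + lam) powr (real m + \<theta>)" if \<mu>: "\<mu> \<in> {0..s}" for \<mu>
  proof -
    let ?e = "real m + \<theta>"
    have e: "?e \<ge> 0" "?e = \<nu> - 1/2" using \<theta> \<nu> by auto
    have "\<phi>\<^sub>i \<mu> \<le> M0 * (\<mu> + lam) powr ?e"
    proof (cases "\<mu> \<le> lam")
      case True
      have "\<phi>\<^sub>i \<mu> \<le> \<phi>\<^sub>i lam" using \<phi>i_le True \<mu> by simp
      also have "\<dots> \<le> mc * \<phi>\<^sub>i lam" using mc \<phi>i_pos[OF lam(1)] by simp
      also have "\<dots> = M0 * lam powr ?e"
      proof -
        have "lam powr (- ?e) * lam powr ?e = 1" unfolding powr_add[symmetric] using lam by simp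
        then show ?thesis by (simp only: M0_def mult.assoc mult_1_right)
      qed
      also have "\<dots> \<le> M0 * (\<mu> + lam) powr ?e" using M00 \<mu> lam e by (intro mult_left_mono powr_mono2) auto
      finally show ?thesis .
    next
      case False
      have le: "\<phi>\<^sub>i \<mu> * (c * lam powr ?e) \<le> \<phi>\<^sub>i lam * \<mu> powr ?e"
        using cover''[of lam \<mu>] False \<mu> lam unfolding e(2) by simp
      have "\<phi>\<^sub>i \<mu> \<le> (1 / c) * (\<phi>\<^sub>i lam * lam powr (- ?e) * \<mu> powr ?e)"
      proof -
        have "x \<le> (1 / c) * (a * (1 / q) * y)" if "x * (c * q) \<le> a * y" "q > 0" for x a y q :: real
          using that c0 by (simp add: field_simps)
        from this[OF le] lam
        show ?thesis unfolding powr_minus_divide by simp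
      qed
      also have "\<dots> \<le> mc * (\<phi>\<^sub>i lam * lam powr (- ?e) * \<mu> powr ?e)"
        using mc \<phi>i_pos[OF lam(1)] by (intro mult_right_mono) auto
      also have "\<dots> = M0 * \<mu> powr ?e" by (simp add: M0_def)
      also have "\<dots> \<le> M0 * (\<mu> + lam) powr ?e" using M00 \<mu> lam e by (intro mult_left_mono powr_mono2) auto
      finally show ?thesis .
    qed
    moreover have "\<phi>\<^sub>i \<mu> \<ge> 0" using \<phi>i_le[of 0 \<mu>] \<phi>i_0 \<mu> by simp
    ultimately show ?thesis by simp
  qed
  have bdd_\<phi>i: "bounded (\<phi>\<^sub>i ` {0..s})"
  proof (rule boundedI)
    fix y assume "y \<in> \<phi>\<^sub>i ` {0..s}"
    then obtain x where "x \<in> {0..s}" "y = \<phi>\<^sub>i x" by blast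
    then show "norm y \<le> \<phi>\<^sub>i s" using \<phi>i_le[of x s] \<phi>i_le[of 0 x] \<phi>i_0 by simp
  qed
  define \<Gamma> where "\<Gamma> = \<gamma>\<^sub>\<nu> + \<gamma>"
  have \<Gamma>0: "\<Gamma> \<ge> 0" using \<gamma>\<nu>0 \<gamma>1 by (simp add: \<Gamma>_def)
  have r_bound: "\<bar>1 - \<sigma> * g lam \<sigma>\<bar> * (\<sigma> + lam) powr t \<le> 2 powr t * \<Gamma> * lam powr t"
    if "\<sigma> \<in> {0..s}" "0 \<le> t" "t \<le> \<nu>" for \<sigma> t
    unfolding \<Gamma>_def
    by (rule residual_weight_bound[where s = s and r = "\<lambda>\<sigma>. 1 - \<sigma> * g lam \<sigma>" and \<nu> = \<nu>])
      (use lam that \<gamma>1 \<gamma>\<nu>0 regD(3) qb in auto)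
  have g_bound: "\<bar>g lam \<sigma>\<bar> * (\<sigma> + lam) \<le> B + D" if "\<sigma> \<in> {0<..s}" for \<sigma>
  proof -
    have "\<bar>g lam \<sigma>\<bar> * (\<sigma> + lam) = \<bar>\<sigma> * g lam \<sigma>\<bar> + \<bar>g lam \<sigma>\<bar> * lam" using that by (simp add: abs_mult algebra_simps)
    also have "\<dots> \<le> D + (B / lam) * lam" using regD(1,2)[OF that] lam by (intro add_mono mult_right_mono) auto
    finally show ?thesis using lam by simp
  qed
  \<comment> \<open>The value \<open>g lam 0\<close> is arbitrary, but a single number does not
    affect boundedness.\<close>
  have bdd_g: "bounded (g lam ` {0..s})"
  proof (rule boundedI)
    fix y assume "y \<in> g lam ` {0..s}"
    then obtain x where "x \<in> {0..s}" "y = g lam x" by blast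
    then show "norm y \<le> max \<bar>g lam 0\<bar> (B / lam)" using regD(2)[of x] by (cases "x = 0") auto
  qed

  have symC: "symmetric C\<^sub>X" unfolding C_eq by (rule cs.C_symmetric)
  have "bounded (\<phi>\<^sub>i ` eigenvalues C\<^sub>X)"
  proof (rule bounded_subset[OF bdd_\<phi>i])
    have "\<mu> \<in> {0..s}" if "\<mu> \<in> eigenvalues C\<^sub>X" for \<mu>
      using eigenvalue_nonneg[OF cs.C_nonneg that[unfolded C_eq]] eigenvalue_le[OF cs.norm_C_le that[unfolded C_eq]] \<kappa>s by auto
    then show "\<phi>\<^sub>i ` eigenvalues C\<^sub>X \<subseteq> \<phi>\<^sub>i ` {0..s}" by blast
  qed
  then have "symmetric (fun_calc \<phi>\<^sub>i C\<^sub>X)" unfolding symmetric_def using fun_calc_symmetric[OF symC] by blast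
  then have hsCs: "hilbert_schmidt C\<^sub>s" unfolding C\<^sub>s_def by (rule hilbert_schmidt_comp_symmetric(1)[OF C\<^sub>o])
  define H where "H = hs_norm C\<^sub>s"
  have H0: "H \<ge> 0" by (simp add: H_def hs_norm_nonneg)
  have Cs_bd: "norm (C\<^sub>s (\<phi> x)) \<le> \<kappa> * H" for x
    using norm_le_hs_norm[OF hsCs, of "\<phi> x"] mult_left_mono[OF \<phi>_bd[of x] H0] by (simp add: H_def mult.commute)
  have Cs_meas: "(\<lambda>x. C\<^sub>s (\<phi> x)) \<in> borel_measurable borel"
    by (rule measurable_compose[OF \<phi>_meas]) (intro borel_measurable_continuous_onI continuous_intros)
  \<comment> \<open>The factor 2 makes \<open>eps1\<close> equal to \<open>B\<^sub>n * L\<close>,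
    which the hypothesis bounds by \<open>sqrt lam / 2\<close>. In \<open>eps2\<close> the factor
    \<open>5 / 2\<close>, multiplied by \<open>2 * (B + D)\<close>, yields the 10 and the 5 in
    \<open>A\<^sub>1\<close> and \<open>A\<^sub>2\<close>.\<close>
  define eps1 where "eps1 = 2 * L * (2 * b * \<kappa>\<^sup>2 / sqrt lam / real n + sqrt (b * \<kappa>\<^sup>2 * cs.N) / sqrt (real n))"
  define eps2 where "eps2 = 5 / 2 * L * (2 * b * M * \<kappa> / sqrt lam / real n + M * sqrt (b * cs.N) / sqrt (real n))"
  have eps1_eq: "eps1 = B\<^sub>n * L"
    by (simp add: eps1_def B\<^sub>n_def N_eq real_sqrt_divide)
  define PM where "PM = Pi\<^sub>M {..<n} (\<lambda>_. p)"
  interpret PM: prob_space PM unfolding PM_def by (rule prob_space_PiM) (rule p(1))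
  define d1 where "d1 z = sqrt (weighted_ip cs.op.R (\<Sum>i<n. (\<beta> (fst (z i)) *\<^sub>R tensor_op (\<phi> (fst (z i))) (\<phi> (fst (z i))) - cov_op q\<^sub>X \<phi>))
               (\<Sum>i<n. (\<beta> (fst (z i)) *\<^sub>R tensor_op (\<phi> (fst (z i))) (\<phi> (fst (z i))) - cov_op q\<^sub>X \<phi>))) / real n"
    for z :: "nat \<Rightarrow> 'x \<times> 'y"
  define d2 where "d2 z = sqrt (weighted_ip cs.op.R (\<Sum>i<n. \<beta> (fst (z i)) *\<^sub>R tensor_op (\<phi> (fst (z i))) (snd (z i) - C\<^sub>s (\<phi> (fst (z i)))))
               (\<Sum>i<n. \<beta> (fst (z i)) *\<^sub>R tensor_op (\<phi> (fst (z i))) (snd (z i) - C\<^sub>s (\<phi> (fst (z i)))))) / real n"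
    for z :: "nat \<Rightarrow> 'x \<times> 'y"
  define F1 where "F1 = {z \<in> space PM. d1 z > eps1}"
  define F2 where "F2 = {z \<in> space PM. d2 z > eps2}"
  have F1: "F1 \<in> sets PM" "measure PM F1 \<le> tail_level 2 L"
    unfolding F1_def PM_def d1_def eps1_def
    by (rule cs.covariance_deviation[OF n L0 order.refl])+
  have F2: "F2 \<in> sets PM" "measure PM F2 \<le> tail_level (5 / 2) L"
    unfolding F2_def PM_def d2_def eps2_def M_def H_def[symmetric]
    by (rule cs.noise_deviation[OF K y_bound Cs_meas Cs_bd source n L0], simp)+
  define E where "E = space PM - (F1 \<union> F2)"
  have E: "E \<in> sets PM" unfolding E_def using F1 F2 by auto
  have "measure PM (F1 \<union> F2) \<le> measure PM F1 + measure PM F2"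
    by (rule measure_Un_le) (use F1 F2 in auto)
  also have "\<dots> \<le> tail_level 2 L + tail_level (5 / 2) L" using F1 F2 by simp
  also have "\<dots> \<le> \<delta>" using tail_level_union[OF L2] expL by simp
  finally have probE: "measure PM E \<ge> 1 - \<delta>"
    unfolding E_def using PM.prob_compl[of "F1 \<union> F2"] F1 F2 by auto
  have f_meas: "regression_fun K \<in> borel_measurable borel"
    unfolding regression_fun_def
    by (rule measurable_compose[OF measurable_prob_algebraD[OF K(1)]]) measurable
  have final: "2 powr (2 * \<nu> - real m) * M0 * \<Gamma> * lam powr \<nu> * hs_norm C\<^sub>o
        + real m * 2 ^ m * \<Gamma> * eps1 * H + 2 * (B + D) * eps2
      \<le> (A\<^sub>1 / real n * sqrt (1 / lam) + A\<^sub>2 * sqrt (\<N> / real n)) * L + A\<^sub>3 * sqrt lam * \<phi>\<^sub>i lam"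
  proof -
    define W where "W = 2 powr (2 * \<nu> - real m) * \<Gamma> * mc"
    have W0: "W \<ge> 0" using \<Gamma>0 mc by (simp add: W_def)
    have "M0 * lam powr \<nu> = mc * \<phi>\<^sub>i lam * sqrt lam"
    proof -
      have "lam powr (- (real m + \<theta>)) * lam powr \<nu> = sqrt lam"
        unfolding powr_add[symmetric] using lam by (simp add: \<nu> powr_half_sqrt)
      then show ?thesis by (simp add: M0_def mult.assoc)
    qed
    then have 1: "2 powr (2 * \<nu> - real m) * M0 * \<Gamma> * lam powr \<nu> * hs_norm C\<^sub>o = A\<^sub>3 * sqrt lam * \<phi>\<^sub>i lam"
      by (simp add: A\<^sub>3_def m \<Gamma>_def mc_def mult_ac)
    \<comment> \<open>The telescoping term carries only \<open>2 ^ m\<close>; it is enlarged to the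
      factor of the leading term, which is possible as \<open>\<nu> \<ge> m\<close>.\<close>
    have "2 ^ m \<le> (2::real) powr (2 * \<nu> - real m)"
    proof -
      have "(2::real) ^ m = 2 powr real m" by (simp add: powr_realpow)
      also have "\<dots> \<le> 2 powr (2 * \<nu> - real m)" using \<theta> by (intro powr_mono) (auto simp: \<nu>)
      finally show ?thesis .
    qed
    then have "2 ^ m * \<Gamma> \<le> 2 powr (2 * \<nu> - real m) * \<Gamma>" using \<Gamma>0 by (intro mult_right_mono) auto
    also have "\<dots> \<le> W" unfolding W_def using \<Gamma>0 mc(1) mult_left_mono[of 1 mc "2 powr (2 * \<nu> - real m) * \<Gamma>"] by simp
    finally have "2 ^ m * \<Gamma> \<le> W" .
    moreover have eps1_0: "eps1 \<ge> 0"
      unfolding eps1_def using L0 b1 cs.N_nonneg lam by (intro mult_nonneg_nonneg add_nonneg_nonneg) auto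
    ultimately have "(2 ^ m * \<Gamma>) * (real m * eps1 * H) \<le> W * (real m * eps1 * H)"
      using H0 by (intro mult_right_mono) auto
    then have 2: "real m * 2 ^ m * \<Gamma> * eps1 * H \<le> real m * W * H * eps1" by (simp add: mult_ac)
    \<comment> \<open>The 4 and the 2 here become the \<open>+ 2\<close> and the \<open>+ 1\<close>
      in the exponents of \<open>A\<^sub>1\<close> and \<open>A\<^sub>2\<close>.\<close>
    have eps1': "eps1 = (4 * b * \<kappa>\<^sup>2 / real n * sqrt (1 / lam) + 2 * sqrt b * \<kappa> * sqrt (\<N> / real n)) * L"
      using \<kappa> by (simp add: eps1_def N_eq real_sqrt_mult real_sqrt_divide algebra_simps)
    have eps2': "2 * (B + D) * eps2 = (10 * b * M * \<kappa> * (B + D) / real n * sqrt (1 / lam) + 5 * M * sqrt b * (B + D) * sqrt (\<N> / real n)) * L"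
    proof -
      define i j where "i = b * M * \<kappa> / sqrt lam / real n" and "j = M * sqrt b * sqrt cs.N / sqrt (real n)"
      have "eps2 = 5 / 2 * L * (2 * i + j)" by (simp add: eps2_def i_def j_def real_sqrt_mult)
      moreover have "10 * b * M * \<kappa> * G / real n * sqrt (1 / lam) = 10 * G * i" for G
        by (simp add: i_def real_sqrt_divide mult_ac)
      moreover have "5 * M * sqrt b * G * sqrt (\<N> / real n) = 5 * G * j" for G
        by (simp add: j_def N_eq real_sqrt_divide mult_ac)
      moreover have "2 * G * (5 / 2 * L * (2 * i + j)) = (10 * G * i + 5 * G * j) * L" for G
        by (simp add: algebra_simps)
      ultimately show ?thesis by (simp only:)
    qed
    have p1: "2 powr (2 * \<nu> - \<nu>\<^sub>b + 2) = 4 * 2 powr (2 * \<nu> - real m)" "2 powr (2 * \<nu> - \<nu>\<^sub>b + 1) = 2 * 2 powr (2 * \<nu> - real m)"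
      by (simp_all add: m powr_add)
    have A1: "A\<^sub>1 = 4 * W * real m * b * \<kappa>\<^sup>2 * H + 10 * b * M * \<kappa> * (B + D)"
      unfolding A\<^sub>1_def p1 by (simp add: m W_def \<Gamma>_def mc_def H_def)
    have A2: "A\<^sub>2 = 2 * W * real m * sqrt b * \<kappa> * H + 5 * M * sqrt b * (B + D)"
      unfolding A\<^sub>2_def p1 by (simp add: m W_def \<Gamma>_def mc_def H_def)
    have "real m * W * H * eps1 + 2 * (B + D) * eps2 = (A\<^sub>1 / real n * sqrt (1 / lam) + A\<^sub>2 * sqrt (\<N> / real n)) * L"
      unfolding eps1' eps2' A1 A2 by (simp add: add_divide_distrib algebra_simps)
    then show ?thesis using 1 2 by linarith
  qed
  have main: "in_L2 q\<^sub>X (\<lambda>x. regression_fun K x - estimator \<phi> \<beta> g lam n z x) \<and>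
      L2_norm q\<^sub>X (\<lambda>x. regression_fun K x - estimator \<phi> \<beta> g lam n z x)
        \<le> (A\<^sub>1 / real n * sqrt (1 / lam) + A\<^sub>2 * sqrt (\<N> / real n)) * L + A\<^sub>3 * sqrt lam * \<phi>\<^sub>i lam"
    if z: "z \<in> E" for z
  proof -
    have dz: "d1 z \<le> eps1" "d2 z \<le> eps2" using z by (auto simp: E_def F1_def F2_def)
    let ?S = "emp_cross_cov \<phi> \<beta> n z o\<^sub>L fun_calc (g lam) (emp_cov \<phi> \<beta> n z)"
    have est: "estimator \<phi> \<beta> g lam n z x = ?S (\<phi> x)" for x by (simp add: estimator_def)
    have Cs_eq: "C\<^sub>s = C\<^sub>o o\<^sub>L fun_calc \<phi>\<^sub>i (cov_op q\<^sub>X \<phi>)" by (simp add: C\<^sub>s_def C_eq)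
    have eps1_le: "eps1 \<le> sqrt lam / 2" unfolding eps1_eq using B\<^sub>n_le by (simp add: L_def)
    have BD0: "0 \<le> B + D" using B0 by simp
    have err: "sqrt (\<integral>x. (norm (C\<^sub>s (\<phi> x) - ?S (\<phi> x)))\<^sup>2 \<partial>q\<^sub>X)
       \<le> 2 powr (2 * \<nu> - real m) * M0 * \<Gamma> * lam powr \<nu> * hs_norm C\<^sub>o
        + real m * 2 ^ m * \<Gamma> * eps1 * hs_norm C\<^sub>s + 2 * (B + D) * eps2"
      by (rule cs.sample_error[OF n C\<^sub>o Cs_eq dz[unfolded d1_def d2_def] eps1_le s \<kappa>s bdd_\<phi>i \<phi>i_bound M00
            \<theta> \<nu> r_bound \<Gamma>0 bdd_g g_bound BD0])
    \<comment> \<open>The source condition identifies the regression function almost everywhere for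
      \<open>q\<^sub>X\<close>, which is all that the \<open>L2\<close> norm sees.\<close>
    have ae: "AE x in q\<^sub>X. (norm (regression_fun K x - estimator \<phi> \<beta> g lam n z x))\<^sup>2 = (norm ((C\<^sub>s - ?S) (\<phi> x)))\<^sup>2"
      using source by eventually_elim (simp add: est blinfun.diff_left)
    have S_meas: "(\<lambda>x. ?S (\<phi> x)) \<in> borel_measurable borel"
      by (rule measurable_compose[OF \<phi>_meas]) (intro borel_measurable_continuous_onI continuous_intros)
    have m1: "(\<lambda>x. regression_fun K x - estimator \<phi> \<beta> g lam n z x) \<in> borel_measurable q\<^sub>X"
      unfolding measurable_cong_sets[OF cs.sets_M refl] est using f_meas S_meas by (rule borel_measurable_diff)
    have m2: "(\<lambda>x. (norm (regression_fun K x - estimator \<phi> \<beta> g lam n z x))\<^sup>2) \<in> borel_measurable q\<^sub>X"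
      using m1 by measurable
    have i2: "integrable q\<^sub>X (\<lambda>x. (norm ((C\<^sub>s - ?S) (\<phi> x)))\<^sup>2)" by (rule cs.L2_integrable)
    have "integrable q\<^sub>X (\<lambda>x. (norm (regression_fun K x - estimator \<phi> \<beta> g lam n z x))\<^sup>2)"
      using integrable_cong_AE[OF m2 borel_measurable_integrable[OF i2] ae] i2 by blast
    moreover have "(\<integral>x. (norm (regression_fun K x - estimator \<phi> \<beta> g lam n z x))\<^sup>2 \<partial>q\<^sub>X) = (\<integral>x. (norm (C\<^sub>s (\<phi> x) - ?S (\<phi> x)))\<^sup>2 \<partial>q\<^sub>X)"
      using integral_cong_AE[OF m2 borel_measurable_integrable[OF i2] ae] by (simp add: blinfun.diff_left)
    ultimately show ?thesis
      unfolding in_L2_def L2_norm_def using m1 err final by (simp add: H_def)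
  qed
  show ?thesis
    using E probE main unfolding PM_def L_def by (intro bexI[of _ E]) auto
qed

end
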